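(* Let $k\ge 3$ be an integer. If the Prym-Green conjecture is true for a Prym-canonical binary curve $\tilde C$ of genus $2k$, embedded by $|\omega_{\tilde C}\otimes A'|$ (that is, $K_{p,2}(\tilde C,\omega_{\tilde C}\otimes A')=0$ for all $0\le p\le k-3$), then it is true for the Prym-canonical binary curve $C$ of genus $2k+1$, embedded by $|\omega_C\otimes A|$, for a generic choice of its parameters $a_{i,j}$ (that is, $K_{p,2}(C,\omega_C\otimes A)=0$ for all $0\le p\le k-3$).
   Context: We work over $\mathbb{C}$. A binary curve of genus $g$ is a stable curve consisting of two smooth rational components $C_1,C_2$ meeting transversally at $g+1$ points. Koszul cohomology: for a projective curve $C$ and a line bundle $L$ on $C$, $K_{p,q}(C,L)$ is the cohomology at the middle term of $$\Lambda^{p+1}H^0(L)\otimes H^0(L^{q-1})\to \Lambda^{p}H^0(L)\otimes H^0(L^{q})\to \Lambda^{p-1}H^0(L)\otimes H^0(L^{q+1}),$$ where the maps are $s_1\wedge\dots\wedge s_m\otimes u\mapsto\sum_{l}(-1)^l s_1\wedge\dots\wedge\hat{s_l}\wedge\dots\wedge s_m\otimes(s_lu)$. The Prym-Green conjecture is true for a curve $C$ of genus $g$ embedded by $|\omega_C\otimes A|$ if $K_{p,2}(C,\omega_C\otimes A)=0$ for all $0\le p\le\lfloor g/2\rfloor-3$. Prym-canonical binary curves of genus $g$ (the same construction is used for every genus): let $m=\lfloor g/2\rfloor$, let $a_{i,j}\in\mathbb{C}$ ($1\le i\le g-1$, $j=1,2$) be parameters, $M_j(t,u)=\prod_{r=1}^{g-1}(t-a_{r,j}u)$,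 $A_j=\prod_{i=1}^{g-1}a_{i,j}$, $d_2$ a nonzero constant and $d_1=-d_2A_1/A_2$. For $j=1,2$ let $C_j$ be the image of $\phi_j:\mathbb{P}^1\to\mathbb{P}^{g-2}$, $$\phi_j(t,u)=\Big[\tfrac{tM_j(t,u)}{t-a_{1,j}u},\dots,\tfrac{tM_j(t,u)}{t-a_{m,j}u},\tfrac{-M_j(t,u)d_ja_{m+1,j}u}{A_j(t-a_{m+1,j}u)},\dots,\tfrac{-M_j(t,u)d_ja_{g-1,j}u}{A_j(t-a_{g-1,j}u)}\Big].$$ Then $\phi_1,\phi_2$ both send $[a_{l,j},1]$ to the $l$-th coordinate point $P_l$ ($1\le l\le g-1$), $[0,1]$ to $P_g=[0,\dots,0,1,\dots,1]$ ($m$ zeros), and $[1,0]$ to $P_{g+1}=[1,\dots,1,0,\dots,0]$ ($m$ ones). It is known that for a general choice of the $a_{i,j}$, $C=C_1\cup C_2$ is a binary curve of genus $g$ with nodes $P_1,\dots,P_{g+1}$, embedded by the complete linear system $|\omega_C\otimes A|$ with $A\in\mathrm{Pic}^0(C)$ nontrivial and $A^{\otimes 2}\cong\mathcal{O}_C$; under $\mathrm{Pic}^0(C)\cong(\mathbb{C}^* )^{g+1}/\mathbb{C}^*$ the bundle $A$ corresponds to $[(h_1,\dots,h_{g+1})]$ with $h_i=1$ for $i\le m$, $h_i=-1$ for $m+1\le i\le g$, $h_{g+1}=1$. Such a curve $C\subset\mathbb{P}^{g-2}$ is called here a Prym-canonical binary curve of genus $g$. "Generic choice of the parameters" means for all parameters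 in a nonempty Zariski open subset of the parameter space $\mathbb{C}^{2(g-1)}$. *)

theory Defs
  imports "HOL-Analysis.Analysis" "HOL-Computational_Algebra.Polynomial" "HOL-Library.Poly_Mapping"
begin

section \<open>Binary forms\<close>

text \<open>
  A binary form \<open>\<Sum>i\<le>d. c\<^sub>i t\<^sup>i u\<^sup>d\<^sup>-\<^sup>i\<close> of degree \<open>d\<close> is represented by its dehomogenization at
  \<open>u = 1\<close>, a polynomial of degree at most \<open>d\<close>; there are no nonzero forms of negative degree.
  A point of the projective line is given by a representative \<open>(t, u) \<noteq> (0, 0)\<close>.
\<close>

definition forms :: "int \<Rightarrow> complex poly set" where
  "forms d = {f. f = 0 \<or> int (degree f) \<le> d}"

definition form_eval :: "int \<Rightarrow> complex poly \<Rightarrow> complex \<times> complex \<Rightarrow> complex" where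
  "form_eval d f v = (\<Sum>i\<le>nat d. coeff f i * fst v ^ i * snd v ^ (nat d - i))"

definition form_dderiv :: "int \<Rightarrow> complex poly \<Rightarrow> complex \<times> complex \<Rightarrow> complex \<times> complex \<Rightarrow> complex" where
  "form_dderiv d f v w = deriv (\<lambda>z. form_eval d f (fst v + z * fst w, snd v + z * snd w)) 0"

text \<open>Nonzero vectors \<open>v\<close>, \<open>w\<close> represent the same point iff \<open>cross v w = 0\<close>.\<close>

definition cross :: "complex \<times> complex \<Rightarrow> complex \<times> complex \<Rightarrow> complex" where
  "cross v w = fst v * snd w - snd v * fst w"

section \<open>Binary curves and their line bundles\<close>

text \<open>
  The two components are copies of the projective line, indexed by the two-element type \<open>2\<close>
  (with elements \<open>1\<close> and \<open>2\<close>); for \<open>1 \<le> l \<le> genus + 1\<close> the point \<open>node l 1\<close> of the first one is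
  glued transversally to the point \<open>node l 2\<close> of the second one.
\<close>

record bin_curve =
  genus :: nat
  node :: "nat \<Rightarrow> 2 \<Rightarrow> complex \<times> complex"

definition binary_curve :: "bin_curve \<Rightarrow> bool" where
  "binary_curve X \<longleftrightarrow> genus X \<ge> 2 \<and>
     (\<forall>j. \<forall>l\<in>{1..genus X + 1}. node X l j \<noteq> (0, 0)) \<and>
     (\<forall>j. \<forall>l\<in>{1..genus X + 1}. \<forall>r\<in>{1..genus X + 1}. l \<noteq> r \<longrightarrow> cross (node X l j) (node X r j) \<noteq> 0)"

text \<open>
  A line bundle is \<open>O(deg 1)\<close> and \<open>O(deg 2)\<close> on the two components, together with an identification
  of the fibres at each node. The vector \<open>node l j\<close> trivializes the fibre of \<open>O(d)\<close> at that point, and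
  sections \<open>s\<^sub>1\<close>, \<open>s\<^sub>2\<close> agree at the node iff \<open>s\<^sub>1(node l 1) = glue l * s\<^sub>2(node l 2)\<close>.
\<close>

record line_bundle =
  deg :: "2 \<Rightarrow> int"
  glue :: "nat \<Rightarrow> complex"

definition tensor :: "line_bundle \<Rightarrow> line_bundle \<Rightarrow> line_bundle" where
  "tensor L M = \<lparr>deg = (\<lambda>j. deg L j + deg M j), glue = (\<lambda>l. glue L l * glue M l)\<rparr>"

definition tensor_power :: "line_bundle \<Rightarrow> int \<Rightarrow> line_bundle" where
  "tensor_power L q = \<lparr>deg = (\<lambda>j. q * deg L j), glue = (\<lambda>l. glue L l powi q)\<rparr>"

type_synonym sec = "complex poly ^ 2"

definition sections :: "bin_curve \<Rightarrow> line_bundle \<Rightarrow> sec set" where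
  "sections X L = {s. (\<forall>j. s $ j \<in> forms (deg L j)) \<and>
     (\<forall>l\<in>{1..genus X + 1}. form_eval (deg L 1) (s $ 1) (node X l 1)
        = glue L l * form_eval (deg L 2) (s $ 2) (node X l 2))}"

definition sec_scale :: "complex \<Rightarrow> sec \<Rightarrow> sec" where
  "sec_scale c s = (\<chi> j. smult c (s $ j))"

text \<open>
  Sections of the dualizing sheaf are pairs of rational differentials with at most simple poles at the
  node points and opposite residues at the two branches of each node. On the component \<open>j\<close> such a
  differential is \<open>s (u dt - t du) / \<Prod>\<^sub>r cross (t, u) (node r j)\<close> with \<open>s\<close> a form of degree
  \<open>genus - 1\<close>. As the differential of the linear form \<open>cross (t, u) x\<close> at \<open>x\<close> is \<open>u dt - t du\<close>, its
  residue at \<open>node l j\<close> is \<open>s (node l j) / res_denom X l j\<close>.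
\<close>

definition res_denom :: "bin_curve \<Rightarrow> nat \<Rightarrow> 2 \<Rightarrow> complex" where
  "res_denom X l j = (\<Prod>r\<in>{1..genus X + 1} - {l}. cross (node X l j) (node X r j))"

definition dualizing :: "bin_curve \<Rightarrow> line_bundle" where
  "dualizing X = \<lparr>deg = (\<lambda>j. int (genus X) - 1),
                  glue = (\<lambda>l. - (res_denom X l 1 / res_denom X l 2))\<rparr>"

section \<open>Embeddings by complete linear systems\<close>

text \<open>
  \<open>embedded_by X L N \<phi>\<close>: the maps \<open>[\<phi> j 1, \<dots>, \<phi> j N]\<close> (\<open>j = 1, 2\<close>) are the restrictions to the
  components of an embedding of \<open>X\<close> by the complete linear system of \<open>L\<close>. The first conjunct says that,
  up to a factor on each component (i.e. up to an isomorphism of \<open>L\<close>), the \<open>\<phi> _ l\<close> form a basis of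
  the space of sections. The remaining ones say that the maps are defined everywhere, that each
  of them is injective, that the two images meet only at the images of the nodes, that each map is
  an immersion, and that the two branches have distinct tangent lines at each node. Tangent vectors
  are computed on the affine cones.
\<close>

definition embedded_by ::
    "bin_curve \<Rightarrow> line_bundle \<Rightarrow> nat \<Rightarrow> (2 \<Rightarrow> nat \<Rightarrow> complex poly) \<Rightarrow> bool" where
  "embedded_by X L N \<phi> \<longleftrightarrow>
     (\<exists>c :: 2 \<Rightarrow> complex. (\<forall>j. c j \<noteq> 0) \<and>
        (let b = (\<lambda>l. \<chi> j. smult (c j) (\<phi> j l)) :: nat \<Rightarrow> sec in
           (\<forall>l\<in>{1..N}. b l \<in> sections X L) \<and>
           (\<forall>s\<in>sections X L. \<exists>!w. w \<in> {1..N} \<rightarrow>\<^sub>E UNIV \<and> s = (\<Sum>l=1..N. sec_scale (w l) (b l))))) \<and>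
     (\<forall>j v. v \<noteq> (0, 0) \<longrightarrow> (\<exists>l\<in>{1..N}. form_eval (deg L j) (\<phi> j l) v \<noteq> 0)) \<and>
     (\<forall>j v w c. v \<noteq> (0, 0) \<longrightarrow> w \<noteq> (0, 0) \<longrightarrow>
        (\<forall>l\<in>{1..N}. form_eval (deg L j) (\<phi> j l) w = c * form_eval (deg L j) (\<phi> j l) v) \<longrightarrow>
        cross v w = 0) \<and>
     (\<forall>v w c. v \<noteq> (0, 0) \<longrightarrow> w \<noteq> (0, 0) \<longrightarrow>
        (\<forall>l\<in>{1..N}. form_eval (deg L 2) (\<phi> 2 l) w = c * form_eval (deg L 1) (\<phi> 1 l) v) \<longrightarrow>
        (\<exists>r\<in>{1..genus X + 1}. cross v (node X r 1) = 0 \<and> cross w (node X r 2) = 0)) \<and>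
     (\<forall>j v w c. v \<noteq> (0, 0) \<longrightarrow> cross v w \<noteq> 0 \<longrightarrow>
        (\<exists>l\<in>{1..N}. form_dderiv (deg L j) (\<phi> j l) v w \<noteq> c * form_eval (deg L j) (\<phi> j l) v)) \<and>
     (\<forall>r\<in>{1..genus X + 1}. \<forall>w1 w2 c c1 c2.
        cross (node X r 1) w1 \<noteq> 0 \<longrightarrow> cross (node X r 2) w2 \<noteq> 0 \<longrightarrow>
        (\<forall>l\<in>{1..N}. c * form_eval (deg L 1) (\<phi> 1 l) (node X r 1)
            + c1 * form_dderiv (deg L 1) (\<phi> 1 l) (node X r 1) w1
            + c2 * form_dderiv (deg L 2) (\<phi> 2 l) (node X r 2) w2 = 0) \<longrightarrow>
        c = 0 \<and> c1 = 0 \<and> c2 = 0)"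

section \<open>Koszul cohomology\<close>

text \<open>
  \<open>\<Lambda>\<^sup>p V \<otimes> W\<close> is the quotient of the free abelian group on the pairs \<open>(vs, u)\<close>, with \<open>vs\<close> a list of
  length \<open>p\<close> in \<open>V\<close> and \<open>u\<close> in \<open>W\<close> (standing for the wedge product of \<open>vs\<close>, tensor \<open>u\<close>), by the
  subgroup \<open>wedge_rel V W p\<close>. The complex scalars enter through the rule \<open>scale\<close>.
\<close>

definition wedge_free :: "sec set \<Rightarrow> sec set \<Rightarrow> nat \<Rightarrow> (sec list \<times> sec \<Rightarrow>\<^sub>0 int) set" where
  "wedge_free V W p = {x. Poly_Mapping.keys x \<subseteq> {(vs, u). length vs = p \<and> set vs \<subseteq> V \<and> u \<in> W}}"

inductive_set wedge_rel :: "sec set \<Rightarrow> sec set \<Rightarrow> nat \<Rightarrow> (sec list \<times> sec \<Rightarrow>\<^sub>0 int) set"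
  for V W p where
  zero: "0 \<in> wedge_rel V W p"
| diff: "x \<in> wedge_rel V W p \<Longrightarrow> y \<in> wedge_rel V W p \<Longrightarrow> x - y \<in> wedge_rel V W p"
| add_wedge: "length as + length bs + 1 = p \<Longrightarrow> set as \<subseteq> V \<Longrightarrow> set bs \<subseteq> V \<Longrightarrow>
    v \<in> V \<Longrightarrow> w \<in> V \<Longrightarrow> u \<in> W \<Longrightarrow>
    frag_of (as @ [v + w] @ bs, u) - frag_of (as @ [v] @ bs, u) - frag_of (as @ [w] @ bs, u)
      \<in> wedge_rel V W p"
| add_tensor: "length vs = p \<Longrightarrow> set vs \<subseteq> V \<Longrightarrow> u \<in> W \<Longrightarrow> w \<in> W \<Longrightarrow>
    frag_of (vs, u + w) - frag_of (vs, u) - frag_of (vs, w) \<in> wedge_rel V W p"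
| scale: "length as + length bs + 1 = p \<Longrightarrow> set as \<subseteq> V \<Longrightarrow> set bs \<subseteq> V \<Longrightarrow>
    v \<in> V \<Longrightarrow> u \<in> W \<Longrightarrow>
    frag_of (as @ [sec_scale c v] @ bs, u) - frag_of (as @ [v] @ bs, sec_scale c u)
      \<in> wedge_rel V W p"
| alternating: "length vs = p \<Longrightarrow> set vs \<subseteq> V \<Longrightarrow> u \<in> W \<Longrightarrow>
    i < k \<Longrightarrow> k < p \<Longrightarrow> vs ! i = vs ! k \<Longrightarrow> frag_of (vs, u) \<in> wedge_rel V W p"

text \<open>List positions start at \<open>0\<close>, hence the sign \<open>(-1)\<^sup>l\<^sup>+\<^sup>1\<close>; products of sections are componentwise.\<close>

definition koszul_map :: "(sec list \<times> sec \<Rightarrow>\<^sub>0 int) \<Rightarrow> (sec list \<times> sec \<Rightarrow>\<^sub>0 int)" where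
  "koszul_map = frag_extend (\<lambda>(vs, u). \<Sum>l<length vs.
     frag_cmul ((-1) ^ (l + 1)) (frag_of (take l vs @ drop (l + 1) vs, vs ! l * u)))"

text \<open>
  Representatives in the free group of the kernel and of the image at the middle term defining
  \<open>K\<^sub>p\<^sub>,\<^sub>q\<close>. For \<open>p = 0\<close> the outgoing map vanishes, in accordance with \<open>\<Lambda>\<^sup>-\<^sup>1 = 0\<close>.
  Boundaries are always cycles, so vanishing of the cohomology is the reverse inclusion.
\<close>

definition koszul_cycles ::
    "bin_curve \<Rightarrow> line_bundle \<Rightarrow> nat \<Rightarrow> int \<Rightarrow> (sec list \<times> sec \<Rightarrow>\<^sub>0 int) set" where
  "koszul_cycles X L p q =
     {x \<in> wedge_free (sections X L) (sections X (tensor_power L q)) p.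
        koszul_map x \<in> wedge_rel (sections X L) (sections X (tensor_power L (q + 1))) (p - 1)}"

definition koszul_boundaries ::
    "bin_curve \<Rightarrow> line_bundle \<Rightarrow> nat \<Rightarrow> int \<Rightarrow> (sec list \<times> sec \<Rightarrow>\<^sub>0 int) set" where
  "koszul_boundaries X L p q =
     {koszul_map y + z | y z.
        y \<in> wedge_free (sections X L) (sections X (tensor_power L (q - 1))) (p + 1) \<and>
        z \<in> wedge_rel (sections X L) (sections X (tensor_power L q)) p}"

definition koszul_vanishes :: "bin_curve \<Rightarrow> line_bundle \<Rightarrow> nat \<Rightarrow> int \<Rightarrow> bool" where
  "koszul_vanishes X L p q \<longleftrightarrow> koszul_cycles X L p q \<subseteq> koszul_boundaries X L p q"

section \<open>Prym-canonical binary curves\<close>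

definition prym_curve :: "nat \<Rightarrow> (nat \<times> 2 \<Rightarrow> complex) \<Rightarrow> bin_curve" where
  "prym_curve g a = \<lparr>genus = g,
     node = (\<lambda>l j. if l \<le> g - 1 then (a (l, j), 1) else if l = g then (0, 1) else (1, 0))\<rparr>"

text \<open>The bundle \<open>A\<close>, of class \<open>(1, \<dots>, 1, -1, \<dots>, -1, 1)\<close> in the torus parametrizing bundles of bidegree
  \<open>(0, 0)\<close>.\<close>

definition prym_torsion :: "nat \<Rightarrow> line_bundle" where
  "prym_torsion g = \<lparr>deg = (\<lambda>j. 0), glue = (\<lambda>l. if l \<in> {g div 2 + 1..g} then -1 else 1)\<rparr>"

definition prym_canonical_bundle :: "nat \<Rightarrow> (nat \<times> 2 \<Rightarrow> complex) \<Rightarrow> line_bundle" where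
  "prym_canonical_bundle g a = tensor (dualizing (prym_curve g a)) (prym_torsion g)"

definition prym_A :: "nat \<Rightarrow> (nat \<times> 2 \<Rightarrow> complex) \<Rightarrow> 2 \<Rightarrow> complex" where
  "prym_A g a j = (\<Prod>i=1..g-1. a (i, j))"

definition prym_d :: "nat \<Rightarrow> (nat \<times> 2 \<Rightarrow> complex) \<Rightarrow> complex \<Rightarrow> 2 \<Rightarrow> complex" where
  "prym_d g a d2 j = (if j = 1 then - d2 * prym_A g a 1 / prym_A g a 2 else d2)"

text \<open>
  The coordinates of \<open>\<phi>\<^sub>j\<close>, forms of degree \<open>g - 1\<close>; the product is \<open>M\<^sub>j(t,u) / (t - a\<^sub>l\<^sub>,\<^sub>j u)\<close>, of
  degree \<open>g - 2\<close>. The factor \<open>t\<close> of the first coordinates is \<open>[:0, 1:]\<close>, while the factor \<open>u\<close> of the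
  last ones disappears in the dehomogenization.
\<close>

definition prym_map :: "nat \<Rightarrow> (nat \<times> 2 \<Rightarrow> complex) \<Rightarrow> complex \<Rightarrow> 2 \<Rightarrow> nat \<Rightarrow> complex poly" where
  "prym_map g a d2 j l =
     (let M = (\<Prod>r\<in>{1..g-1} - {l}. [:- a (r, j), 1:]) in
      if l \<le> g div 2 then [:0, 1:] * M
      else smult (- (prym_d g a d2 j * a (l, j) / prym_A g a j)) M)"

definition prym_canonical_binary_curve :: "nat \<Rightarrow> (nat \<times> 2 \<Rightarrow> complex) \<Rightarrow> complex \<Rightarrow> bool" where
  "prym_canonical_binary_curve g a d2 \<longleftrightarrow>
     binary_curve (prym_curve g a) \<and>
     embedded_by (prym_curve g a) (prym_canonical_bundle g a) (g - 1) (prym_map g a d2)"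

text \<open>The condition \<open>p + 3 \<le> g div 2\<close> is \<open>p \<le> g div 2 - 3\<close> without truncated subtraction.\<close>

definition prym_green :: "bin_curve \<Rightarrow> line_bundle \<Rightarrow> bool" where
  "prym_green X L \<longleftrightarrow> (\<forall>p. p + 3 \<le> genus X div 2 \<longrightarrow> koszul_vanishes X L p 2)"

section \<open>Zariski open sets of parameters\<close>

inductive polynomial_fun :: "'i set \<Rightarrow> (('i \<Rightarrow> complex) \<Rightarrow> complex) \<Rightarrow> bool" for I where
  const: "polynomial_fun I (\<lambda>x. c)"
| coord: "i \<in> I \<Longrightarrow> polynomial_fun I (\<lambda>x. x i)"
| add: "polynomial_fun I f \<Longrightarrow> polynomial_fun I h \<Longrightarrow> polynomial_fun I (\<lambda>x. f x + h x)"
| mult: "polynomial_fun I f \<Longrightarrow> polynomial_fun I h \<Longrightarrow> polynomial_fun I (\<lambda>x. f x * h x)"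

text \<open>Affine space with coordinates indexed by \<open>I\<close> consists of the functions extensional on \<open>I\<close>.\<close>

definition zariski_open :: "'i set \<Rightarrow> ('i \<Rightarrow> complex) set \<Rightarrow> bool" where
  "zariski_open I U \<longleftrightarrow>
     (\<exists>S. (\<forall>f\<in>S. polynomial_fun I f) \<and> U = {x \<in> I \<rightarrow>\<^sub>E UNIV. \<exists>f\<in>S. f x \<noteq> 0})"

definition prym_indices :: "nat \<Rightarrow> (nat \<times> 2) set" where
  "prym_indices g = {1..g-1} \<times> UNIV"

end

theory Submission
  imports Defs
begin

text \<open>
  Let \<open>C\<close> be a Prym-canonical binary curve of genus \<open>g = 2k + 1\<close>, let \<open>L\<close> be its line bundle and
  \<open>V\<close> the space of sections of \<open>L\<close>. Sections of \<open>L\<close> that vanish at a node \<open>P\<close> are sections of the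
  corresponding bundle on the partial normalization \<open>C\<^sub>P\<close> of \<open>C\<close> at \<open>P\<close>, multiplied by the two linear
  forms that vanish at the preimages of \<open>P\<close>; geometrically, \<open>C\<^sub>P\<close> is the image of \<open>C\<close> under the
  projection from \<open>P\<close>. If \<open>P\<close> is one of the \<open>k\<close> coordinate points \<open>P\<^sub>k\<^sub>+\<^sub>1, \<dots>, P\<^sub>2\<^sub>k\<close>, then \<open>C\<^sub>P\<close> is again a
  Prym-canonical binary curve, of genus \<open>2k\<close>, whose parameters are those of \<open>C\<close> without the ones of \<open>P\<close>.
  The theorem follows from two facts.

  (1) If \<open>K\<^sub>p\<^sub>,\<^sub>2\<close> vanishes for all these \<open>k\<close> projections and \<open>p + 3 \<le> k\<close>, it vanishes for \<open>C\<close>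
  (\<open>koszul_exact_from_projections\<close>). Write \<open>F\<^sup>q\<close> for pairs of forms of degree \<open>q (g - 1)\<close> on the two
  components, and \<open>T\<^sup>q\<close> for one number per node; sections of \<open>L\<^sup>q\<close> are the kernel of the map from \<open>F\<^sup>q\<close> to
  \<open>T\<^sup>q\<close> that compares the two values at each node. On a single component the Koszul complex is exact in
  the relevant degree, because \<open>V\<close> contains two forms without a common zero (\<open>component_exact\<close>). Hence
  a cycle \<open>Z\<close> of \<open>C\<close> is the differential of some \<open>Y\<close> with coefficients in \<open>F\<^sup>1\<close>, and the node values of
  \<open>Y\<close> form a cycle with coefficients in \<open>T\<^sup>1\<close>. Over a single node the Koszul complex is exact as well,
  so these node values are the differential of some \<open>w\<close>, an element of the \<open>p + 2\<close>-nd exterior power of \<open>V\<close>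
  tensor \<open>T\<^sup>0\<close>. A multi-index of length \<open>p + 2\<close> misses one of the \<open>k\<close> indices of the projecting nodes.
  So \<open>w\<close> is a sum of pieces each of which only involves sections vanishing at one node \<open>P\<close>; and since
  a function that is the same at all nodes comes from a constant on one component, one can arrange
  that the piece belonging to \<open>P\<close> also has the value \<open>0\<close> at \<open>P\<close>. Such a piece lives on \<open>C\<^sub>P\<close>. There it can be
  lifted to a cycle with coefficients in \<open>F\<^sup>1\<close>: the lift exists because the first cohomology of the bundle
  of \<open>C\<^sub>P\<close> vanishes (\<open>node_lift\<close>), and it can be corrected to a cycle because \<open>K\<^sub>p\<^sub>,\<^sub>2\<close> of \<open>C\<^sub>P\<close> vanishes
  (\<open>lift_cocycle\<close>). Subtracting these lifts from \<open>Y\<close> makes all node differences zero, and \<open>Z\<close> becomes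
  a boundary.

  (2) The vanishing of \<open>K\<^sub>p\<^sub>,\<^sub>2\<close> is an open condition on the parameters (\<open>koszul_exact_open\<close>). It
  says that a complex of matrices with polynomial entries is exact in the middle, which is shown to be
  open by Gaussian elimination (\<open>exactness_open\<close>). So it holds for generic curves of genus \<open>2k\<close>, and for
  generic \<open>C\<close> it holds for all \<open>k\<close> projections at once.

  Besides, the curves are embedded for generic parameters. It is enough that the pairs
  \<open>(a\<^sub>l\<^sub>,\<^sub>1, a\<^sub>l\<^sub>,\<^sub>2)\<close> have distinct nonzero coordinates, that no three of them are collinear and that no two are
  collinear with the origin (\<open>generic_params\<close>, \<open>prym_canonical\<close>); points of a parabola are an example.

  Exterior powers are handled through alternating functions on lists of basis indices; the
  theorem \<open>koszul_exact_iff\<close> is the bridge to the presentation by generators and relations.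
\<close>

section \<open>Koszul complexes of alternating cochains\<close>

text \<open>
  The ring of pairs of polynomials has zero divisors, so characteristic zero alone does not give that
  \<open>x = - x\<close> implies \<open>x = 0\<close>; this is what makes an antisymmetric function vanish on repeated arguments.
\<close>

class two_torsion_free = comm_ring_1 +
  assumes double_eq_0D: "x + x = 0 \<Longrightarrow> x = 0"

instance complex :: two_torsion_free
  by standard simp

instance poly :: (two_torsion_free) two_torsion_free
proof
  fix x :: "'a poly"
  assume "x + x = 0"
  then have "coeff x n + coeff x n = 0" for n by (metis coeff_0 coeff_add)
  then show "x = 0" by (intro poly_eqI) (simp add: double_eq_0D)
qed

instance vec :: (two_torsion_free, finite) two_torsion_free
  by standard (simp add: vec_eq_iff double_eq_0D)

lemma eq_uminus_self: "x = - x \<Longrightarrow> x = 0" for x :: "'m::two_torsion_free"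
  by (simp add: double_eq_0D eq_neg_iff_add_eq_0)

definition add_closed :: "'m::ab_group_add set \<Rightarrow> bool" where
  "add_closed M \<longleftrightarrow> 0 \<in> M \<and> (\<forall>x\<in>M. \<forall>y\<in>M. x - y \<in> M)"

lemma add_closedD:
  assumes "add_closed M"
  shows "0 \<in> M" "x \<in> M \<Longrightarrow> y \<in> M \<Longrightarrow> x - y \<in> M" "x \<in> M \<Longrightarrow> - x \<in> M"
    "x \<in> M \<Longrightarrow> y \<in> M \<Longrightarrow> x + y \<in> M"
proof -
  show 0: "0 \<in> M" and diff: "\<And>x y. x \<in> M \<Longrightarrow> y \<in> M \<Longrightarrow> x - y \<in> M"
    using assms by (auto simp: add_closed_def)
  show neg: "- x \<in> M" if "x \<in> M" for x using diff[OF 0 that] by simp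
  show "x + y \<in> M" if "x \<in> M" "y \<in> M" using diff[OF that(1) neg[OF that(2)]] by simp
qed

lemma add_closed_sum: "add_closed M \<Longrightarrow> (\<And>i. i \<in> A \<Longrightarrow> f i \<in> M) \<Longrightarrow> sum f A \<in> M"
  by (induction A rule: infinite_finite_induct) (auto intro: add_closedD)

lemma add_closed_UNIV [simp]: "add_closed UNIV"
  by (simp add: add_closed_def)

text \<open>
  Adjacent transpositions suffice, since they generate all permutations.
\<close>

definition alternating :: "('i list \<Rightarrow> 'm::ab_group_add) \<Rightarrow> bool" where
  "alternating w \<longleftrightarrow> (\<forall>xs i j ys. w (xs @ i # j # ys) = - w (xs @ j # i # ys))"

text \<open>
  Relative to a basis indexed by \<open>I\<close>, an element of the \<open>p\<close>-th exterior power with coefficients in \<open>M\<close> is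
  an antisymmetric array of coordinates. The array is extended by zero to lists of other lengths, so that
  the contraction of a cochain of degree \<open>0\<close> is zero.
\<close>

definition cochains :: "'i set \<Rightarrow> nat \<Rightarrow> 'm::ab_group_add set \<Rightarrow> ('i list \<Rightarrow> 'm) set" where
  "cochains I p M = {w. alternating w \<and> (\<forall>xs. w xs \<in> M) \<and>
     (\<forall>xs. w xs \<noteq> 0 \<longrightarrow> length xs = p \<and> set xs \<subseteq> I)}"

text \<open>
  The Koszul differential in coordinates, up to sign: multiplication by \<open>e i\<close> is combined with the
  contraction by the \<open>i\<close>-th dual basis vector, and antisymmetry makes explicit signs superfluous.
\<close>

definition contract :: "'i set \<Rightarrow> ('i \<Rightarrow> 'm) \<Rightarrow> ('i list \<Rightarrow> 'm) \<Rightarrow> 'i list \<Rightarrow> 'm::comm_ring_1" where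
  "contract I e w xs = (\<Sum>i\<in>I. e i * w (i # xs))"

text \<open>
  Exterior multiplication on the left by the vector with coordinates \<open>c\<close>, by expansion along the
  first index.
\<close>

fun vwedge :: "('i \<Rightarrow> 'm) \<Rightarrow> ('i list \<Rightarrow> 'm) \<Rightarrow> 'i list \<Rightarrow> 'm::comm_ring_1" where
  "vwedge c w [] = 0"
| "vwedge c w (i # xs) = c i * w xs - vwedge c (\<lambda>ys. w (i # ys)) xs"

lemma alternatingD: "alternating w \<Longrightarrow> w (xs @ i # j # ys) = - w (xs @ j # i # ys)"
  unfolding alternating_def by blast

lemma alternatingD0: "alternating w \<Longrightarrow> w (i # j # ys) = - w (j # i # ys)"
  using alternatingD[of w "[]" i j ys] by (simp only: append_Nil)

lemma alternating_Cons: "alternating w \<Longrightarrow> alternating (\<lambda>ys. w (i # ys))"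
  unfolding alternating_def by (metis append_Cons)

lemma cochainsI:
  assumes "alternating w" "\<And>xs. w xs \<in> M"
    "\<And>xs. w xs \<noteq> 0 \<Longrightarrow> length xs = p" "\<And>xs. w xs \<noteq> 0 \<Longrightarrow> set xs \<subseteq> I"
  shows "w \<in> cochains I p M"
  using assms by (auto simp: cochains_def)

lemma cochainsD:
  assumes "w \<in> cochains I p M"
  shows "alternating w" "w xs \<in> M" "w xs \<noteq> 0 \<Longrightarrow> length xs = p" "w xs \<noteq> 0 \<Longrightarrow> set xs \<subseteq> I"
    "length xs \<noteq> p \<Longrightarrow> w xs = 0" "\<not> set xs \<subseteq> I \<Longrightarrow> w xs = 0"
  using assms by (auto simp: cochains_def)

lemma cochains_mono: "w \<in> cochains I p M \<Longrightarrow> I \<subseteq> J \<Longrightarrow> M \<subseteq> N \<Longrightarrow> w \<in> cochains J p N"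
  unfolding cochains_def by blast

lemma cochains_Cons:
  assumes "w \<in> cochains I (Suc p) M"
  shows "(\<lambda>ys. w (i # ys)) \<in> cochains I p M"
proof (rule cochainsI)
  show "alternating (\<lambda>ys. w (i # ys))" by (intro alternating_Cons cochainsD[OF assms])
  show "w (i # xs) \<in> M" for xs by (rule cochainsD[OF assms])
qed (use cochainsD(3,4)[OF assms] in fastforce)+

lemma cochains_zero: "0 \<in> M \<Longrightarrow> (\<lambda>_. 0) \<in> cochains I p M"
  by (auto simp: cochains_def alternating_def)

lemma cochains_diff:
  assumes "add_closed M" "v \<in> cochains I p M" "w \<in> cochains I p M"
  shows "(\<lambda>xs. v xs - w xs) \<in> cochains I p M"
proof (rule cochainsI)
  show "alternating (\<lambda>xs. v xs - w xs)"
    unfolding alternating_def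
  proof (intro allI)
    fix xs i j ys
    show "v (xs @ i # j # ys) - w (xs @ i # j # ys) = - (v (xs @ j # i # ys) - w (xs @ j # i # ys))"
      using alternatingD[OF cochainsD(1)[OF assms(2)], of xs i j ys]
        alternatingD[OF cochainsD(1)[OF assms(3)], of xs i j ys] by simp
  qed
  show "v xs - w xs \<in> M" for xs
    using assms(1) by (rule add_closedD) (rule cochainsD[OF assms(2)] cochainsD[OF assms(3)])+
  show "length xs = p" "set xs \<subseteq> I" if "v xs - w xs \<noteq> 0" for xs
    using that cochainsD(5,6)[OF assms(2), of xs] cochainsD(5,6)[OF assms(3), of xs] by fastforce+
qed

lemma cochains_add:
  assumes "add_closed M" "v \<in> cochains I p M" "w \<in> cochains I p M"
  shows "(\<lambda>xs. v xs + w xs) \<in> cochains I p M"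
proof -
  have "(\<lambda>xs. v xs - (0 - w xs)) \<in> cochains I p M"
    using assms by (intro cochains_diff cochains_zero) (auto intro: add_closedD)
  then show ?thesis by simp
qed

lemma cochains_sum:
  assumes "add_closed M" "\<And>s. s \<in> S \<Longrightarrow> w s \<in> cochains I p M"
  shows "(\<lambda>xs. \<Sum>s\<in>S. w s xs) \<in> cochains I p M"
  using assms(2)
  by (induction S rule: infinite_finite_induct)
     (use assms(1) in \<open>auto intro!: cochains_zero cochains_add add_closedD(1)\<close>)

lemma cochains_map:
  fixes h :: "'m::ab_group_add \<Rightarrow> 'n::ab_group_add"
  assumes "w \<in> cochains I p M" "\<And>x. x \<in> M \<Longrightarrow> h x \<in> N" "\<And>x. h (- x) = - h x" "h 0 = 0"
  shows "(\<lambda>xs. h (w xs)) \<in> cochains I p N"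
proof (rule cochainsI)
  show "alternating (\<lambda>xs. h (w xs))"
    unfolding alternating_def using alternatingD[OF cochainsD(1)[OF assms(1)]] assms(3) by metis
  show "h (w xs) \<in> N" for xs by (rule assms(2)) (rule cochainsD[OF assms(1)])
  show "length xs = p" "set xs \<subseteq> I" if "h (w xs) \<noteq> 0" for xs
  proof -
    have "w xs \<noteq> 0" using that assms(4) by auto
    then show "length xs = p" "set xs \<subseteq> I" using cochainsD(3,4)[OF assms(1)] by auto
  qed
qed

lemma wedge_cong:
  assumes "\<And>ys. length ys < length xs \<Longrightarrow> set ys \<subseteq> set xs \<Longrightarrow> v ys = w ys"
  shows "vwedge c v xs = vwedge c w xs"
  using assms
proof (induction xs arbitrary: v w)
  case (Cons i xs)
  have "v xs = w xs" by (rule Cons.prems) auto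
  moreover have "vwedge c (\<lambda>ys. v (i # ys)) xs = vwedge c (\<lambda>ys. w (i # ys)) xs"
    by (rule Cons.IH, rule Cons.prems) auto
  ultimately show ?case by simp
qed simp

lemma wedge_zero [simp]: "vwedge c (\<lambda>_. 0) xs = 0"
  by (induction xs) auto

lemma wedge_add: "vwedge c (\<lambda>ys. v ys + w ys) xs = vwedge c v xs + vwedge c w xs"
  by (induction xs arbitrary: v w) (auto simp: algebra_simps)

lemma wedge_diff: "vwedge c (\<lambda>ys. v ys - w ys) xs = vwedge c v xs - vwedge c w xs"
  by (induction xs arbitrary: v w) (auto simp: algebra_simps)

lemma wedge_uminus: "vwedge c (\<lambda>ys. - w ys) xs = - vwedge c w xs"
  using wedge_diff[of c "\<lambda>_. 0" w xs] by simp

lemma wedge_mult: "vwedge c (\<lambda>ys. k * w ys) xs = k * vwedge c w xs"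
  by (induction xs arbitrary: w) (auto simp: algebra_simps)

lemma wedge_mult_right: "vwedge c (\<lambda>ys. w ys * k) xs = vwedge c w xs * k"
  using wedge_mult[of c k w xs] by (simp add: mult.commute)

lemma wedge_sum: "vwedge c (\<lambda>ys. \<Sum>i\<in>A. w i ys) xs = (\<Sum>i\<in>A. vwedge c (w i) xs)"
  by (induction A rule: infinite_finite_induct) (auto simp: wedge_add)

lemma wedge_add_left: "vwedge (\<lambda>i. c i + d i) w xs = vwedge c w xs + vwedge d w xs"
  by (induction xs arbitrary: w) (auto simp: algebra_simps)

lemma wedge_mult_left: "vwedge (\<lambda>i. k * c i) w xs = k * vwedge c w xs"
  by (induction xs arbitrary: w) (auto simp: algebra_simps)

lemma wedge_anticommute: "vwedge c (vwedge d w) xs = - vwedge d (vwedge c w) xs"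
  by (induction xs arbitrary: w) (auto simp: algebra_simps wedge_mult wedge_mult_right wedge_diff)

lemma alternating_wedge:
  assumes "alternating w"
  shows "alternating (vwedge c w)"
proof -
  have "vwedge c w (xs @ i # j # ys) = - vwedge c w (xs @ j # i # ys)" for xs i j ys
    using assms
  proof (induction xs arbitrary: w)
    case Nil
    have "vwedge c (\<lambda>zs. w (j # i # zs)) ys = vwedge c (\<lambda>zs. - w (i # j # zs)) ys"
      by (rule wedge_cong) (rule alternatingD0[OF Nil])
    then show ?case by (simp add: wedge_uminus)
  next
    case (Cons k xs)
    have "w (xs @ i # j # ys) = - w (xs @ j # i # ys)" using Cons.prems by (rule alternatingD)
    then show ?case using Cons.IH[OF alternating_Cons[OF Cons.prems, of k]] by simp
  qed
  then show ?thesis unfolding alternating_def by blast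
qed

text \<open>
  The proof has to generalize over the degree, as the recursion replaces a cochain by its contractions.
\<close>

lemma wedge_support:
  assumes "\<And>ys. w ys \<noteq> 0 \<Longrightarrow> length ys = p \<and> set ys \<subseteq> I" "\<And>i. c i \<noteq> 0 \<Longrightarrow> i \<in> I"
    and "vwedge c w xs \<noteq> 0"
  shows "length xs = Suc p \<and> set xs \<subseteq> I"
  using assms
proof (induction xs arbitrary: w p)
  case (Cons i xs)
  show ?case
  proof (cases "c i * w xs = 0")
    case False
    then have "c i \<noteq> 0" "w xs \<noteq> 0" by auto
    then show ?thesis using Cons.prems by auto
  next
    case True
    then have *: "vwedge c (\<lambda>ys. w (i # ys)) xs \<noteq> 0" using Cons.prems(3) by auto
    obtain ys where "w (i # ys) \<noteq> 0"
    proof (rule ccontr)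
      assume "\<not> thesis"
      then have "(\<lambda>ys. w (i # ys)) = (\<lambda>_. 0)" using that by blast
      then show False using * by simp
    qed
    then have i: "i \<in> I" and p: "p = Suc (length ys)" using Cons.prems(1) by force+
    have "length xs = Suc (length ys) \<and> set xs \<subseteq> I"
      by (rule Cons.IH[OF _ _ *]) (use Cons.prems p in fastforce)+
    then show ?thesis using i p by simp
  qed
qed simp

lemma wedge_closed:
  assumes "add_closed M" "\<And>i x. x \<in> M \<Longrightarrow> c i * x \<in> M" "\<And>ys. w ys \<in> M"
  shows "vwedge c w xs \<in> M"
  using assms(3)
  by (induction xs arbitrary: w) (use assms(1,2) in \<open>auto intro!: add_closedD\<close>)

lemma wedge_cochains:
  assumes "w \<in> cochains J p M" "J \<subseteq> I" "\<And>i. c i \<noteq> 0 \<Longrightarrow> i \<in> I" "add_closed M"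
    "\<And>i x. x \<in> M \<Longrightarrow> c i * x \<in> M"
  shows "vwedge c w \<in> cochains I (Suc p) M"
proof (rule cochainsI)
  show "alternating (vwedge c w)" by (intro alternating_wedge cochainsD[OF assms(1)])
  show "vwedge c w xs \<in> M" for xs by (intro wedge_closed assms cochainsD[OF assms(1)])
  have "length xs = Suc p \<and> set xs \<subseteq> I" if "vwedge c w xs \<noteq> 0" for xs
    using cochainsD(3,4)[OF assms(1)] assms(2,3) that
    by (intro wedge_support[where w = w and c = c]) auto
  then show "vwedge c w xs \<noteq> 0 \<Longrightarrow> length xs = Suc p" "vwedge c w xs \<noteq> 0 \<Longrightarrow> set xs \<subseteq> I" for xs
    by blast+
qed

text \<open>Contraction is a skew derivation for the exterior product.\<close>

lemma contract_wedge:
  "contract I e (vwedge c w) xs = (\<Sum>i\<in>I. c i * e i) * w xs - vwedge c (contract I e w) xs"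
proof -
  have "vwedge c (contract I e w) xs = (\<Sum>i\<in>I. e i * vwedge c (\<lambda>ys. w (i # ys)) xs)"
    unfolding contract_def by (simp add: wedge_sum wedge_mult)
  then show ?thesis
    by (simp add: contract_def algebra_simps sum_subtractf sum_distrib_left)
qed

lemma alternating_contract:
  assumes "alternating w"
  shows "alternating (contract I e w)"
  unfolding alternating_def contract_def
proof (intro allI)
  fix xs i j ys
  have "w (k # xs @ i # j # ys) = - w (k # xs @ j # i # ys)" for k
    using alternatingD[OF assms, of "k # xs" i j ys] by (simp only: append_Cons)
  then show "(\<Sum>k\<in>I. e k * w (k # xs @ i # j # ys)) = - (\<Sum>k\<in>I. e k * w (k # xs @ j # i # ys))"
    by (simp add: sum_negf)
qed

lemma contract_support:
  assumes "w \<in> cochains I p M" "contract J e w xs \<noteq> 0"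
  shows "Suc (length xs) = p \<and> set xs \<subseteq> I"
proof -
  obtain i where "w (i # xs) \<noteq> 0"
    using assms(2) unfolding contract_def by (rule sum.not_neutral_contains_not_neutral) (metis mult_zero_right)
  then show ?thesis using cochainsD(3,4)[OF assms(1)] by fastforce
qed

lemma contract_cochains:
  assumes "w \<in> cochains I (Suc p) M" "add_closed N" "\<And>i x. i \<in> J \<Longrightarrow> x \<in> M \<Longrightarrow> e i * x \<in> N"
  shows "contract J e w \<in> cochains I p N"
proof (rule cochainsI)
  show "alternating (contract J e w)" by (intro alternating_contract cochainsD[OF assms(1)])
  show "contract J e w xs \<in> N" for xs
    unfolding contract_def by (intro add_closed_sum assms cochainsD[OF assms(1)])
qed (use contract_support[OF assms(1)] in blast)+

lemma contract_mono:
  assumes "w \<in> cochains I p M" "I \<subseteq> J" "finite J"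
  shows "contract J e w xs = contract I e w xs"
  unfolding contract_def
  by (rule sum.mono_neutral_right) (use assms cochainsD(6)[OF assms(1)] in auto)

text \<open>
  The products \<open>e i * e j\<close> are symmetric in \<open>i\<close> and \<open>j\<close>, the coordinates are antisymmetric.
\<close>

lemma contract_contract:
  fixes e :: "'i \<Rightarrow> 'm::two_torsion_free"
  assumes "alternating w"
  shows "contract I e (contract I e w) xs = 0"
proof (rule eq_uminus_self)
  have "contract I e (contract I e w) xs = (\<Sum>i\<in>I. \<Sum>j\<in>I. e i * e j * w (j # i # xs))"
    by (simp add: contract_def sum_distrib_left mult.assoc)
  also have "\<dots> = (\<Sum>j\<in>I. \<Sum>i\<in>I. e i * e j * w (j # i # xs))" by (rule sum.swap)
  also have "\<dots> = (\<Sum>j\<in>I. \<Sum>i\<in>I. - (e j * e i * w (i # j # xs)))"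
    by (intro sum.cong refl) (subst alternatingD0[OF assms], simp add: mult.commute)
  also have "\<dots> = - contract I e (contract I e w) xs"
    by (simp add: contract_def sum_distrib_left mult.assoc sum_negf)
  finally show "contract I e (contract I e w) xs = - contract I e (contract I e w) xs" .
qed

lemma contract_diff: "contract I e (\<lambda>xs. v xs - w xs) xs = contract I e v xs - contract I e w xs"
  by (simp add: contract_def algebra_simps sum_subtractf)

lemma contract_add: "contract I e (\<lambda>xs. v xs + w xs) xs = contract I e v xs + contract I e w xs"
  by (simp add: contract_def algebra_simps sum.distrib)

lemma contract_sum: "contract I e (\<lambda>xs. \<Sum>s\<in>S. w s xs) xs = (\<Sum>s\<in>S. contract I e (w s) xs)"
  by (induction S rule: infinite_finite_induct) (auto simp: contract_add, auto simp: contract_def)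

text \<open>
  Euler's identity: contracting with a basis vector and multiplying by it again, summed over the
  basis, is multiplication by the degree.
\<close>

lemma euler_wedge:
  assumes "alternating w" "finite I" "\<And>xs. w xs \<noteq> 0 \<Longrightarrow> set xs \<subseteq> I"
  shows "(\<Sum>j\<in>I. vwedge (\<lambda>i. if i = j then 1 else 0) (\<lambda>ys. w (j # ys)) xs) = of_nat (length xs) * w xs"
  using assms(1,3)
proof (induction xs arbitrary: w)
  case (Cons i xs)
  have "(\<Sum>j\<in>I. vwedge (\<lambda>i. if i = j then 1 else 0) (\<lambda>ys. w (j # i # ys)) xs)
      = - (\<Sum>j\<in>I. vwedge (\<lambda>i. if i = j then 1 else 0) (\<lambda>ys. w (i # j # ys)) xs)"
    unfolding sum_negf[symmetric] wedge_uminus[symmetric]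
    by (intro sum.cong wedge_cong refl) (rule alternatingD0[OF Cons.prems(1)])
  also have "\<dots> = - (of_nat (length xs) * w (i # xs))"
    by (subst Cons.IH[OF alternating_Cons[OF Cons.prems(1)]]) (use Cons.prems(2) in force)+
  finally have 1: "(\<Sum>j\<in>I. vwedge (\<lambda>i. if i = j then 1 else 0) (\<lambda>ys. w (j # i # ys)) xs)
      = - (of_nat (length xs) * w (i # xs))" .
  have "(\<Sum>j\<in>I. (if i = j then 1 else 0) * w (j # xs)) = (\<Sum>j\<in>I. if i = j then w (i # xs) else 0)"
    by (intro sum.cong) auto
  also have "\<dots> = w (i # xs)"
    using assms(2) Cons.prems(2)[of "i # xs"] by auto
  finally show ?case using 1 by (simp add: sum_subtractf algebra_simps)
qed simp

section \<open>Exactness of Koszul complexes\<close>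

text \<open>
  Exactness at the middle of a three-term piece of the Koszul complex of the elements \<open>e i\<close>. The
  third term does not appear: the cycle condition is an equation in the ambient ring.
\<close>

definition koszul_exact ::
    "'i set \<Rightarrow> ('i \<Rightarrow> 'm) \<Rightarrow> nat \<Rightarrow> 'm set \<Rightarrow> 'm::comm_ring_1 set \<Rightarrow> bool" where
  "koszul_exact I e p M1 M2 \<longleftrightarrow>
     (\<forall>Z\<in>cochains I p M2. contract I e Z = (\<lambda>_. 0) \<longrightarrow>
        (\<exists>Y\<in>cochains I (Suc p) M1. contract I e Y = Z))"

lemma koszul_exactD:
  assumes "koszul_exact I e p M1 M2" "Z \<in> cochains I p M2" "\<And>xs. contract I e Z xs = 0"
  obtains Y where "Y \<in> cochains I (Suc p) M1" "\<And>xs. contract I e Y xs = Z xs"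
proof -
  have "contract I e Z = (\<lambda>_. 0)" using assms(3) by auto
  then show thesis using assms(1,2) that unfolding koszul_exact_def by metis
qed

lemma koszul_exactI:
  assumes "\<And>Z. Z \<in> cochains I p M2 \<Longrightarrow> (\<And>xs. contract I e Z xs = 0) \<Longrightarrow>
    \<exists>Y\<in>cochains I (Suc p) M1. \<forall>xs. contract I e Y xs = Z xs"
  shows "koszul_exact I e p M1 M2"
  unfolding koszul_exact_def fun_eq_iff using assms by blast

text \<open>
  Moving an entry to the front passes every earlier entry once.
\<close>

lemma alternating_move:
  fixes w :: "'i list \<Rightarrow> 'm::comm_ring_1"
  assumes "alternating w"
  shows "w (as @ v # bs) = (-1) ^ length as * w (v # as @ bs)"
proof (induction as arbitrary: bs rule: rev_induct)
  case (snoc a as)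
  have "w ((as @ [a]) @ v # bs) = - w (as @ v # a # bs)"
    using alternatingD[OF assms, of as a v bs] by simp
  then show ?case by (simp add: snoc.IH)
qed simp

lemma alternating_not_distinct:
  fixes w :: "'i list \<Rightarrow> 'm::two_torsion_free"
  assumes "alternating w" "\<not> distinct xs"
  shows "w xs = 0"
proof -
  obtain as x bs cs where xs: "xs = as @ [x] @ bs @ [x] @ cs"
    using not_distinct_decomp[OF assms(2)] by blast
  have "w (x # x # (as @ bs) @ cs) = 0"
    by (rule eq_uminus_self) (rule alternatingD0[OF assms(1)])
  then have "w (x # (as @ bs) @ x # cs) = 0"
    using alternating_move[OF alternating_Cons[OF assms(1), of x], of "as @ bs" x cs] by simp
  then show ?thesis
    using alternating_move[OF assms(1), of as x "bs @ x # cs"] by (simp add: xs)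
qed

text \<open>
  A cochain over \<open>insert v I\<close> has the form \<open>\<beta> + v \<and> \<gamma>\<close> with \<open>\<beta>\<close>, \<open>\<gamma>\<close> over \<open>I\<close>. If it is a cycle,
  then so is \<open>\<gamma>\<close>; hence \<open>\<gamma>\<close> is the differential of some \<open>\<epsilon>\<close>, and adding the differential of
  \<open>v \<and> \<epsilon>\<close> leaves a cycle over \<open>I\<close>. The degree of the coefficients does not change, so that exactness in
  one such degree carries over to larger families.
\<close>

lemma koszul_exact_insert:
  fixes e :: "'i \<Rightarrow> 'm::two_torsion_free"
  assumes "finite I" "v \<notin> I" and ex: "\<And>p. koszul_exact I e p M1 M2"
    and M1: "add_closed M1" and M2: "add_closed M2"
    and mult: "\<And>i x. i \<in> insert v I \<Longrightarrow> x \<in> M1 \<Longrightarrow> e i * x \<in> M2"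
  shows "koszul_exact (insert v I) e p M1 M2"
proof (rule koszul_exactI)
  fix Z assume Z: "Z \<in> cochains (insert v I) p M2" and cyc: "\<And>xs. contract (insert v I) e Z xs = 0"
  note alt = cochainsD(1)[OF Z]
  let ?J = "insert v I"
  have J: "finite ?J" using assms by simp
  define \<delta> :: "'i \<Rightarrow> 'm" where "\<delta> = (\<lambda>i. if i = v then 1 else 0)"
  \<comment> \<open>The part of \<open>Z\<close> that involves \<open>v\<close> is a cycle over \<open>I\<close>.\<close>
  have "\<exists>\<epsilon>\<in>cochains I p M1. \<forall>xs. contract I e \<epsilon> xs = Z (v # xs)"
  proof (cases p)
    case 0
    then have "Z (v # xs) = 0" for xs using cochainsD(3)[OF Z, of "v # xs"] by auto
    then show ?thesis
      using cochains_zero[OF add_closedD(1)[OF M1]] by (intro bexI) (auto simp: contract_def)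
  next
    case (Suc q)
    have "(\<lambda>ys. Z (v # ys)) \<in> cochains ?J q M2" by (rule cochains_Cons) (use Z Suc in simp)
    moreover have "set ys \<subseteq> I" if "Z (v # ys) \<noteq> 0" for ys
      using that cochainsD(4)[OF Z that] alternating_not_distinct[OF alt, of "v # ys"] by fastforce
    ultimately have g: "(\<lambda>ys. Z (v # ys)) \<in> cochains I q M2" by (auto simp: cochains_def)
    have "contract I e (\<lambda>ys. Z (v # ys)) xs = 0" for xs
    proof -
      have "contract I e (\<lambda>ys. Z (v # ys)) xs = - (\<Sum>i\<in>I. e i * Z (i # v # xs))"
        unfolding contract_def sum_negf[symmetric]
        by (intro sum.cong refl) (subst alternatingD0[OF alt], simp)
      moreover have "0 = e v * Z (v # v # xs) + (\<Sum>i\<in>I. e i * Z (i # v # xs))"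
        using cyc[of "v # xs"] assms by (simp add: contract_def)
      moreover have "Z (v # v # xs) = 0" by (rule alternating_not_distinct[OF alt]) simp
      ultimately show ?thesis by simp
    qed
    then show ?thesis using koszul_exactD[OF ex g] Suc by metis
  qed
  then obtain \<epsilon> where \<epsilon>: "\<epsilon> \<in> cochains I p M1" and d\<epsilon>: "\<And>xs. contract I e \<epsilon> xs = Z (v # xs)" by blast
  define B where "B = vwedge \<delta> \<epsilon>"
  have B: "B \<in> cochains ?J (Suc p) M1"
    unfolding B_def \<delta>_def
    by (rule wedge_cochains[OF \<epsilon>]) (use M1 in \<open>auto split: if_splits intro: add_closedD\<close>)
  have dB: "contract ?J e B xs = e v * \<epsilon> xs - vwedge \<delta> (\<lambda>ys. Z (v # ys)) xs" for xs
  proof -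
    have "(\<Sum>i\<in>?J. \<delta> i * e i) = (\<Sum>i\<in>?J. if i = v then e i else 0)"
      by (intro sum.cong) (auto simp: \<delta>_def)
    also have "\<dots> = e v" using J by simp
    finally have 1: "(\<Sum>i\<in>?J. \<delta> i * e i) = e v" .
    have "contract ?J e \<epsilon> = (\<lambda>ys. Z (v # ys))"
      by (rule ext) (use contract_mono[OF \<epsilon> subset_insertI J] d\<epsilon> in metis)
    then show ?thesis by (simp add: B_def contract_wedge 1)
  qed
  define Z' where "Z' = (\<lambda>xs. Z xs + contract ?J e B xs)"
  have Z': "Z' \<in> cochains ?J p M2"
    unfolding Z'_def by (intro cochains_add M2 Z contract_cochains[OF B] mult)
  have Z'v: "Z' (v # xs) = 0" for xs
  proof -
    have "(\<lambda>zs. Z (v # v # zs)) = (\<lambda>_. 0)"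
      using alternating_not_distinct[OF alt] by fastforce
    moreover have "\<epsilon> (v # xs) = 0" using cochainsD(4)[OF \<epsilon>, of "v # xs"] assms(2) by auto
    ultimately show ?thesis by (simp add: Z'_def dB \<delta>_def)
  qed
  have "Z' xs = 0" if v: "v \<in> set xs" for xs
  proof -
    obtain as bs where "xs = as @ v # bs" using split_list[OF v] by blast
    then show ?thesis using alternating_move[OF cochainsD(1)[OF Z'], of as v bs] Z'v by simp
  qed
  then have Z'I: "Z' \<in> cochains I p M2" using Z' unfolding cochains_def by blast
  have "contract I e Z' xs = 0" for xs
    using contract_mono[OF Z'I subset_insertI J, of e xs] cyc contract_contract[OF cochainsD(1)[OF B], of ?J e xs]
    by (auto simp: Z'_def contract_add)
  from koszul_exactD[OF ex Z'I this] obtain Y' where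
    Y': "Y' \<in> cochains I (Suc p) M1" and dY': "\<And>xs. contract I e Y' xs = Z' xs" by blast
  have "Y' \<in> cochains ?J (Suc p) M1" using Y' by (rule cochains_mono) auto
  then have "(\<lambda>xs. Y' xs - B xs) \<in> cochains ?J (Suc p) M1" by (intro cochains_diff M1 B)
  moreover have "contract ?J e (\<lambda>xs. Y' xs - B xs) xs = Z xs" for xs
    using contract_mono[OF Y' subset_insertI J, of e xs] dY' by (auto simp: contract_diff Z'_def)
  ultimately show "\<exists>Y\<in>cochains ?J (Suc p) M1. \<forall>xs. contract ?J e Y xs = Z xs" by blast
qed

text \<open>
  For two elements the complex has length two: the three hypotheses are its exactness at the three places.
\<close>

lemma koszul_exact_pencil:
  fixes e :: "'i \<Rightarrow> 'm::two_torsion_free"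
  assumes "s \<noteq> t" and M1: "add_closed M1"
    and span: "\<And>f. f \<in> M2 \<Longrightarrow> \<exists>x\<in>M1. \<exists>y\<in>M1. f = e s * x + e t * y"
    and syz: "\<And>f h. f \<in> M2 \<Longrightarrow> h \<in> M2 \<Longrightarrow> e s * f + e t * h = 0 \<Longrightarrow>
      \<exists>q\<in>M1. f = e t * q \<and> h = - (e s * q)"
    and reg: "\<And>f. f \<in> M2 \<Longrightarrow> e s * f = 0 \<Longrightarrow> f = 0"
  shows "koszul_exact {s, t} e p M1 M2"
proof (rule koszul_exactI)
  fix Z assume Z: "Z \<in> cochains {s, t} p M2" and cyc: "\<And>xs. contract {s, t} e Z xs = 0"
  have cyc': "e s * Z (s # xs) + e t * Z (t # xs) = 0" for xs
    using cyc[of xs] assms(1) by (simp add: contract_def)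
  have con: "contract {s, t} e Y xs = e s * Y (s # xs) + e t * Y (t # xs)" for Y xs
    using assms(1) by (simp add: contract_def)
  note M1' = add_closedD[OF M1]
  consider "p = 0" | "p = 1" | "p \<ge> 2" by linarith
  then show "\<exists>Y\<in>cochains {s, t} (Suc p) M1. \<forall>xs. contract {s, t} e Y xs = Z xs"
  proof cases
    case 1
    obtain x y where xy: "x \<in> M1" "y \<in> M1" "Z [] = e s * x + e t * y"
      using span[OF cochainsD(2)[OF Z]] by blast
    define Y where "Y = (\<lambda>xs. if xs = [s] then x else if xs = [t] then y else 0)"
    have "Y \<in> cochains {s, t} (Suc p) M1"
      by (rule cochainsI) (use xy M1' 1 in \<open>auto simp: Y_def alternating_def append_eq_Cons_conv split: if_splits\<close>)
    moreover have "contract {s, t} e Y xs = Z xs" for xs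
      using xy assms(1) cochainsD(3)[OF Z, of xs] 1 by (cases xs) (auto simp: con Y_def)
    ultimately show ?thesis by blast
  next
    case 2
    obtain q where q: "q \<in> M1" "Z [s] = e t * q" "Z [t] = - (e s * q)"
      using syz[OF cochainsD(2)[OF Z] cochainsD(2)[OF Z]] cyc'[of "[]"] by blast
    define Y where "Y = (\<lambda>xs. if xs = [t, s] then q else if xs = [s, t] then - q else 0)"
    have "Y \<in> cochains {s, t} (Suc p) M1"
    proof (rule cochainsI)
      show "alternating Y"
        using assms(1) by (auto simp: Y_def alternating_def append_eq_Cons_conv)
    qed (use q M1' 2 in \<open>auto simp: Y_def split: if_splits\<close>)
    moreover have "contract {s, t} e Y xs = Z xs" for xs
    proof (cases "xs = [s] \<or> xs = [t]")
      case True
      then show ?thesis using assms(1) q by (auto simp: con Y_def)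
    next
      case False
      have "Z xs = 0"
      proof (rule ccontr)
        assume "Z xs \<noteq> 0"
        then have "length xs = 1" "set xs \<subseteq> {s, t}" using cochainsD(3,4)[OF Z, of xs] 2 by auto
        then show False using False by (auto simp: length_Suc_conv)
      qed
      then show ?thesis using False by (auto simp: con Y_def)
    qed
    ultimately show ?thesis by blast
  next
    case 3
    note nd = alternating_not_distinct[OF cochainsD(1)[OF Z]]
    have st: "Z [s, t] = 0" "Z [t, s] = 0"
    proof -
      show "Z [s, t] = 0" using cyc'[of "[t]"] nd[of "[t, t]"]
        by (intro reg[OF cochainsD(2)[OF Z]]) simp
      then show "Z [t, s] = 0" using alternatingD0[OF cochainsD(1)[OF Z], of t s "[]"] by simp
    qed
    have "Z xs = 0" for xs
    proof (rule ccontr)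
      assume *: "Z xs \<noteq> 0"
      then have d: "distinct xs" using nd by blast
      have l: "length xs = p" and sub: "set xs \<subseteq> {s, t}" using cochainsD(3,4)[OF Z *] by auto
      have "p \<le> 2" using distinct_card[OF d] l card_mono[OF _ sub] by (auto simp: card_insert_if split: if_splits)
      then have "length xs = 2" using 3 l by simp
      then obtain x y where "xs = [x, y]" by (auto simp: numeral_2_eq_2 length_Suc_conv)
      then show False using sub d st * by auto
    qed
    then show ?thesis using cochains_zero[OF M1'(1)] by (intro bexI[of _ "\<lambda>_. 0"]) (auto simp: con)
  qed
qed

text \<open>
  The map of exterior powers induced by the linear map that sends the basis vector with index \<open>s\<close> to the
  combination with coefficients \<open>c\<close> and fixes the others: every entry of the list is either kept or
  replaced by \<open>s\<close>.
\<close>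

fun push :: "'i \<Rightarrow> ('i \<Rightarrow> 'm) \<Rightarrow> ('i list \<Rightarrow> 'm) \<Rightarrow> 'i list \<Rightarrow> 'm::comm_ring_1" where
  "push s c w [] = w []"
| "push s c w (i # xs) = push s c (\<lambda>ys. w (i # ys)) xs + c i * push s c (\<lambda>ys. w (s # ys)) xs"

lemma push_zero [simp]: "push s c (\<lambda>_. 0) xs = 0"
  by (induction xs) auto

lemma push_add: "push s c (\<lambda>ys. v ys + w ys) xs = push s c v xs + push s c w xs"
  by (induction xs arbitrary: v w) (auto simp: algebra_simps)

lemma push_mult: "push s c (\<lambda>ys. k * w ys) xs = k * push s c w xs"
  by (induction xs arbitrary: w) (auto simp: algebra_simps)

lemma push_sum: "push s c (\<lambda>ys. \<Sum>i\<in>A. w i ys) xs = (\<Sum>i\<in>A. push s c (w i) xs)"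
  by (induction A rule: infinite_finite_induct) (auto simp: push_add)

lemma push_uminus: "push s c (\<lambda>ys. - w ys) xs = - push s c w xs"
  using push_mult[of s c "-1" w xs] by simp

lemma alternating_push:
  fixes w :: "'i list \<Rightarrow> 'm::two_torsion_free"
  assumes "alternating w"
  shows "alternating (push s c w)"
proof -
  have "push s c w (xs @ i # j # ys) = - push s c w (xs @ j # i # ys)" for xs i j ys
    using assms
  proof (induction xs arbitrary: w)
    case Nil
    have neg: "push s c (\<lambda>zs. w (a # b # zs)) ys = - push s c (\<lambda>zs. w (b # a # zs)) ys" for a b
      unfolding push_uminus[symmetric]
      by (rule arg_cong[where f = "\<lambda>v. push s c v ys"]) (rule ext, rule alternatingD0[OF Nil])
    have "push s c (\<lambda>zs. w (s # s # zs)) ys = 0" by (rule eq_uminus_self) (rule neg)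
    then show ?case by (simp add: neg[of i j] neg[of i s] neg[of s j] algebra_simps)
  next
    case (Cons k xs)
    show ?case
      using Cons.IH[OF alternating_Cons[OF Cons.prems, of k]]
        Cons.IH[OF alternating_Cons[OF Cons.prems, of s]] by simp
  qed
  then show ?thesis unfolding alternating_def by blast
qed

lemma push_closed:
  assumes "add_closed M" "\<And>i x. x \<in> M \<Longrightarrow> c i * x \<in> M" "\<And>ys. w ys \<in> M"
  shows "push s c w xs \<in> M"
  using assms(3)
  by (induction xs arbitrary: w) (use assms(1,2) in \<open>auto intro!: add_closedD(4)\<close>)

text \<open>
  The value \<open>c s = -1\<close> makes the two summands of the recursion cancel on lists containing \<open>s\<close>.
\<close>

lemma push_support:
  assumes "\<And>ys. w ys \<noteq> 0 \<Longrightarrow> length ys = p \<and> set ys \<subseteq> insert s I"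
    and "c s = -1" "\<And>i. i \<notin> insert s I \<Longrightarrow> c i = 0" and "push s c w xs \<noteq> 0"
  shows "length xs = p \<and> set xs \<subseteq> I"
  using assms(1,4)
proof (induction xs arbitrary: w p)
  case Nil
  then show ?case by fastforce
next
  case (Cons i xs)
  have "i \<noteq> s" using Cons.prems(2) assms(2) by auto
  obtain k where k: "push s c (\<lambda>ys. w (k # ys)) xs \<noteq> 0"
    using Cons.prems(2) by (metis add.right_neutral mult_zero_right push.simps(2))
  have "i \<in> I"
  proof (rule ccontr)
    assume "i \<notin> I"
    then have "i \<notin> insert s I" using \<open>i \<noteq> s\<close> by simp
    then have "(\<lambda>ys. w (i # ys)) = (\<lambda>_. 0)" "c i = 0"
      using Cons.prems(1) assms(3) by fastforce+
    then show False using Cons.prems(2) by simp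
  qed
  obtain ys where "w (k # ys) \<noteq> 0"
  proof (rule ccontr)
    assume "\<not> thesis"
    then have "(\<lambda>ys. w (k # ys)) = (\<lambda>_. 0)" using that by blast
    then show False using k by simp
  qed
  then have p: "p = Suc (length ys)" using Cons.prems(1) by force
  have "length xs = length ys \<and> set xs \<subseteq> I"
    by (rule Cons.IH[OF _ k]) (use Cons.prems(1) p in fastforce)
  then show ?case using p \<open>i \<in> I\<close> by simp
qed

lemma push_id:
  assumes "\<And>xs. s \<in> set xs \<Longrightarrow> w xs = 0"
  shows "push s c w xs = w xs"
  using assms
proof (induction xs arbitrary: w)
  case (Cons i xs)
  have "(\<lambda>ys. w (s # ys)) = (\<lambda>_. 0)" using Cons.prems by auto
  moreover have "push s c (\<lambda>ys. w (i # ys)) xs = w (i # xs)" by (rule Cons.IH) (simp add: Cons.prems)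
  ultimately show ?case by simp
qed simp

text \<open>
  A redundant element of the family may be omitted: substituting its expression in terms of the others
  is a chain map, and it does not change cochains over the smaller index set.
\<close>

lemma koszul_exact_drop:
  fixes e :: "'i \<Rightarrow> 'm::two_torsion_free"
  assumes "finite I" "s \<notin> I" and es: "e s = (\<Sum>i\<in>I. c i * e i)"
    and M1: "add_closed M1" "\<And>i x. x \<in> M1 \<Longrightarrow> c i * x \<in> M1"
    and ex: "koszul_exact (insert s I) e p M1 M2"
  shows "koszul_exact I e p M1 M2"
proof (rule koszul_exactI)
  fix Z assume Z: "Z \<in> cochains I p M2" and cyc: "\<And>xs. contract I e Z xs = 0"
  let ?J = "insert s I"
  define c' where "c' = (\<lambda>i. if i = s then -1 else if i \<in> I then c i else 0)"
  have "Z \<in> cochains ?J p M2" using Z by (rule cochains_mono) auto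
  moreover have "contract ?J e Z xs = 0" for xs
    using contract_mono[OF Z subset_insertI, of s e xs] assms(1) cyc by simp
  ultimately obtain Y where Y: "Y \<in> cochains ?J (Suc p) M1" and dY: "\<And>xs. contract ?J e Y xs = Z xs"
    using koszul_exactD[OF ex] by blast
  have "push s c' Y \<in> cochains I (Suc p) M1"
  proof (rule cochainsI)
    show "alternating (push s c' Y)" by (intro alternating_push cochainsD[OF Y])
    show "push s c' Y xs \<in> M1" for xs
      by (intro push_closed M1 cochainsD[OF Y]) (use M1 in \<open>auto simp: c'_def intro: add_closedD\<close>)
    have "length xs = Suc p \<and> set xs \<subseteq> I" if "push s c' Y xs \<noteq> 0" for xs
      by (rule push_support[OF _ _ _ that]) (use cochainsD(3,4)[OF Y] in \<open>auto simp: c'_def\<close>)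
    then show "push s c' Y xs \<noteq> 0 \<Longrightarrow> length xs = Suc p" "push s c' Y xs \<noteq> 0 \<Longrightarrow> set xs \<subseteq> I" for xs
      by blast+
  qed
  moreover have "contract I e (push s c' Y) xs = Z xs" for xs
  proof -
    have "contract I e (push s c' Y) xs
        = (\<Sum>i\<in>I. e i * push s c' (\<lambda>ys. Y (i # ys)) xs) + (\<Sum>i\<in>I. c' i * e i) * push s c' (\<lambda>ys. Y (s # ys)) xs"
      by (simp add: contract_def sum.distrib distrib_left sum_distrib_right mult_ac)
    also have "(\<Sum>i\<in>I. c' i * e i) = e s"
      unfolding es by (intro sum.cong) (use assms(2) in \<open>auto simp: c'_def\<close>)
    also have "(\<Sum>i\<in>I. e i * push s c' (\<lambda>ys. Y (i # ys)) xs) + e s * push s c' (\<lambda>ys. Y (s # ys)) xs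
        = push s c' (contract ?J e Y) xs"
      unfolding contract_def using assms(1,2)
      by (simp add: push_add push_sum push_mult algebra_simps)
    also have "contract ?J e Y = Z" using dY by auto
    also have "push s c' Z xs = Z xs"
      by (rule push_id) (use cochainsD(6)[OF Z] assms(2) in blast)
    finally show ?thesis .
  qed
  ultimately show "\<exists>Y\<in>cochains I (Suc p) M1. \<forall>xs. contract I e Y xs = Z xs" by blast
qed

definition pullback :: "('j \<Rightarrow> 'i) \<Rightarrow> 'j set \<Rightarrow> ('i list \<Rightarrow> 'm::zero) \<Rightarrow> 'j list \<Rightarrow> 'm" where
  "pullback \<tau> J w ys = (if set ys \<subseteq> J then w (map \<tau> ys) else 0)"

lemma pullback_cochains:
  assumes "w \<in> cochains I p M"
  shows "pullback \<tau> J w \<in> cochains J p M"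
proof (rule cochainsI)
  show "alternating (pullback \<tau> J w)"
    unfolding alternating_def
  proof (intro allI)
    fix xs i j ys
    have "w (map \<tau> xs @ \<tau> i # \<tau> j # map \<tau> ys) = - w (map \<tau> xs @ \<tau> j # \<tau> i # map \<tau> ys)"
      by (rule alternatingD[OF cochainsD(1)[OF assms]])
    then show "pullback \<tau> J w (xs @ i # j # ys) = - pullback \<tau> J w (xs @ j # i # ys)"
      by (auto simp: pullback_def)
  qed
  have "w [] \<in> M" by (rule cochainsD(2)[OF assms])
  have "0 \<in> M"
  proof (cases "p = 0")
    case True
    then have "w [undefined] = 0" by (intro cochainsD(5)[OF assms]) simp
    then show ?thesis by (metis cochainsD(2)[OF assms])
  next
    case False
    then have "w [] = 0" by (intro cochainsD(5)[OF assms]) simp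
    then show ?thesis by (metis cochainsD(2)[OF assms])
  qed
  then show "pullback \<tau> J w xs \<in> M" for xs
    by (auto simp: pullback_def intro: cochainsD(2)[OF assms])
  show "length xs = p" "set xs \<subseteq> J" if "pullback \<tau> J w xs \<noteq> 0" for xs
    using that cochainsD(3)[OF assms, of "map \<tau> xs"] by (auto simp: pullback_def split: if_splits)
qed

lemma contract_pullback:
  assumes "bij_betw \<tau> J I" "set ys \<subseteq> J"
  shows "contract J (\<lambda>j. e (\<tau> j)) (pullback \<tau> J w) ys = contract I e w (map \<tau> ys)"
proof -
  have "contract J (\<lambda>j. e (\<tau> j)) (pullback \<tau> J w) ys = (\<Sum>j\<in>J. e (\<tau> j) * w (\<tau> j # map \<tau> ys))"
    unfolding contract_def by (intro sum.cong) (use assms in \<open>auto simp: pullback_def\<close>)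
  also have "\<dots> = contract I e w (map \<tau> ys)"
    unfolding contract_def by (rule sum.reindex_bij_betw[OF assms(1)])
  finally show ?thesis .
qed

lemma koszul_exact_reindex:
  assumes bij: "bij_betw \<sigma> I J" and ex: "koszul_exact I (\<lambda>i. e (\<sigma> i)) p M1 M2"
  shows "koszul_exact J e p M1 M2"
proof (rule koszul_exactI)
  fix Z assume Z: "Z \<in> cochains J p M2" and cyc: "\<And>xs. contract J e Z xs = 0"
  define \<tau> where "\<tau> = inv_into I \<sigma>"
  have bij': "bij_betw \<tau> J I" unfolding \<tau>_def by (rule bij_betw_inv_into[OF bij])
  have \<sigma>\<tau>: "\<sigma> (\<tau> j) = j" if "j \<in> J" for j
    unfolding \<tau>_def using bij that by (simp add: bij_betw_def f_inv_into_f)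
  note Z' = pullback_cochains[OF Z, of \<sigma> I]
  have sup: "contract K e' w ys = 0" if "w \<in> cochains K q M" "\<not> set ys \<subseteq> K" for K e' w q M and ys :: "'z list"
    using contract_support[OF that(1)] that(2) by metis
  have "contract I (\<lambda>i. e (\<sigma> i)) (pullback \<sigma> I Z) xs = 0" for xs
    using contract_pullback[OF bij, of xs e Z] cyc sup[OF Z', of xs] by (cases "set xs \<subseteq> I") auto
  then obtain Y where Y: "Y \<in> cochains I (Suc p) M1"
    and dY: "\<And>xs. contract I (\<lambda>i. e (\<sigma> i)) Y xs = pullback \<sigma> I Z xs"
    using koszul_exactD[OF ex Z'] by blast
  have "contract J e (pullback \<tau> J Y) ys = Z ys" for ys
  proof (cases "set ys \<subseteq> J")
    case True
    have "contract J e (pullback \<tau> J Y) ys = contract J (\<lambda>j. e (\<sigma> (\<tau> j))) (pullback \<tau> J Y) ys"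
      unfolding contract_def by (intro sum.cong) (auto simp: \<sigma>\<tau>)
    also have "\<dots> = pullback \<sigma> I Z (map \<tau> ys)"
      using contract_pullback[OF bij' True, of "\<lambda>i. e (\<sigma> i)" Y] dY by simp
    also have "\<dots> = Z (map (\<sigma> \<circ> \<tau>) ys)"
      using True bij' by (auto simp: pullback_def bij_betw_def)
    also have "map (\<sigma> \<circ> \<tau>) ys = ys"
      using True \<sigma>\<tau> by (intro map_idI) auto
    finally show ?thesis .
  next
    case False
    then show ?thesis using sup[OF pullback_cochains[OF Y]] cochainsD(6)[OF Z] by metis
  qed
  then show "\<exists>Y\<in>cochains J (Suc p) M1. \<forall>xs. contract J e Y xs = Z xs"
    using pullback_cochains[OF Y] by blast
qed

section \<open>Koszul cohomology in coordinates\<close>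

definition sconst :: "complex \<Rightarrow> sec" where
  "sconst c = (\<chi> j. [:c:])"

lemma sec_scale_sconst: "sec_scale c s = sconst c * s"
  by (simp add: sec_scale_def sconst_def vec_eq_iff)

lemma sconst_simps [simp]: "sconst 0 = 0" "sconst 1 = 1"
  by (simp_all add: sconst_def vec_eq_iff one_pCons)

lemma sconst_add: "sconst (c + d) = sconst c + sconst d"
  by (simp add: sconst_def vec_eq_iff)

lemma sconst_mult: "sconst (c * d) = sconst c * sconst d"
  by (simp add: sconst_def vec_eq_iff)

lemma sconst_uminus: "sconst (- c) = - sconst c"
  by (simp add: sconst_def vec_eq_iff)

lemma sconst_of_nat: "sconst (of_nat n) = of_nat n"
  by (induction n) (simp_all add: sconst_add)

lemma sconst_power_neg_one: "sconst ((-1) ^ n) = (-1) ^ n"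
  by (induction n) (simp_all add: sconst_uminus)

definition sec_subspace :: "sec set \<Rightarrow> bool" where
  "sec_subspace W \<longleftrightarrow> add_closed W \<and> (\<forall>c. \<forall>s\<in>W. sconst c * s \<in> W)"

lemma sec_subspaceD:
  assumes "sec_subspace W"
  shows "add_closed W" "s \<in> W \<Longrightarrow> sconst c * s \<in> W" "0 \<in> W" "s \<in> W \<Longrightarrow> t \<in> W \<Longrightarrow> s + t \<in> W"
    "s \<in> W \<Longrightarrow> t \<in> W \<Longrightarrow> s - t \<in> W" "s \<in> W \<Longrightarrow> - s \<in> W"
  using assms by (auto simp: sec_subspace_def add_closedD)

definition frag_eval :: "('a \<Rightarrow> 'm) \<Rightarrow> ('a \<Rightarrow>\<^sub>0 int) \<Rightarrow> 'm::comm_ring_1" where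
  "frag_eval h x = (\<Sum>k\<in>Poly_Mapping.keys x. of_int (Poly_Mapping.lookup x k) * h k)"

lemma frag_eval_superset:
  assumes "finite A" "Poly_Mapping.keys x \<subseteq> A"
  shows "frag_eval h x = (\<Sum>k\<in>A. of_int (Poly_Mapping.lookup x k) * h k)"
  unfolding frag_eval_def by (rule sum.mono_neutral_left) (use assms in \<open>auto simp: in_keys_iff\<close>)

lemma frag_eval_0 [simp]: "frag_eval h 0 = 0"
  by (simp add: frag_eval_def)

lemma frag_eval_of [simp]: "frag_eval h (frag_of k) = h k"
  by (simp add: frag_eval_def)

lemma frag_eval_diff: "frag_eval h (x - y) = frag_eval h x - frag_eval h y"
proof -
  let ?A = "Poly_Mapping.keys x \<union> Poly_Mapping.keys y"
  have "frag_eval h (x - y) = (\<Sum>k\<in>?A. of_int (Poly_Mapping.lookup (x - y) k) * h k)"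
    by (rule frag_eval_superset) (use keys_diff[of x y] in auto)
  moreover have "frag_eval h x = (\<Sum>k\<in>?A. of_int (Poly_Mapping.lookup x k) * h k)"
    "frag_eval h y = (\<Sum>k\<in>?A. of_int (Poly_Mapping.lookup y k) * h k)"
    by (rule frag_eval_superset; simp)+
  ultimately show ?thesis
    by (simp add: sum_subtractf[symmetric] algebra_simps lookup_minus)
qed

lemma frag_eval_uminus: "frag_eval h (- x) = - frag_eval h x"
  using frag_eval_diff[of h 0 x] by simp

lemma frag_eval_add: "frag_eval h (x + y) = frag_eval h x + frag_eval h y"
  using frag_eval_diff[of h x "- y"] by (simp add: frag_eval_uminus)

lemma frag_eval_sum: "frag_eval h (\<Sum>i\<in>A. x i) = (\<Sum>i\<in>A. frag_eval h (x i))"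
  by (induction A rule: infinite_finite_induct) (auto simp: frag_eval_add)

lemma frag_eval_sign: "frag_eval h (frag_cmul ((-1) ^ n) x) = (-1) ^ n * frag_eval h x"
  by (cases "even n") (simp_all add: frag_eval_uminus)

lemma wedge_rel_uminus: "x \<in> wedge_rel V W p \<Longrightarrow> - x \<in> wedge_rel V W p"
  using wedge_rel.diff[OF wedge_rel.zero] by fastforce

lemma wedge_rel_add: "x \<in> wedge_rel V W p \<Longrightarrow> y \<in> wedge_rel V W p \<Longrightarrow> x + y \<in> wedge_rel V W p"
  using wedge_rel.diff[of x V W p "- y"] wedge_rel_uminus by force

lemma wedge_rel_add_closed: "add_closed (wedge_rel V W p)"
  unfolding add_closed_def by (blast intro: wedge_rel.zero wedge_rel.diff)

definition wedge_eq :: "sec set \<Rightarrow> sec set \<Rightarrow> nat \<Rightarrow> (sec list \<times> sec \<Rightarrow>\<^sub>0 int) \<Rightarrow> (sec list \<times> sec \<Rightarrow>\<^sub>0 int) \<Rightarrow> bool" where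
  "wedge_eq V W p x y \<longleftrightarrow> x - y \<in> wedge_rel V W p"

lemma wedge_eq_refl [simp]: "wedge_eq V W p x x"
  by (simp add: wedge_eq_def wedge_rel.zero)

lemma wedge_eq_sym: "wedge_eq V W p x y \<Longrightarrow> wedge_eq V W p y x"
  unfolding wedge_eq_def using wedge_rel_uminus by fastforce

lemma wedge_eq_trans [trans]: "wedge_eq V W p x y \<Longrightarrow> wedge_eq V W p y z \<Longrightarrow> wedge_eq V W p x z"
  unfolding wedge_eq_def using wedge_rel_add by fastforce

lemma wedge_eq_diff:
  "wedge_eq V W p x y \<Longrightarrow> wedge_eq V W p x' y' \<Longrightarrow> wedge_eq V W p (x - x') (y - y')"
  unfolding wedge_eq_def using wedge_rel.diff[of "x - y" V W p "x' - y'"] by (simp add: algebra_simps)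

lemma wedge_eq_sum:
  assumes "\<And>i. i \<in> A \<Longrightarrow> wedge_eq V W p (x i) (y i)"
  shows "wedge_eq V W p (sum x A) (sum y A)"
  using add_closed_sum[OF wedge_rel_add_closed, of A "\<lambda>i. x i - y i" V W p] assms
  by (simp add: wedge_eq_def sum_subtractf)

lemma wedge_eq_uminus: "wedge_eq V W p x y \<Longrightarrow> wedge_eq V W p (- x) (- y)"
  using wedge_eq_diff[of V W p 0 0 x y] by simp

lemma wedge_eq_sign: "wedge_eq V W p x y \<Longrightarrow> wedge_eq V W p (frag_cmul ((-1) ^ n) x) (frag_cmul ((-1) ^ n) y)"
  by (cases "even n") (auto intro: wedge_eq_uminus)

lemma wedge_free_induct [consumes 1, case_names zero of_pair diff]:
  assumes "x \<in> wedge_free V' W p" "P 0"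
    "\<And>vs u. length vs = p \<Longrightarrow> set vs \<subseteq> V' \<Longrightarrow> u \<in> W \<Longrightarrow> P (frag_of (vs, u))"
    "\<And>x y. P x \<Longrightarrow> P y \<Longrightarrow> P (x - y)"
  shows "P x"
proof -
  have "Poly_Mapping.keys x \<subseteq> {(vs, u). length vs = p \<and> set vs \<subseteq> V' \<and> u \<in> W}"
    using assms(1) by (simp add: wedge_free_def)
  then show ?thesis
    by (induction x rule: frag_induction) (use assms(2-4) in auto)
qed

lemma wedge_free_of: "length vs = p \<Longrightarrow> set vs \<subseteq> V' \<Longrightarrow> u \<in> W \<Longrightarrow> frag_of (vs, u) \<in> wedge_free V' W p"
  by (simp add: wedge_free_def keys_frag_of)

lemma wedge_free_add_closed: "add_closed (wedge_free V' W p)"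
  unfolding add_closed_def wedge_free_def using keys_diff by force

lemma wedge_free_sign: "x \<in> wedge_free V' W p \<Longrightarrow> frag_cmul ((-1) ^ n) x \<in> wedge_free V' W p"
  by (auto simp: wedge_free_def)

lemma koszul_map_free:
  assumes "x \<in> wedge_free V W p" and "\<And>v u. v \<in> V \<Longrightarrow> u \<in> W \<Longrightarrow> v * u \<in> W'"
  shows "koszul_map x \<in> wedge_free V W' (p - 1)"
  using assms(1)
proof (induction x rule: wedge_free_induct)
  case zero
  then show ?case by (simp add: koszul_map_def wedge_free_def)
next
  case (of_pair vs u)
  have "frag_of (take l vs @ drop (l + 1) vs, vs ! l * u) \<in> wedge_free V W' (p - 1)" if "l < length vs" for l
    using of_pair that set_take_subset[of l vs] set_drop_subset[of "l + 1" vs]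
    by (intro wedge_free_of assms(2)) auto
  then show ?case
    unfolding koszul_map_def frag_extend_of prod.case
    by (intro add_closed_sum[OF wedge_free_add_closed] wedge_free_sign) auto
next
  case (diff x y)
  then show ?case by (simp add: koszul_map_def frag_extend_diff add_closedD[OF wedge_free_add_closed])
qed

text \<open>
  A basis of \<open>V\<close> with coordinate functionals that are defined, and linear, on all pairs of polynomials.
\<close>

locale koszul_basis =
  fixes I :: "nat set" and E :: "nat \<Rightarrow> sec" and \<kappa> :: "nat \<Rightarrow> sec \<Rightarrow> complex" and V :: "sec set"
  assumes finite_I: "finite I" and V: "sec_subspace V" and E: "i \<in> I \<Longrightarrow> E i \<in> V"
    and kappa_add: "\<kappa> i (s + t) = \<kappa> i s + \<kappa> i t" and kappa_scale: "\<kappa> i (sconst c * s) = c * \<kappa> i s"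
    and kappa_out: "i \<notin> I \<Longrightarrow> \<kappa> i s = 0"
    and kappa_E: "j \<in> I \<Longrightarrow> \<kappa> i (E j) = (if i = j then 1 else 0)"
    and expand: "s \<in> V \<Longrightarrow> s = (\<Sum>i\<in>I. sconst (\<kappa> i s) * E i)"
begin

text \<open>
  The coordinates of the class of the pair \<open>(vs, u)\<close>, that is, of the wedge product of \<open>vs\<close> tensor \<open>u\<close>.
\<close>

primrec coords :: "sec list \<Rightarrow> sec \<Rightarrow> nat list \<Rightarrow> sec" where
  "coords [] u = (\<lambda>J. if J = [] then u else 0)"
| "coords (v # vs) u = vwedge (\<lambda>i. sconst (\<kappa> i v)) (coords vs u)"

lemma coords_mult: "coords vs (c * u) = (\<lambda>J. c * coords vs u J)"
  by (induction vs) (auto simp: wedge_mult)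

lemma coords_add: "coords vs (u + w) = (\<lambda>J. coords vs u J + coords vs w J)"
  by (induction vs) (auto simp: wedge_add)

lemma coords_cochains:
  assumes "sec_subspace W" "u \<in> W"
  shows "coords vs u \<in> cochains I (length vs) W"
proof (induction vs)
  case Nil
  show ?case
    by (rule cochainsI) (use assms in \<open>auto simp: alternating_def sec_subspaceD split: if_splits\<close>)
next
  case (Cons v vs)
  have "sconst (\<kappa> i v) \<noteq> 0 \<Longrightarrow> i \<in> I" for i using kappa_out by force
  then show ?case
    using wedge_cochains[OF Cons order_refl, of "\<lambda>i. sconst (\<kappa> i v)"] sec_subspaceD[OF assms(1)] by auto
qed

lemma coords_add_wedge:
  "coords (as @ (v + w) # bs) u J = coords (as @ v # bs) u J + coords (as @ w # bs) u J"
proof (induction as arbitrary: J)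
  case Nil
  then show ?case by (simp add: kappa_add sconst_add wedge_add_left)
next
  case (Cons a as)
  have "coords (as @ (v + w) # bs) u = (\<lambda>J. coords (as @ v # bs) u J + coords (as @ w # bs) u J)"
    using Cons by blast
  then show ?case by (simp add: wedge_add)
qed

lemma coords_scale_wedge:
  "coords (as @ (sconst c * v) # bs) u J = sconst c * coords (as @ v # bs) u J"
proof (induction as arbitrary: J)
  case Nil
  then show ?case by (simp add: kappa_scale sconst_mult wedge_mult_left)
next
  case (Cons a as)
  have "coords (as @ (sconst c * v) # bs) u = (\<lambda>J. sconst c * coords (as @ v # bs) u J)"
    using Cons by blast
  then show ?case by (simp add: wedge_mult)
qed

lemma alternating_coords: "alternating (\<lambda>vs. coords vs u J)"
proof -
  have "coords (as @ v # w # bs) u J = - coords (as @ w # v # bs) u J" for as v w bs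
  proof (induction as arbitrary: J)
    case Nil
    show ?case unfolding append_Nil coords.simps by (rule wedge_anticommute)
  next
    case (Cons a as)
    have "coords (as @ v # w # bs) u = (\<lambda>J. - coords (as @ w # v # bs) u J)" using Cons by blast
    then show ?case by (simp add: wedge_uminus)
  qed
  then show ?thesis unfolding alternating_def by blast
qed

text \<open>
  Since contraction is a skew derivation, it removes the factors of a wedge product one by one, with
  alternating signs. For \<open>e = E\<close> this is the Koszul differential, for a unit vector \<open>e\<close> it is the expansion of
  a determinant along its first row.
\<close>

lemma contract_coords:
  "contract I e (coords vs u) J = (\<Sum>b<length vs.
     (-1) ^ b * coords (take b vs @ drop (b + 1) vs) ((\<Sum>i\<in>I. sconst (\<kappa> i (vs ! b)) * e i) * u) J)"
proof (induction vs arbitrary: J)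
  case Nil
  then show ?case by (simp add: contract_def)
next
  case (Cons v vs)
  let ?h = "\<lambda>v. \<Sum>i\<in>I. sconst (\<kappa> i v) * e i"
  have IH: "contract I e (coords vs u) = (\<lambda>J. \<Sum>b<length vs.
     (-1) ^ b * coords (take b vs @ drop (b + 1) vs) (?h (vs ! b) * u) J)"
    using Cons by blast
  have "contract I e (coords (v # vs) u) J
      = ?h v * coords vs u J - vwedge (\<lambda>i. sconst (\<kappa> i v)) (contract I e (coords vs u)) J"
    by (simp add: contract_wedge)
  also have "vwedge (\<lambda>i. sconst (\<kappa> i v)) (contract I e (coords vs u)) J
      = (\<Sum>b<length vs. (-1) ^ b * coords (v # take b vs @ drop (b + 1) vs) (?h (vs ! b) * u) J)"
    by (simp add: IH wedge_sum wedge_mult)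
  finally show ?case
    by (simp add: sum.lessThan_Suc_shift coords_mult sum_negf del: sum.lessThan_Suc)
qed

definition coord_map :: "(sec list \<times> sec \<Rightarrow>\<^sub>0 int) \<Rightarrow> nat list \<Rightarrow> sec" where
  "coord_map x J = frag_eval (\<lambda>(vs, u). coords vs u J) x"

lemma coord_map_diff: "coord_map (x - y) J = coord_map x J - coord_map y J"
  by (simp add: coord_map_def frag_eval_diff)

lemma coord_map_add: "coord_map (x + y) J = coord_map x J + coord_map y J"
  by (simp add: coord_map_def frag_eval_add)

lemma coord_map_uminus: "coord_map (- x) J = - coord_map x J"
  by (simp add: coord_map_def frag_eval_uminus)

lemma coord_map_of [simp]: "coord_map (frag_of (vs, u)) J = coords vs u J"
  by (simp add: coord_map_def)

lemma coord_map_sum: "coord_map (\<Sum>i\<in>A. x i) J = (\<Sum>i\<in>A. coord_map (x i) J)"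
  by (simp add: coord_map_def frag_eval_sum)

lemma coord_map_cochains:
  assumes "x \<in> wedge_free V W p" "sec_subspace W"
  shows "coord_map x \<in> cochains I p W"
  using assms(1)
proof (induction x rule: wedge_free_induct)
  case zero
  then show ?case using sec_subspaceD[OF assms(2)] cochains_zero by (simp add: coord_map_def[abs_def])
next
  case (of_pair vs u)
  then show ?case using coords_cochains[OF assms(2)] by (auto simp: coord_map_def[abs_def])
next
  case (diff x y)
  have "coord_map (x - y) = (\<lambda>J. coord_map x J - coord_map y J)" by (auto simp: coord_map_diff)
  then show ?case using cochains_diff[OF sec_subspaceD(1)[OF assms(2)] diff] by simp
qed

lemma coord_map_koszul:
  assumes "x \<in> wedge_free V W p"
  shows "coord_map (koszul_map x) J = - contract I E (coord_map x) J"
  using assms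
proof (induction x rule: wedge_free_induct)
  case zero
  then show ?case by (simp add: koszul_map_def coord_map_def contract_def)
next
  case (of_pair vs u)
  have "(\<Sum>i\<in>I. sconst (\<kappa> i (vs ! b)) * E i) = vs ! b" if "b < length vs" for b
    using expand[of "vs ! b"] of_pair that by (metis nth_mem subsetD)
  then have "contract I E (coords vs u) J
      = (\<Sum>b<length vs. (-1) ^ b * coords (take b vs @ drop (b + 1) vs) (vs ! b * u) J)"
    by (simp add: contract_coords)
  moreover have "coord_map (frag_of (vs, u)) = coords vs u" by auto
  moreover have "coord_map (koszul_map (frag_of (vs, u))) J
      = (\<Sum>b<length vs. (-1) ^ (b + 1) * coords (take b vs @ drop (b + 1) vs) (vs ! b * u) J)"
    unfolding koszul_map_def coord_map_def frag_extend_of prod.case frag_eval_sum frag_eval_sign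
      frag_eval_of ..
  ultimately show ?case by (simp add: sum_negf)
next
  case (diff x y)
  have "coord_map (x - y) = (\<lambda>J. coord_map x J - coord_map y J)" by (auto simp: coord_map_diff)
  moreover have "koszul_map (x - y) = koszul_map x - koszul_map y"
    by (simp add: koszul_map_def frag_extend_diff)
  ultimately show ?case using diff by (simp add: coord_map_diff contract_diff)
qed

text \<open>
  The defining relations of exterior power and tensor product hold for determinants.
\<close>

lemma coord_map_rel: "x \<in> wedge_rel V W p \<Longrightarrow> coord_map x J = 0"
proof (induction rule: wedge_rel.induct)
  case zero
  then show ?case by (simp add: coord_map_def)
next
  case (alternating vs u i k)
  then have "\<not> distinct vs" unfolding distinct_conv_nth by (metis less_trans nat_neq_iff)
  then show ?case using alternating_not_distinct[OF alternating_coords] by simp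
qed (auto simp: coord_map_diff coords_add_wedge coords_add coords_mult coords_scale_wedge
    sec_scale_sconst)

end

lemma wedge_eq_tensor_add:
  assumes "length vs = p" "set vs \<subseteq> V" "u \<in> W" "w \<in> W"
  shows "wedge_eq V W p (frag_of (vs, u + w)) (frag_of (vs, u) + frag_of (vs, w))"
  using wedge_rel.add_tensor[OF assms] by (simp add: wedge_eq_def algebra_simps)

lemma wedge_eq_tensor_zero:
  assumes "length vs = p" "set vs \<subseteq> V" "0 \<in> W"
  shows "wedge_eq V W p (frag_of (vs, 0)) 0"
  using wedge_rel_uminus[OF wedge_rel.add_tensor[OF assms assms(3)]] by (simp add: wedge_eq_def)

lemma wedge_eq_tensor_sum:
  assumes "length vs = p" "set vs \<subseteq> V" "sec_subspace W" "\<And>i. i \<in> A \<Longrightarrow> u i \<in> W"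
  shows "wedge_eq V W p (frag_of (vs, \<Sum>i\<in>A. u i)) (\<Sum>i\<in>A. frag_of (vs, u i))"
  using assms(4)
proof (induction A rule: infinite_finite_induct)
  case (insert a A)
  have "wedge_eq V W p (frag_of (vs, u a + (\<Sum>i\<in>A. u i))) (frag_of (vs, u a) + frag_of (vs, \<Sum>i\<in>A. u i))"
    using insert.prems assms by (intro wedge_eq_tensor_add add_closed_sum) (auto simp: sec_subspaceD)
  also have "wedge_eq V W p \<dots> (frag_of (vs, u a) + (\<Sum>i\<in>A. frag_of (vs, u i)))"
    using insert by (simp add: wedge_eq_def)
  finally show ?case using insert by simp
qed (use wedge_eq_tensor_zero[OF assms(1,2)] sec_subspaceD(3)[OF assms(3)] in auto)

lemma wedge_eq_tensor_sign:
  assumes "length vs = p" "set vs \<subseteq> V" "sec_subspace W" "u \<in> W"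
  shows "wedge_eq V W p (frag_cmul ((-1) ^ n) (frag_of (vs, u))) (frag_of (vs, (-1) ^ n * u))"
proof (cases "even n")
  case False
  have "wedge_eq V W p (frag_of (vs, u + - u)) (frag_of (vs, u) + frag_of (vs, - u))"
    using assms by (intro wedge_eq_tensor_add) (auto simp: sec_subspaceD)
  moreover have "wedge_eq V W p (frag_of (vs, u + - u)) 0"
    using wedge_eq_tensor_zero[OF assms(1,2)] sec_subspaceD(3)[OF assms(3)] by simp
  ultimately have "wedge_eq V W p (frag_of (vs, u) + frag_of (vs, - u)) 0"
    using wedge_eq_sym wedge_eq_trans by blast
  then show ?thesis
    using False wedge_rel_uminus[of "frag_of (vs, u) + frag_of (vs, - u)" V W p] by (simp add: wedge_eq_def)
qed simp

lemma wedge_eq_slot_add: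
  assumes "length bs + 1 = p" "set bs \<subseteq> V" "v \<in> V" "w \<in> V" "u \<in> W"
  shows "wedge_eq V W p (frag_of ((v + w) # bs, u)) (frag_of (v # bs, u) + frag_of (w # bs, u))"
  using wedge_rel.add_wedge[of "[]" bs p V v w u W] assms by (simp add: wedge_eq_def algebra_simps)

lemma wedge_eq_slot_sum:
  assumes "length bs + 1 = p" "set bs \<subseteq> V" "sec_subspace V" "\<And>i. i \<in> A \<Longrightarrow> v i \<in> V" "u \<in> W"
  shows "wedge_eq V W p (frag_of ((\<Sum>i\<in>A. v i) # bs, u)) (\<Sum>i\<in>A. frag_of (v i # bs, u))"
proof -
  have zero: "wedge_eq V W p (frag_of (0 # bs, u)) 0"
    using wedge_eq_slot_add[OF assms(1,2) _ _ assms(5), of 0 0] sec_subspaceD(3)[OF assms(3)]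
      wedge_rel_uminus[of "- frag_of (0 # bs, u)" V W p] by (simp add: wedge_eq_def)
  show ?thesis
    using assms(4)
  proof (induction A rule: infinite_finite_induct)
    case (insert a A)
    have "wedge_eq V W p (frag_of ((v a + (\<Sum>i\<in>A. v i)) # bs, u))
        (frag_of (v a # bs, u) + frag_of ((\<Sum>i\<in>A. v i) # bs, u))"
      using insert.prems assms by (intro wedge_eq_slot_add add_closed_sum) (auto simp: sec_subspaceD)
    also have "wedge_eq V W p \<dots> (frag_of (v a # bs, u) + (\<Sum>i\<in>A. frag_of (v i # bs, u)))"
      using insert by (simp add: wedge_eq_def)
    finally show ?case using insert by simp
  qed (use zero in auto)
qed

lemma wedge_eq_slot_scale:
  assumes "length bs + 1 = p" "set bs \<subseteq> V" "v \<in> V" "u \<in> W"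
  shows "wedge_eq V W p (frag_of ((sconst c * v) # bs, u)) (frag_of (v # bs, sconst c * u))"
  using wedge_rel.scale[of "[]" bs p V v u W c] assms by (simp add: wedge_eq_def sec_scale_sconst)

text \<open>
  The usual polarization: expand the wedge product with \<open>v + w\<close> in both of the two places.
\<close>

lemma wedge_eq_swap:
  assumes p: "length as + length bs + 2 = p" and V: "set as \<subseteq> V" "set bs \<subseteq> V" "v \<in> V" "w \<in> V"
    and "sec_subspace V" "u \<in> W"
  shows "wedge_eq V W p (frag_of (as @ v # w # bs, u)) (- frag_of (as @ w # v # bs, u))"
proof -
  let ?X = "\<lambda>x y. frag_of (as @ x # y # bs, u)"
  have vw: "v + w \<in> V" using assms by (simp add: sec_subspaceD)
  have alt: "?X x x \<in> wedge_rel V W p" if "x \<in> V" for x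
    by (rule wedge_rel.alternating[where i = "length as" and k = "Suc (length as)"])
       (use that assms in \<open>auto simp: nth_append\<close>)
  have left: "?X (x + y) z - ?X x z - ?X y z \<in> wedge_rel V W p" if "x \<in> V" "y \<in> V" "z \<in> V" for x y z
    using wedge_rel.add_wedge[of as "z # bs" p V x y u W] that assms by simp
  have right: "?X z (x + y) - ?X z x - ?X z y \<in> wedge_rel V W p" if "x \<in> V" "y \<in> V" "z \<in> V" for x y z
    using wedge_rel.add_wedge[of "as @ [z]" bs p V x y u W] that assms by simp
  have "?X (v + w) (v + w) - (?X (v + w) (v + w) - ?X v (v + w) - ?X w (v + w))
      - (?X v (v + w) - ?X v v - ?X v w) - (?X w (v + w) - ?X w v - ?X w w) - ?X v v - ?X w w
      \<in> wedge_rel V W p"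
    by (intro wedge_rel.diff alt left right V vw)
  then show ?thesis by (simp add: wedge_eq_def algebra_simps)
qed

lemma wedge_eq_move:
  assumes "length as + length bs + 1 = p" "set as \<subseteq> V" "set bs \<subseteq> V" "v \<in> V" "sec_subspace V" "u \<in> W"
  shows "wedge_eq V W p (frag_of (v # as @ bs, u)) (frag_cmul ((-1) ^ length as) (frag_of (as @ v # bs, u)))"
  using assms(1-3)
proof (induction as arbitrary: bs rule: rev_induct)
  case (snoc a as)
  have "wedge_eq V W p (frag_of (v # as @ a # bs, u)) (frag_cmul ((-1) ^ length as) (frag_of (as @ v # a # bs, u)))"
    using snoc.IH[of "a # bs"] snoc.prems by simp
  also have "wedge_eq V W p \<dots> (frag_cmul ((-1) ^ length as) (- frag_of (as @ a # v # bs, u)))"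
    using snoc.prems assms(4-6) by (intro wedge_eq_sign wedge_eq_swap) auto
  finally show ?case by (cases "even (length as)") simp_all
qed simp

lemma wedge_rel_prefix:
  assumes "x \<in> wedge_rel V W p" "v \<in> V"
  shows "frag_extend (\<lambda>(vs, u). frag_of (v # vs, u)) x \<in> wedge_rel V W (Suc p)"
  using assms(1)
proof (induction rule: wedge_rel.induct)
  case zero
  show ?case by (simp add: wedge_rel.zero)
next
  case (diff x y)
  then show ?case by (simp add: frag_extend_diff wedge_rel.diff)
next
  case (add_wedge as bs x y u)
  then show ?case using wedge_rel.add_wedge[of "v # as" bs "Suc p" V x y u W] assms(2)
    by (simp add: frag_extend_diff)
next
  case (add_tensor vs u w)
  then show ?case using wedge_rel.add_tensor[of "v # vs" "Suc p" V u W w] assms(2)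
    by (simp add: frag_extend_diff)
next
  case (scale as bs x u c)
  then show ?case using wedge_rel.scale[of "v # as" bs "Suc p" V x u W c] assms(2)
    by (simp add: frag_extend_diff)
next
  case (alternating vs u i k)
  then show ?case using wedge_rel.alternating[of "v # vs" "Suc p" V u W "Suc i" "Suc k"] assms(2)
    by simp
qed

definition index_lists :: "'i set \<Rightarrow> nat \<Rightarrow> 'i list set" where
  "index_lists I p = {J. set J \<subseteq> I \<and> length J = p}"

lemma finite_index_lists: "finite I \<Longrightarrow> finite (index_lists I p)"
  unfolding index_lists_def by (rule finite_lists_length_eq)

lemma index_lists_0 [simp]: "index_lists I 0 = {[]}"
  by (auto simp: index_lists_def)

lemma sum_index_lists_Suc: "(\<Sum>J\<in>index_lists I (Suc p). f J) = (\<Sum>i\<in>I. \<Sum>J\<in>index_lists I p. f (i # J))"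
proof -
  have "index_lists I (Suc p) = (\<lambda>(i, J). i # J) ` (I \<times> index_lists I p)"
    by (auto simp: index_lists_def length_Suc_conv image_iff)
  moreover have "inj_on (\<lambda>(i, J). i # J) (I \<times> index_lists I p)"
    by (auto simp: inj_on_def)
  ultimately show ?thesis
    by (simp add: sum.reindex sum.cartesian_product split_def)
qed

context koszul_basis
begin

text \<open>
  Every element is the combination of the wedge products of basis vectors given by its coordinates. All
  lists of indices are used, not only the increasing ones, which explains the factor \<open>1 / fact p\<close>. For the
  induction the pair \<open>(vs, u)\<close> is divided into \<open>p + 1\<close> equal parts; in the \<open>b\<close>-th one the entry
  \<open>vs ! b\<close> is moved to the front and expanded in the basis.
\<close>

lemma normal_form_pair:
  assumes W: "sec_subspace W"
  shows "length vs = p \<Longrightarrow> set vs \<subseteq> V \<Longrightarrow> u \<in> W \<Longrightarrow>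
    wedge_eq V W p (frag_of (vs, u))
      (\<Sum>J\<in>index_lists I p. frag_of (map E J, sconst (1 / fact p) * coords vs u J))"
proof (induction p arbitrary: vs u)
  case 0
  then show ?case by simp
next
  case (Suc p)
  note [simp] = sec_subspaceD[OF W]
  define u' where "u' = sconst (1 / of_nat (Suc p)) * u"
  have u': "u' \<in> W" using Suc.prems by (simp add: u'_def)
  have "sconst (1 / of_nat (Suc p)) * of_nat (Suc p) = sconst (1 / of_nat (Suc p) * of_nat (Suc p))"
    by (simp only: sconst_mult sconst_of_nat)
  also have "\<dots> = 1" by (simp del: of_nat_Suc)
  finally have "(\<Sum>b<Suc p. u') = u"
    by (simp add: u'_def mult_ac del: of_nat_Suc)
  define del where "del = (\<lambda>b. take b vs @ drop (b + 1) vs)"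
  have del: "length (del b) = p" "set (del b) \<subseteq> V" "vs ! b \<in> V" if "b < Suc p" for b
    using that Suc.prems set_take_subset[of b vs] set_drop_subset[of "b + 1" vs]
    by (auto simp: del_def)
  let ?c = "\<lambda>b i. (-1) ^ b * (sconst (\<kappa> i (vs ! b)) * u')"
  have cW: "?c b i \<in> W" for b i
    using u' sec_subspaceD(2)[OF W, of "sconst (\<kappa> i (vs ! b)) * u'" "(-1) ^ b"] by (simp add: sconst_power_neg_one)
  have "wedge_eq V W (Suc p) (frag_of (vs, u)) (\<Sum>b<Suc p. frag_of (vs, u'))"
    using wedge_eq_tensor_sum[OF Suc.prems(1,2) W, of "{..<Suc p}" "\<lambda>_. u'"] u' \<open>(\<Sum>b<Suc p. u') = u\<close>
    by simp
  also have "wedge_eq V W (Suc p) \<dots> (\<Sum>b<Suc p. \<Sum>i\<in>I. \<Sum>J\<in>index_lists I p.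
      frag_of (map E (i # J), sconst (1 / fact p) * coords (del b) (?c b i) J))"
  proof (rule wedge_eq_sum)
    fix b assume "b \<in> {..<Suc p}"
    then have b: "b < Suc p" by simp
    have vs: "take b vs @ vs ! b # drop (b + 1) vs = vs" "length (take b vs) = b"
      using b Suc.prems by (auto simp: id_take_nth_drop[symmetric])
    have "wedge_eq V W (Suc p) (frag_of (vs ! b # del b, u')) (frag_cmul ((-1) ^ b) (frag_of (vs, u')))"
      using wedge_eq_move[of "take b vs" "drop (b + 1) vs" "Suc p" V "vs ! b" u' W] del[OF b] vs u' V b Suc.prems
      by (simp add: del_def)
    from wedge_eq_sign[OF this, of b]
    have "wedge_eq V W (Suc p) (frag_of (vs, u')) (frag_cmul ((-1) ^ b) (frag_of (vs ! b # del b, u')))"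
      by (intro wedge_eq_sym[of V W "Suc p" "frag_cmul ((-1) ^ b) (frag_of (vs ! b # del b, u'))"])
         (simp add: power_add[symmetric] mult_2[symmetric])
    also have "wedge_eq V W (Suc p) \<dots> (frag_of (vs ! b # del b, (-1) ^ b * u'))"
      using del[OF b] u' by (intro wedge_eq_tensor_sign W) auto
    also have "wedge_eq V W (Suc p) \<dots> (\<Sum>i\<in>I. frag_of ((sconst (\<kappa> i (vs ! b)) * E i) # del b, (-1) ^ b * u'))"
    proof -
      have "(-1) ^ b * u' \<in> W" using sec_subspaceD(2)[OF W u', of "(-1) ^ b"] by (simp add: sconst_power_neg_one)
      then show ?thesis
        using wedge_eq_slot_sum[of "del b" "Suc p" V I "\<lambda>i. sconst (\<kappa> i (vs ! b)) * E i" "(-1) ^ b * u'" W]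
          del[OF b] V expand[OF del(3)[OF b]] E sec_subspaceD(2)[OF V] by simp
    qed
    also have "wedge_eq V W (Suc p) \<dots> (\<Sum>i\<in>I. \<Sum>J\<in>index_lists I p.
      frag_of (map E (i # J), sconst (1 / fact p) * coords (del b) (?c b i) J))"
    proof (rule wedge_eq_sum)
      fix i assume i: "i \<in> I"
      have "(-1) ^ b * u' \<in> W" using sec_subspaceD(2)[OF W u', of "(-1) ^ b"] by (simp add: sconst_power_neg_one)
      then have "wedge_eq V W (Suc p) (frag_of ((sconst (\<kappa> i (vs ! b)) * E i) # del b, (-1) ^ b * u'))
          (frag_of (E i # del b, sconst (\<kappa> i (vs ! b)) * ((-1) ^ b * u')))"
        using del[OF b] E[OF i] by (intro wedge_eq_slot_scale) auto
      also have "sconst (\<kappa> i (vs ! b)) * ((-1) ^ b * u') = ?c b i" by (simp add: mult_ac)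
      also have "wedge_eq V W (Suc p) (frag_of (E i # del b, ?c b i)) (\<Sum>J\<in>index_lists I p.
          frag_of (map E (i # J), sconst (1 / fact p) * coords (del b) (?c b i) J))"
        using wedge_rel_prefix[OF Suc.IH[OF del(1,2)[OF b] cW[of b i], unfolded wedge_eq_def] E[OF i]]
        by (simp add: wedge_eq_def frag_extend_diff frag_extend_sum finite_index_lists[OF finite_I] o_def)
      finally show "wedge_eq V W (Suc p) (frag_of ((sconst (\<kappa> i (vs ! b)) * E i) # del b, (-1) ^ b * u'))
          (\<Sum>J\<in>index_lists I p. frag_of (map E (i # J), sconst (1 / fact p) * coords (del b) (?c b i) J))" .
    qed
    finally show "wedge_eq V W (Suc p) (frag_of (vs, u')) (\<Sum>i\<in>I. \<Sum>J\<in>index_lists I p.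
      frag_of (map E (i # J), sconst (1 / fact p) * coords (del b) (?c b i) J))" .
  qed
  also have "(\<Sum>b<Suc p. \<Sum>i\<in>I. \<Sum>J\<in>index_lists I p.
      frag_of (map E (i # J), sconst (1 / fact p) * coords (del b) (?c b i) J))
    = (\<Sum>J\<in>index_lists I (Suc p). \<Sum>b<Suc p.
      frag_of (map E J, sconst (1 / fact p) * coords (del b) (?c b (hd J)) (tl J)))"
    unfolding sum_index_lists_Suc
    by (subst sum.swap, intro sum.cong refl, subst sum.swap) simp
  also have "wedge_eq V W (Suc p) \<dots>
      (\<Sum>J\<in>index_lists I (Suc p). frag_of (map E J, sconst (1 / fact (Suc p)) * coords vs u J))"
  proof (rule wedge_eq_sum)
    fix J assume "J \<in> index_lists I (Suc p)"
    then obtain i K where J: "J = i # K" "i \<in> I" "K \<in> index_lists I p"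
      by (auto simp: index_lists_def length_Suc_conv)
    have K: "length (map E J) = Suc p" "set (map E J) \<subseteq> V"
      using J E by (auto simp: index_lists_def)
    have "coords vs u' (i # K) = (\<Sum>b<Suc p. coords (del b) (?c b i) K)"
    proof -
      have "(\<Sum>k\<in>I. sconst (\<kappa> k v) * (if k = i then 1 else 0)) = sconst (\<kappa> i v)" for v
      proof -
        have "(\<Sum>k\<in>I. sconst (\<kappa> k v) * (if k = i then 1 else 0)) = (\<Sum>k\<in>I. if k = i then sconst (\<kappa> i v) else 0)"
          by (intro sum.cong) auto
        then show ?thesis using J finite_I by simp
      qed
      moreover have "contract I (\<lambda>k. if k = i then 1 else 0) (coords vs u') K = coords vs u' (i # K)"
      proof -
        have "contract I (\<lambda>k. if k = i then 1 else 0) (coords vs u') K = (\<Sum>k\<in>I. if k = i then coords vs u' (i # K) else 0)"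
          unfolding contract_def by (intro sum.cong) auto
        then show ?thesis using J finite_I by simp
      qed
      ultimately show ?thesis
        using contract_coords[of "\<lambda>k. if k = i then 1 else 0" vs u' K] Suc.prems(1)
        by (simp only: del_def coords_mult)
    qed
    moreover have "sconst (1 / fact p) * coords vs u' J = sconst (1 / fact (Suc p)) * coords vs u J"
    proof -
      have "sconst (1 / fact p) * sconst (1 / of_nat (Suc p)) = sconst (1 / fact (Suc p))"
        by (simp add: sconst_mult[symmetric] field_simps)
      then show ?thesis by (simp add: u'_def coords_mult mult.assoc[symmetric] del: of_nat_Suc fact_Suc)
    qed
    ultimately have eq: "(\<Sum>b<Suc p. sconst (1 / fact p) * coords (del b) (?c b i) K) = sconst (1 / fact (Suc p)) * coords vs u J"
      by (simp only: sum_distrib_left[symmetric] J)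
    have "wedge_eq V W (Suc p) (frag_of (map E J, \<Sum>b<Suc p. sconst (1 / fact p) * coords (del b) (?c b i) K))
      (\<Sum>b<Suc p. frag_of (map E J, sconst (1 / fact p) * coords (del b) (?c b i) K))"
      by (rule wedge_eq_tensor_sum[OF K W]) (intro sec_subspaceD(2)[OF W] cochainsD(2)[OF coords_cochains[OF W cW]])
    then show "wedge_eq V W (Suc p) (\<Sum>b<Suc p. frag_of (map E J, sconst (1 / fact p) * coords (del b) (?c b (hd J)) (tl J)))
      (frag_of (map E J, sconst (1 / fact (Suc p)) * coords vs u J))"
      by (simp only: eq J list.sel wedge_eq_sym)
  qed
  finally show ?case .
qed

lemma normal_form:
  assumes x: "x \<in> wedge_free V W p" and W: "sec_subspace W"
  shows "wedge_eq V W p x (\<Sum>J\<in>index_lists I p. frag_of (map E J, sconst (1 / fact p) * coord_map x J))"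
proof -
  have E': "length (map E J) = p" "set (map E J) \<subseteq> V" if "J \<in> index_lists I p" for J
    using that E by (auto simp: index_lists_def)
  note W' = sec_subspaceD[OF W]
  have "(\<forall>J. coord_map x J \<in> W) \<and>
      wedge_eq V W p x (\<Sum>J\<in>index_lists I p. frag_of (map E J, sconst (1 / fact p) * coord_map x J))"
    using x
  proof (induction x rule: wedge_free_induct)
    case zero
    have "wedge_eq V W p (\<Sum>J\<in>index_lists I p. frag_of (map E J, 0)) (\<Sum>J\<in>index_lists I p. 0)"
      by (intro wedge_eq_sum wedge_eq_tensor_zero E' W') auto
    then show ?case using W' by (simp add: coord_map_def wedge_eq_sym)
  next
    case (of_pair vs u)
    then show ?case using normal_form_pair[OF W] cochainsD(2)[OF coords_cochains[OF W]] by simp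
  next
    case (diff x y)
    let ?c = "\<lambda>x J. sconst (1 / fact p) * coord_map x J"
    have "wedge_eq V W p (x - y) (\<Sum>J\<in>index_lists I p. frag_of (map E J, ?c x J) - frag_of (map E J, ?c y J))"
      unfolding sum_subtractf using diff by (intro wedge_eq_diff) auto
    also have "wedge_eq V W p \<dots> (\<Sum>J\<in>index_lists I p. frag_of (map E J, ?c (x - y) J))"
    proof (rule wedge_eq_sum)
      fix J assume J: "J \<in> index_lists I p"
      have "wedge_eq V W p (frag_of (map E J, ?c (x - y) J + ?c y J)) (frag_of (map E J, ?c (x - y) J) + frag_of (map E J, ?c y J))"
        by (intro wedge_eq_tensor_add E'[OF J] W') (use diff W' in \<open>auto simp: coord_map_diff\<close>)
      moreover have "?c (x - y) J + ?c y J = ?c x J" by (simp add: coord_map_diff algebra_simps)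
      ultimately show "wedge_eq V W p (frag_of (map E J, ?c x J) - frag_of (map E J, ?c y J)) (frag_of (map E J, ?c (x - y) J))"
        by (simp add: wedge_eq_def algebra_simps)
    qed
    finally show ?case using diff W' by (auto simp: coord_map_diff)
  qed
  then show ?thesis by blast
qed

text \<open>
  The coordinates determine an element of the exterior power tensor \<open>W\<close>, by its normal form.
\<close>

lemma coord_map_eq_0_imp_rel:
  assumes x: "x \<in> wedge_free V W p" and W: "sec_subspace W" and "\<And>J. coord_map x J = 0"
  shows "x \<in> wedge_rel V W p"
proof -
  have E': "length (map E J) = p" "set (map E J) \<subseteq> V" if "J \<in> index_lists I p" for J
    using that E by (auto simp: index_lists_def)
  have "wedge_eq V W p x (\<Sum>J\<in>index_lists I p. frag_of (map E J, 0))"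
    using normal_form[OF x W] assms(3) by simp
  also have "wedge_eq V W p \<dots> (\<Sum>J\<in>index_lists I p. 0)"
    by (intro wedge_eq_sum wedge_eq_tensor_zero E' sec_subspaceD[OF W]) auto
  finally show ?thesis by (simp add: wedge_eq_def)
qed

text \<open>
  The coordinates of a normal form are the given ones, by Euler's identity.
\<close>

lemma coords_basis_sum:
  "Y \<in> cochains I p W \<Longrightarrow> (\<Sum>J\<in>index_lists I p. coords (map E J) (Y J) K) = of_nat (fact p) * Y K"
proof (induction p arbitrary: Y K)
  case 0
  then show ?case using cochainsD(5)[OF 0, of K] by simp
next
  case (Suc p)
  have "(\<Sum>J\<in>index_lists I (Suc p). coords (map E J) (Y J) K)
      = (\<Sum>j\<in>I. vwedge (\<lambda>i. if i = j then 1 else 0) (\<lambda>ys. \<Sum>J\<in>index_lists I p. coords (map E J) (Y (j # J)) ys) K)"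
  proof -
    have "(\<lambda>i. sconst (\<kappa> i (E j))) = (\<lambda>i. if i = j then 1 else 0)" if "j \<in> I" for j
      using kappa_E[OF that] by auto
    then show ?thesis by (simp add: sum_index_lists_Suc wedge_sum)
  qed
  also have "\<dots> = (\<Sum>j\<in>I. of_nat (fact p) * vwedge (\<lambda>i. if i = j then 1 else 0) (\<lambda>ys. Y (j # ys)) K)"
    by (simp add: Suc.IH[OF cochains_Cons[OF Suc.prems]] wedge_mult)
  also have "\<dots> = of_nat (fact p) * (of_nat (length K) * Y K)"
    by (simp add: sum_distrib_left[symmetric] euler_wedge[OF cochainsD(1)[OF Suc.prems] finite_I cochainsD(4)[OF Suc.prems]])
  also have "\<dots> = of_nat (fact (Suc p)) * Y K"
    using cochainsD(3)[OF Suc.prems, of K] by (cases "Y K = 0") (auto simp: algebra_simps)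
  finally show ?case .
qed

definition of_cochain :: "nat \<Rightarrow> (nat list \<Rightarrow> sec) \<Rightarrow> (sec list \<times> sec \<Rightarrow>\<^sub>0 int)" where
  "of_cochain p Y = (\<Sum>J\<in>index_lists I p. frag_of (map E J, sconst (1 / fact p) * Y J))"

lemma coord_map_of_cochain:
  assumes "Y \<in> cochains I p W"
  shows "coord_map (of_cochain p Y) = Y"
proof
  fix K
  have "coord_map (of_cochain p Y) K = sconst (1 / fact p) * (\<Sum>J\<in>index_lists I p. coords (map E J) (Y J) K)"
    by (simp add: of_cochain_def coord_map_sum coords_mult sum_distrib_left)
  also have "\<dots> = sconst (1 / fact p) * sconst (of_nat (fact p)) * Y K"
    by (simp only: coords_basis_sum[OF assms] sconst_of_nat mult.assoc)
  also have "\<dots> = Y K" by (simp add: sconst_mult[symmetric])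
  finally show "coord_map (of_cochain p Y) K = Y K" .
qed

lemma of_cochain_free:
  assumes "Y \<in> cochains I p W" "sec_subspace W"
  shows "of_cochain p Y \<in> wedge_free V W p"
  unfolding of_cochain_def
  by (intro add_closed_sum wedge_free_add_closed wedge_free_of sec_subspaceD(2)[OF assms(2)] cochainsD(2)[OF assms(1)])
     (use E in \<open>auto simp: index_lists_def\<close>)

text \<open>
  Coordinates turn the Koszul differential into the contraction with the basis, up to the sign coming from
  the numbering of the factors. As they are injective and surjective on exterior powers, exactness can be
  tested on coordinates.
\<close>

theorem koszul_exact_iff:
  assumes W: "sec_subspace W1" "sec_subspace W2" "sec_subspace W3"
    and mult: "\<And>v u. v \<in> V \<Longrightarrow> u \<in> W1 \<Longrightarrow> v * u \<in> W2" "\<And>v u. v \<in> V \<Longrightarrow> u \<in> W2 \<Longrightarrow> v * u \<in> W3"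
  shows "koszul_exact I E p W1 W2 \<longleftrightarrow>
    {x \<in> wedge_free V W2 p. koszul_map x \<in> wedge_rel V W3 (p - 1)} \<subseteq>
    {koszul_map y + z | y z. y \<in> wedge_free V W1 (p + 1) \<and> z \<in> wedge_rel V W2 p}"
    (is "_ \<longleftrightarrow> ?C \<subseteq> ?B")
proof
  assume ex: "koszul_exact I E p W1 W2"
  show "?C \<subseteq> ?B"
  proof
    fix x assume "x \<in> ?C"
    then have x: "x \<in> wedge_free V W2 p" and dx: "koszul_map x \<in> wedge_rel V W3 (p - 1)" by auto
    have "contract I E (coord_map x) J = 0" for J
      using coord_map_koszul[OF x, of J] coord_map_rel[OF dx, of J] by simp
    then obtain Y where Y: "Y \<in> cochains I (Suc p) W1" and dY: "\<And>J. contract I E Y J = coord_map x J"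
      using koszul_exactD[OF ex coord_map_cochains[OF x W(2)]] by blast
    define y where "y = - of_cochain (Suc p) Y"
    have y: "y \<in> wedge_free V W1 (p + 1)"
      unfolding y_def using add_closedD(3)[OF wedge_free_add_closed of_cochain_free[OF Y W(1)]] by simp
    have "coord_map y J = - Y J" for J
      by (simp add: y_def coord_map_uminus coord_map_of_cochain[OF Y])
    then have "coord_map (koszul_map y) J = coord_map x J" for J
      unfolding coord_map_koszul[OF y] by (simp add: contract_def sum_negf) (simp add: dY[symmetric] contract_def)
    moreover have "koszul_map y \<in> wedge_free V W2 p" using koszul_map_free[OF y mult(1)] by simp
    ultimately have "x - koszul_map y \<in> wedge_rel V W2 p"
      by (intro coord_map_eq_0_imp_rel W add_closedD[OF wedge_free_add_closed] x) (simp_all add: coord_map_diff)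
    then show "x \<in> ?B" using y by (intro CollectI exI[of _ y] exI[of _ "x - koszul_map y"]) simp
  qed
next
  assume CB: "?C \<subseteq> ?B"
  show "koszul_exact I E p W1 W2"
  proof (rule koszul_exactI)
    fix Z assume Z: "Z \<in> cochains I p W2" and cyc: "\<And>xs. contract I E Z xs = 0"
    let ?x = "of_cochain p Z"
    have x: "?x \<in> wedge_free V W2 p" by (rule of_cochain_free[OF Z W(2)])
    have "koszul_map ?x \<in> wedge_rel V W3 (p - 1)"
      by (intro coord_map_eq_0_imp_rel koszul_map_free[OF x mult(2)] W)
         (simp_all add: coord_map_koszul[OF x] coord_map_of_cochain[OF Z] cyc)
    then obtain y z where y: "y \<in> wedge_free V W1 (p + 1)" and z: "z \<in> wedge_rel V W2 p" and "?x = koszul_map y + z"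
      using CB x by blast
    then have "Z J = coord_map (koszul_map y) J + coord_map z J" for J
      using coord_map_of_cochain[OF Z] by (metis coord_map_add)
    then have ZJ: "Z J = - contract I E (coord_map y) J" for J
      using coord_map_koszul[OF y] coord_map_rel[OF z] by simp
    have "(\<lambda>J. 0 - coord_map y J) \<in> cochains I (Suc p) W1"
      using coord_map_cochains[OF y W(1)] sec_subspaceD[OF W(1)] by (intro cochains_diff cochains_zero) auto
    moreover have "contract I E (\<lambda>J. 0 - coord_map y J) xs = Z xs" for xs
      by (simp add: ZJ contract_diff) (simp add: contract_def sum_negf)
    ultimately show "\<exists>Y\<in>cochains I (Suc p) W1. \<forall>xs. contract I E Y xs = Z xs" by blast
  qed
qed

end

section \<open>The graded pieces of the section ring\<close>

text \<open>
  The nodes: the parameter nodes, and the two nodes lying over \<open>0\<close> and \<open>\<infinity>\<close> on both components. The set \<open>I\<close>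
  of parameter indices is arbitrary, so that normalizing a node amounts to removing an index; the indices up
  to \<open>m\<close> are those for which the torsion bundle has the gluing factor \<open>1\<close>.
\<close>

datatype pt = Fin nat | Zero | Inf

definition pts :: "nat set \<Rightarrow> pt set" where
  "pts I = Fin ` I \<union> {Zero, Inf}"

definition distinct_nodes :: "nat set \<Rightarrow> (nat \<times> 2 \<Rightarrow> complex) \<Rightarrow> bool" where
  "distinct_nodes I a \<longleftrightarrow> finite I \<and> (\<forall>j. \<forall>l\<in>I. a (l, j) \<noteq> 0 \<and> (\<forall>r\<in>I. l \<noteq> r \<longrightarrow> a (l, j) \<noteq> a (r, j)))"

definition lin_prod :: "nat set \<Rightarrow> (nat \<times> 2 \<Rightarrow> complex) \<Rightarrow> 2 \<Rightarrow> complex poly" where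
  "lin_prod I a j = (\<Prod>r\<in>I. [:- a (r, j), 1:])"

text \<open>
  The coordinates of the map to projective space, up to a factor which makes their coefficients polynomial
  in the parameters. The change of sign on the second component is the isomorphism of line bundles that makes them
  sections.
\<close>

definition basis_sec :: "nat \<Rightarrow> nat set \<Rightarrow> (nat \<times> 2 \<Rightarrow> complex) \<Rightarrow> nat \<Rightarrow> sec" where
  "basis_sec m I a l = (\<chi> j. if l \<le> m then smult (if j = 1 then 1 else -1) ([:0, 1:] * lin_prod (I - {l}) a j)
     else smult (a (l, j)) (lin_prod (I - {l}) a j))"

definition pt_eval :: "(nat \<times> 2 \<Rightarrow> complex) \<Rightarrow> nat \<Rightarrow> 2 \<Rightarrow> pt \<Rightarrow> complex poly \<Rightarrow> complex" where
  "pt_eval a d j P f = (case P of Fin l \<Rightarrow> poly f (a (l, j)) | Zero \<Rightarrow> poly f 0 | Inf \<Rightarrow> coeff f d)"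

text \<open>
  The residue denominators, without signs that are the same on both components.
\<close>

definition pt_denom :: "nat set \<Rightarrow> (nat \<times> 2 \<Rightarrow> complex) \<Rightarrow> 2 \<Rightarrow> pt \<Rightarrow> complex" where
  "pt_denom I a j P = (case P of Fin l \<Rightarrow> - a (l, j) * (\<Prod>r\<in>I - {l}. a (l, j) - a (r, j))
     | Zero \<Rightarrow> (\<Prod>r\<in>I. - a (r, j)) | Inf \<Rightarrow> 1)"

definition pt_sign :: "nat \<Rightarrow> pt \<Rightarrow> complex" where
  "pt_sign m P = (case P of Fin l \<Rightarrow> if l \<le> m then 1 else -1 | Zero \<Rightarrow> -1 | Inf \<Rightarrow> 1)"

definition pt_glue :: "nat \<Rightarrow> nat set \<Rightarrow> (nat \<times> 2 \<Rightarrow> complex) \<Rightarrow> pt \<Rightarrow> complex" where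
  "pt_glue m I a P = - (pt_denom I a 1 P / pt_denom I a 2 P) * pt_sign m P"

definition secs_le :: "nat \<Rightarrow> sec set" where
  "secs_le d = {s. \<forall>j. degree (s $ j) \<le> d}"

text \<open>
  The sections of the \<open>q\<close>-th power of the line bundle, as pairs of dehomogenized forms.
\<close>

definition sec_ring :: "nat \<Rightarrow> nat set \<Rightarrow> (nat \<times> 2 \<Rightarrow> complex) \<Rightarrow> nat \<Rightarrow> sec set" where
  "sec_ring m I a q = {s \<in> secs_le (q * card I). \<forall>P\<in>pts I.
     pt_eval a (q * card I) 1 P (s $ 1) = pt_glue m I a P ^ q * pt_eval a (q * card I) 2 P (s $ 2)}"

lemma forall_two: "(\<forall>j::2. P j) \<longleftrightarrow> P 1 \<and> P 2"
  using exhaust_2 by metis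

lemma distinct_nodesD:
  assumes "distinct_nodes I a"
  shows "finite I" "l \<in> I \<Longrightarrow> a (l, j) \<noteq> 0" "l \<in> I \<Longrightarrow> r \<in> I \<Longrightarrow> l \<noteq> r \<Longrightarrow> a (l, j) \<noteq> a (r, j)"
    "inj_on (\<lambda>l. a (l, j)) I"
  using assms unfolding distinct_nodes_def inj_on_def by blast+

lemma distinct_nodes_subset: "distinct_nodes I a \<Longrightarrow> J \<subseteq> I \<Longrightarrow> distinct_nodes J a"
  unfolding distinct_nodes_def using finite_subset by blast

lemma degree_lin_prod [simp]: "degree (lin_prod I a j) = card I"
  unfolding lin_prod_def by (subst degree_prod_sum_eq) auto

lemma lead_coeff_lin_prod [simp]: "coeff (lin_prod I a j) (card I) = 1"
  using lead_coeff_prod[of "\<lambda>r. [:- a (r, j), 1:]" I] by (simp add: lin_prod_def[symmetric])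

lemma lin_prod_nonzero [simp]: "lin_prod I a j \<noteq> 0"
  using lead_coeff_lin_prod[of I a j] by (metis coeff_0 zero_neq_one)

lemma poly_lin_prod: "poly (lin_prod I a j) x = (\<Prod>r\<in>I. x - a (r, j))"
  by (simp add: lin_prod_def poly_prod)

lemma lin_prod_remove: "finite I \<Longrightarrow> l \<in> I \<Longrightarrow> lin_prod I a j = [:- a (l, j), 1:] * lin_prod (I - {l}) a j"
  unfolding lin_prod_def by (rule prod.remove)

lemma pt_eval_add: "pt_eval a d j P (f + g) = pt_eval a d j P f + pt_eval a d j P g"
  by (cases P) (auto simp: pt_eval_def)

lemma pt_eval_diff: "pt_eval a d j P (f - g) = pt_eval a d j P f - pt_eval a d j P g"
  by (cases P) (auto simp: pt_eval_def)

lemma pt_eval_smult: "pt_eval a d j P (smult c f) = c * pt_eval a d j P f"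
  by (cases P) (auto simp: pt_eval_def)

lemma pt_eval_0 [simp]: "pt_eval a d j P 0 = 0"
  by (cases P) (auto simp: pt_eval_def)

lemma pt_eval_sum: "pt_eval a d j P (\<Sum>i\<in>A. f i) = (\<Sum>i\<in>A. pt_eval a d j P (f i))"
  by (induction A rule: infinite_finite_induct) (auto simp: pt_eval_add)

lemma coeff_mult_top:
  assumes "degree f \<le> d" "degree g \<le> e"
  shows "coeff (f * g) (d + e) = coeff f d * coeff g e"
proof -
  have "coeff f i * coeff g (d + e - i) = (if i = d then coeff f d * coeff g e else 0)" if "i \<le> d + e" for i
  proof -
    consider "i < d" | "i = d" | "i > d" by linarith
    then show ?thesis
    proof cases
      case 1
      then have "degree g < d + e - i" using assms by linarith
      then show ?thesis using 1 by (simp add: coeff_eq_0)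
    next
      case 3
      then show ?thesis using assms by (simp add: coeff_eq_0)
    qed simp
  qed
  then have "coeff (f * g) (d + e) = (\<Sum>i\<le>d + e. if i = d then coeff f d * coeff g e else 0)"
    unfolding coeff_mult by (intro sum.cong) auto
  then show ?thesis by simp
qed

lemma pt_eval_mult:
  "degree f \<le> d \<Longrightarrow> degree g \<le> e \<Longrightarrow> pt_eval a (d + e) j P (f * g) = pt_eval a d j P f * pt_eval a e j P g"
  by (cases P) (auto simp: pt_eval_def coeff_mult_top)

lemma pt_denom_nonzero: "distinct_nodes I a \<Longrightarrow> P \<in> pts I \<Longrightarrow> pt_denom I a j P \<noteq> 0"
  by (auto simp: pts_def pt_denom_def distinct_nodesD dest: distinct_nodesD(2,3))

lemma pt_glue_nonzero: "distinct_nodes I a \<Longrightarrow> P \<in> pts I \<Longrightarrow> pt_glue m I a P \<noteq> 0"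
  by (auto simp: pt_glue_def pt_denom_nonzero pt_sign_def split: pt.splits)

lemma sconst_nth [simp]: "sconst c $ j = [:c:]"
  by (simp add: sconst_def)

lemma secs_le_subspace: "sec_subspace (secs_le d)"
  by (auto simp: sec_subspace_def add_closed_def secs_le_def intro: degree_diff_le degree_smult_le[THEN order_trans])

lemma sec_ring_subspace: "sec_subspace (sec_ring m I a q)"
  unfolding sec_ring_def sec_subspace_def add_closed_def
  using secs_le_subspace[of "q * card I", unfolded sec_subspace_def add_closed_def]
  by (auto simp: pt_eval_diff pt_eval_smult algebra_simps)

lemma secs_le_mult: "s \<in> secs_le d \<Longrightarrow> t \<in> secs_le e \<Longrightarrow> s * t \<in> secs_le (d + e)"
  unfolding secs_le_def by (auto intro!: degree_mult_le[THEN order_trans] add_mono)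

lemma sec_ring_mult:
  assumes "s \<in> sec_ring m I a q" "t \<in> sec_ring m I a r"
  shows "s * t \<in> sec_ring m I a (q + r)"
proof -
  have d: "\<And>j. degree (s $ j) \<le> q * card I" "\<And>j. degree (t $ j) \<le> r * card I"
    using assms by (auto simp: sec_ring_def secs_le_def)
  have "pt_eval a ((q + r) * card I) j P ((s * t) $ j) = pt_eval a (q * card I) j P (s $ j) * pt_eval a (r * card I) j P (t $ j)" for j P
    using pt_eval_mult[OF d(1,2)] by (simp add: add_mult_distrib)
  moreover have "s * t \<in> secs_le ((q + r) * card I)"
    using secs_le_mult assms by (auto simp: sec_ring_def add_mult_distrib)
  ultimately show ?thesis using assms by (auto simp: sec_ring_def power_add)
qed

lemma basis_sec_deg: "finite I \<Longrightarrow> l \<in> I \<Longrightarrow> basis_sec m I a l \<in> secs_le (card I)"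
  unfolding secs_le_def basis_sec_def
  by (auto simp: card.remove[of I l] simp del: card_Diff_insert intro!: degree_smult_le[THEN order_trans] degree_pCons_le[THEN order_trans])

lemma pt_eval_basis:
  assumes "distinct_nodes I a" "l \<in> I"
  shows "r \<in> I \<Longrightarrow> pt_eval a (card I) j (Fin r) (basis_sec m I a l $ j) =
      (if r = l then (if l \<le> m \<and> j \<noteq> 1 then 1 else -1) * pt_denom I a j (Fin l) else 0)" (is "_ \<Longrightarrow> ?A")
    and "pt_eval a (card I) j Zero (basis_sec m I a l $ j) = (if l \<le> m then 0 else - pt_denom I a j Zero)" (is ?B)
    and "pt_eval a (card I) j Inf (basis_sec m I a l $ j) = (if l \<le> m then (if j = 1 then 1 else -1) else 0)" (is ?C)
proof -
  note fin = distinct_nodesD(1)[OF assms(1)]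
  have r0: "(\<Prod>x\<in>I - {l}. a (r, j) - a (x, j)) = 0" if "r \<in> I - {l}"
    using that fin by (intro prod_zero) auto
  show ?A if "r \<in> I"
    using r0 that by (auto simp: pt_eval_def basis_sec_def poly_lin_prod pt_denom_def)
  show ?B
    using prod.remove[OF fin assms(2), of "\<lambda>r. - a (r, j)"]
    by (simp add: pt_eval_def basis_sec_def poly_lin_prod pt_denom_def)
  have n: "card I = Suc (card (I - {l}))" using fin assms(2) by (metis card.remove)
  have "coeff (lin_prod (I - {l}) a j) (card I) = 0"
    by (rule coeff_eq_0) (simp add: n)
  moreover have "coeff ([:0, 1:] * lin_prod (I - {l}) a j) (card I) = 1"
    by (simp add: n)
  ultimately show ?C by (simp add: pt_eval_def basis_sec_def del: mult_pCons_left)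
qed

lemma basis_sec_in:
  assumes "distinct_nodes I a" "l \<in> I"
  shows "basis_sec m I a l \<in> sec_ring m I a 1"
proof -
  have "pt_eval a (card I) 1 P (basis_sec m I a l $ 1) = pt_glue m I a P * pt_eval a (card I) 2 P (basis_sec m I a l $ 2)"
    if "P \<in> pts I" for P
    using pt_denom_nonzero[OF assms(1) that, of 2] that assms(2)
    by (cases P) (auto simp: pt_eval_basis(2,3)[OF assms] pt_eval_basis(1)[OF assms] pt_glue_def pt_sign_def pts_def pt_denom_def)
  then show ?thesis
    using basis_sec_deg[OF distinct_nodesD(1)[OF assms(1)] assms(2)] by (simp add: sec_ring_def)
qed

definition basis_coord :: "nat \<Rightarrow> nat set \<Rightarrow> (nat \<times> 2 \<Rightarrow> complex) \<Rightarrow> nat \<Rightarrow> sec \<Rightarrow> complex" where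
  "basis_coord m I a l s = (if l \<in> I then poly (s $ 1) (a (l, 1)) / (- pt_denom I a 1 (Fin l)) else 0)"

lemma poly_vanishing:
  fixes b :: "'i \<Rightarrow> complex"
  assumes "finite I" "inj_on b I" "degree f \<le> card I" "\<And>l. l \<in> I \<Longrightarrow> poly f (b l) = 0"
  shows "f = smult (coeff f (card I)) (\<Prod>l\<in>I. [:- b l, 1:])"
proof (rule poly_eqI_degree_lead_coeff[where A = "b ` I" and n = "card I"])
  have deg: "degree (\<Prod>l\<in>I. [:- b l, 1:]) = card I" by (subst degree_prod_sum_eq) auto
  have lc: "coeff (\<Prod>l\<in>I. [:- b l, 1:]) (card I) = 1"
    using lead_coeff_prod[of "\<lambda>l. [:- b l, 1:]" I] by (simp add: deg)
  show "degree (smult (coeff f (card I)) (\<Prod>l\<in>I. [:- b l, 1:])) \<le> card I"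
    using deg by (simp add: degree_smult_le[THEN order_trans])
  show "coeff f (card I) = coeff (smult (coeff f (card I)) (\<Prod>l\<in>I. [:- b l, 1:])) (card I)"
    by (simp add: lc)
  show "card (b ` I) \<ge> card I" using assms by (simp add: card_image)
  show "poly f z = poly (smult (coeff f (card I)) (\<Prod>l\<in>I. [:- b l, 1:])) z" if "z \<in> b ` I" for z
    using that assms by (auto simp: poly_prod)
qed (use assms in simp)

text \<open>
  On each component such a section is a multiple of the product of the \<open>t - a\<^sub>l\<^sub>,\<^sub>j u\<close>. The factors agree by the
  gluing at \<open>0\<close> and are opposite by the gluing at infinity. It is here that the torsion bundle, whose signs
  at these two nodes differ, enters.
\<close>

lemma vanishing_section:
  assumes "distinct_nodes I a" "s \<in> sec_ring m I a 1" "\<And>l. l \<in> I \<Longrightarrow> poly (s $ 1) (a (l, 1)) = 0"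
  shows "s = 0"
proof -
  note fin = distinct_nodesD(1)[OF assms(1)]
  have deg: "degree (s $ j) \<le> card I" for j using assms(2) by (simp add: sec_ring_def secs_le_def)
  have node: "pt_eval a (card I) 1 P (s $ 1) = pt_glue m I a P * pt_eval a (card I) 2 P (s $ 2)" if "P \<in> pts I" for P
    using assms(2) that by (simp add: sec_ring_def)
  have "poly (s $ 2) (a (l, 2)) = 0" if "l \<in> I" for l
    using node[of "Fin l"] pt_glue_nonzero[OF assms(1), of "Fin l" m] that assms(3) by (auto simp: pts_def pt_eval_def)
  then have "\<forall>j. \<forall>l\<in>I. poly (s $ j) (a (l, j)) = 0" using assms(3) by (simp add: forall_two)
  then have s: "s $ j = smult (coeff (s $ j) (card I)) (lin_prod I a j)" for j
    unfolding lin_prod_def by (intro poly_vanishing fin distinct_nodesD(4)[OF assms(1)] deg) auto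
  have "coeff (s $ 1) (card I) = - coeff (s $ 2) (card I)"
    using node[of Inf] by (simp add: pts_def pt_eval_def pt_glue_def pt_denom_def pt_sign_def)
  moreover have "coeff (s $ 1) (card I) = coeff (s $ 2) (card I)"
  proof -
    have "poly (s $ j) 0 = coeff (s $ j) (card I) * pt_denom I a j Zero" for j
      by (subst s) (simp add: poly_lin_prod pt_denom_def)
    then show ?thesis
      using node[of Zero] pt_denom_nonzero[OF assms(1), of Zero] by (simp add: pts_def pt_eval_def pt_glue_def pt_sign_def)
  qed
  ultimately have "coeff (s $ j) (card I) = 0" for j using exhaust_2[of j] by auto
  then have "s $ j = 0" for j by (subst s) simp
  then show ?thesis by (simp add: vec_eq_iff)
qed

text \<open>
  At the parameter nodes the basis sections behave like a Lagrange basis.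
\<close>

lemma koszul_basis_sec_ring:
  assumes "distinct_nodes I a"
  shows "koszul_basis I (basis_sec m I a) (basis_coord m I a) (sec_ring m I a 1)"
proof
  show "finite I" by (rule distinct_nodesD[OF assms])
  show "sec_subspace (sec_ring m I a 1)" by (rule sec_ring_subspace)
  show "basis_sec m I a i \<in> sec_ring m I a 1" if "i \<in> I" for i using assms that by (rule basis_sec_in)
  show "basis_coord m I a i (s + t) = basis_coord m I a i s + basis_coord m I a i t" for i s t
    by (simp add: basis_coord_def add_divide_distrib)
  show lin: "basis_coord m I a i (sconst c * s) = c * basis_coord m I a i s" for i c s
    by (simp add: basis_coord_def)
  show "basis_coord m I a i s = 0" if "i \<notin> I" for i s using that by (simp add: basis_coord_def)
  show dual: "basis_coord m I a i (basis_sec m I a j) = (if i = j then 1 else 0)" if "j \<in> I" for i j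
    using pt_eval_basis(1)[OF assms that, of i 1 m] pt_denom_nonzero[OF assms, of "Fin i" 1] that
    by (auto simp: basis_coord_def pt_eval_def pts_def split: if_splits)
  show "s = (\<Sum>i\<in>I. sconst (basis_coord m I a i s) * basis_sec m I a i)" if s: "s \<in> sec_ring m I a 1" for s
  proof -
    let ?t = "s - (\<Sum>i\<in>I. sconst (basis_coord m I a i s) * basis_sec m I a i)"
    have "?t \<in> sec_ring m I a 1"
      by (intro sec_subspaceD(5)[OF sec_ring_subspace] s add_closed_sum sec_subspaceD(1,2)[OF sec_ring_subspace] basis_sec_in assms)
    moreover have "poly (?t $ 1) (a (l, 1)) = 0" if "l \<in> I" for l
    proof -
      have "poly (basis_sec m I a i $ 1) (a (l, 1)) = (if i = l then - pt_denom I a 1 (Fin l) else 0)" if "i \<in> I" for i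
        using pt_eval_basis(1)[OF assms that, of l 1 m] \<open>l \<in> I\<close> by (auto simp: pt_eval_def)
      then have "poly ((\<Sum>i\<in>I. sconst (basis_coord m I a i s) * basis_sec m I a i) $ 1) (a (l, 1))
          = (\<Sum>i\<in>I. if i = l then basis_coord m I a l s * - pt_denom I a 1 (Fin l) else 0)"
        by (simp add: poly_sum) (intro sum.cong, auto)
      also have "\<dots> = poly (s $ 1) (a (l, 1))"
        using that distinct_nodesD(1)[OF assms] pt_denom_nonzero[OF assms, of "Fin l" 1] by (simp add: basis_coord_def pts_def)
      finally show ?thesis by simp
    qed
    ultimately have "?t = 0" by (rule vanishing_section[OF assms])
    then show ?thesis by simp
  qed
qed

text \<open>
  The obstruction at the node \<open>P\<close> for a pair of forms to be a section.
\<close>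

definition node_diff :: "nat \<Rightarrow> nat set \<Rightarrow> (nat \<times> 2 \<Rightarrow> complex) \<Rightarrow> pt \<Rightarrow> sec \<Rightarrow> complex" where
  "node_diff m I a P s = pt_eval a (card I) 1 P (s $ 1) - pt_glue m I a P * pt_eval a (card I) 2 P (s $ 2)"

lemma node_diff_add: "node_diff m I a P (s + t) = node_diff m I a P s + node_diff m I a P t"
  by (simp add: node_diff_def pt_eval_add algebra_simps)

lemma node_diff_diff: "node_diff m I a P (s - t) = node_diff m I a P s - node_diff m I a P t"
  by (simp add: node_diff_def pt_eval_diff algebra_simps)

lemma node_diff_scale: "node_diff m I a P (sconst c * s) = c * node_diff m I a P s"
  by (simp add: node_diff_def pt_eval_smult algebra_simps)

lemma node_diff_0 [simp]: "node_diff m I a P 0 = 0"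
  by (simp add: node_diff_def)

lemma node_diff_sum: "node_diff m I a P (\<Sum>i\<in>A. s i) = (\<Sum>i\<in>A. node_diff m I a P (s i))"
  by (induction A rule: infinite_finite_induct) (auto simp: node_diff_add)

lemma sec_ring_1_iff: "s \<in> sec_ring m I a 1 \<longleftrightarrow> s \<in> secs_le (card I) \<and> (\<forall>P\<in>pts I. node_diff m I a P s = 0)"
  by (simp add: sec_ring_def node_diff_def)

text \<open>
  Every system of node differences comes from a pair of forms: the first cohomology of the line bundle
  vanishes.
\<close>

lemma node_lift:
  assumes "distinct_nodes I a" "P \<in> pts I"
  shows "\<exists>s\<in>secs_le (card I). \<forall>Q\<in>pts I. node_diff m I a Q s = (if Q = P then 1 else 0)"
proof -
  note fin = distinct_nodesD(1)[OF assms(1)]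
  note sub = secs_le_subspace[of "card I", THEN sec_subspaceD(2)] secs_le_subspace[of "card I", THEN sec_subspaceD(4)]
    secs_le_subspace[of "card I", THEN sec_subspaceD(5)]
  \<comment> \<open>These two pairs only have differences at \<open>0\<close> and infinity; they are opposite at \<open>0\<close> and equal at infinity.\<close>
  define b :: "2 \<Rightarrow> sec" where "b k = (\<chi> j. if j = k then lin_prod I a j else 0)" for k
  have bF: "b k \<in> secs_le (card I)" for k by (simp add: b_def secs_le_def)
  have poly0: "poly (lin_prod I a j) (a (l, j)) = 0" if "l \<in> I" for l j
    using that fin by (auto simp: poly_lin_prod)
  have bv: "node_diff m I a (Fin l) (b k) = 0" if "l \<in> I" for l k
    using that poly0 by (auto simp: node_diff_def b_def pt_eval_def)
  have b0: "node_diff m I a Zero (b 1) = pt_denom I a 1 Zero" "node_diff m I a Zero (b 2) = - pt_denom I a 1 Zero"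
    and bi: "node_diff m I a Inf (b 1) = 1" "node_diff m I a Inf (b 2) = 1"
    using pt_denom_nonzero[OF assms(1), of Zero 2]
    by (auto simp: node_diff_def b_def pt_eval_def pt_glue_def pt_sign_def poly_lin_prod pt_denom_def pts_def)
  define z where "z = pt_denom I a 1 Zero"
  have z: "z \<noteq> 0" using pt_denom_nonzero[OF assms(1), of Zero 1] by (simp add: z_def pts_def)
  define si where "si = sconst (1 / 2) * (b 1 + b 2)"
  define sz where "sz = sconst (1 / (2 * z)) * (b 1 - b 2)"
  have si: "node_diff m I a Q si = (if Q = Inf then 1 else 0)"
    and sz: "node_diff m I a Q sz = (if Q = Zero then 1 else 0)" if "Q \<in> pts I" for Q
    using that z by (auto simp: si_def sz_def node_diff_scale node_diff_add node_diff_diff bv b0 bi pts_def z_def)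
  have F: "si \<in> secs_le (card I)" "sz \<in> secs_le (card I)"
    unfolding si_def sz_def by (intro sub bF)+
  show ?thesis
  proof (cases P)
    case (Fin l)
    then have l: "l \<in> I" using assms(2) by (auto simp: pts_def)
    define c where "c = (\<Prod>r\<in>I - {l}. a (l, 1) - a (r, 1))"
    have c: "c \<noteq> 0" unfolding c_def using distinct_nodesD(3)[OF assms(1) l] fin by auto
    define t :: sec where "t = (\<chi> j. if j = 1 then smult (1 / c) (lin_prod (I - {l}) a j) else 0)"
    have tF: "t \<in> secs_le (card I)"
      using card_mono[of I "I - {l}"] fin by (auto simp: t_def secs_le_def)
    have "coeff (lin_prod (I - {l}) a 1) (card I) = 0"
      using card.remove[OF fin l] by (intro coeff_eq_0) simp
    moreover have "poly (lin_prod (I - {l}) a 1) (a (r, 1)) = (if r = l then c else 0)" if "r \<in> I" for r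
      using that fin by (auto simp: poly_lin_prod c_def)
    ultimately have "node_diff m I a Q t = (if Q = P then 1 else if Q = Zero then node_diff m I a Zero t else 0)" if "Q \<in> pts I" for Q
      using that Fin c by (auto simp: node_diff_def t_def pt_eval_def pts_def split: if_splits)
    then have "node_diff m I a Q (t - sconst (node_diff m I a Zero t) * sz) = (if Q = P then 1 else 0)" if "Q \<in> pts I" for Q
      using that Fin sz[OF that] by (auto simp: node_diff_diff node_diff_scale)
    then show ?thesis using tF F by (intro bexI[of _ "t - sconst (node_diff m I a Zero t) * sz"] sub) auto
  next
    case Zero
    show ?thesis using sz F Zero by (intro bexI[of _ sz]) auto
  next
    case Inf
    show ?thesis using si F Inf by (intro bexI[of _ si]) auto
  qed
qed

section \<open>The Koszul complex of one component\<close>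

lemma koszul_exact_cong:
  assumes "koszul_exact I e p M1 M2" "\<And>i. i \<in> I \<Longrightarrow> e i = e' i"
  shows "koszul_exact I e' p M1 M2"
proof -
  have "contract I e = contract I e'"
    using assms(2) by (intro ext) (simp add: contract_def)
  then show ?thesis using assms(1) by (simp add: koszul_exact_def)
qed

definition comaximal :: "complex poly \<Rightarrow> complex poly \<Rightarrow> bool" where
  "comaximal f g \<longleftrightarrow> (\<exists>x y. x * f + y * g = 1)"

lemma comaximal_sym: "comaximal f g \<Longrightarrow> comaximal g f"
  unfolding comaximal_def by (metis add.commute)

lemma comaximal_mult:
  assumes "comaximal f h" "comaximal g h"
  shows "comaximal (f * g) h"
proof -
  obtain x y x' y' where *: "x * f + y * h = 1" "x' * g + y' * h = 1"
    using assms unfolding comaximal_def by blast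
  have "(x * f + y * h) * (x' * g + y' * h) = 1" by (simp add: *)
  then have "(x * x') * (f * g) + (x * f * y' + y * x' * g + y * h * y') * h = 1"
    by (simp add: algebra_simps)
  then show ?thesis unfolding comaximal_def by blast
qed

lemma comaximal_1 [simp]: "comaximal 1 h"
  unfolding comaximal_def by (metis add.right_neutral mult_1 mult_zero_left)

lemma comaximal_power: "comaximal f h \<Longrightarrow> comaximal (f ^ n) h"
  by (induction n) (auto intro: comaximal_mult)

lemma comaximal_prod: "(\<And>i. i \<in> A \<Longrightarrow> comaximal (f i) h) \<Longrightarrow> comaximal (prod f A) h"
  by (induction A rule: infinite_finite_induct) (auto intro: comaximal_mult)

lemma comaximal_linear:
  assumes "b \<noteq> c"
  shows "comaximal [:- b, 1:] [:- c, 1:]"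
proof -
  define k where "k = 1 / (c - b)"
  have "k * c - k * b = 1" using assms by (simp add: k_def diff_divide_distrib[symmetric])
  then have "[:k:] * [:- b, 1:] + [:- k:] * [:- c, 1:] = 1"
    by (simp add: one_pCons mult.commute)
  then show ?thesis unfolding comaximal_def by blast
qed

lemma lagrange_span:
  fixes b :: "'i \<Rightarrow> complex"
  assumes "finite A" "inj_on b A" "degree f < card A"
  shows "\<exists>c. f = (\<Sum>l\<in>A. smult (c l) (\<Prod>r\<in>A - {l}. [:- b r, 1:]))"
proof -
  define c where "c l = poly f (b l) / (\<Prod>r\<in>A - {l}. b l - b r)" for l
  define h where "h = (\<Sum>l\<in>A. smult (c l) (\<Prod>r\<in>A - {l}. [:- b r, 1:]))"
  have "f = h"
  proof (rule poly_eqI_degree[where A = "b ` A"])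
    show "poly f x = poly h x" if x: "x \<in> b ` A" for x
    proof -
      obtain k where k: "k \<in> A" "x = b k" using x by blast
      have "poly h x = (\<Sum>l\<in>A. if l = k then c k * (\<Prod>r\<in>A - {k}. b k - b r) else 0)"
        unfolding h_def poly_sum
      proof (intro sum.cong refl)
        fix l assume "l \<in> A"
        have "(\<Prod>r\<in>A - {l}. b k - b r) = 0" if "l \<noteq> k"
          using that k assms(1) by (intro prod_zero) auto
        then show "poly (smult (c l) (\<Prod>r\<in>A - {l}. [:- b r, 1:])) x
            = (if l = k then c k * (\<Prod>r\<in>A - {k}. b k - b r) else 0)"
          by (auto simp: poly_prod k)
      qed
      also have "\<dots> = poly f x"
      proof -
        have "(\<Prod>r\<in>A - {k}. b k - b r) \<noteq> 0"
          using assms(1,2) k by (auto simp: inj_on_def)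
        then show ?thesis using k assms(1) by (simp add: c_def)
      qed
      finally show ?thesis by simp
    qed
    have "degree (smult (c l) (\<Prod>r\<in>A - {l}. [:- b r, 1:])) < card A" if "l \<in> A" for l
    proof -
      have "degree (\<Prod>r\<in>A - {l}. [:- b r, 1:]) = card (A - {l})" by (subst degree_prod_sum_eq) auto
      then show ?thesis using card.remove[OF assms(1) that] by (intro degree_smult_le[THEN le_less_trans]) simp
    qed
    then have "degree h < card A" unfolding h_def using assms(3) by (intro degree_sum_less) auto
    then show "card (b ` A) > degree h" "card (b ` A) > degree f"
      using assms by (simp_all add: card_image)
  qed
  then show ?thesis unfolding h_def by blast
qed

definition polys_le :: "nat \<Rightarrow> complex poly set" where
  "polys_le d = {f. degree f \<le> d}"

lemma polys_le_closed: "add_closed (polys_le d)"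
  by (auto simp: add_closed_def polys_le_def intro: degree_diff_le)

text \<open>
  Two forms \<open>e s\<close>, \<open>e t\<close> of degree \<open>n\<close> without common zeros generate all forms of degree \<open>2n\<close>, and their
  syzygies are the trivial ones. As \<open>e s\<close> does not vanish at infinity, degrees can be controlled by division with
  remainder.
\<close>

lemma pencil_exact:
  fixes e :: "'i \<Rightarrow> complex poly"
  assumes "s \<noteq> t" and co: "comaximal (e s) (e t)" and ds: "degree (e s) = n" "n > 0" and dt: "degree (e t) \<le> n"
  shows "koszul_exact {s, t} e p (polys_le n) (polys_le (2 * n))"
proof (rule koszul_exact_pencil[OF assms(1) polys_le_closed])
  have s0: "e s \<noteq> 0" using ds by auto
  obtain x y where xy: "x * e s + y * e t = 1" using co unfolding comaximal_def by blast
  have quot: "degree q \<le> n" if "degree (e s * q) \<le> 2 * n" for q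
  proof (cases "q = 0")
    case False
    then show ?thesis using that ds s0 by (simp add: degree_mult_eq)
  qed simp
  show "\<exists>x\<in>polys_le n. \<exists>y\<in>polys_le n. f = e s * x + e t * y" if f: "f \<in> polys_le (2 * n)" for f
  proof -
    define D where "D = (f * y) div e s"
    define y' where "y' = (f * y) mod e s"
    define x' where "x' = f * x + e t * D"
    have y': "y' = f * y - e s * D" unfolding y'_def D_def by (rule minus_mult_div_eq_mod[symmetric])
    have "e s * x' + e t * y' = f * (x * e s + y * e t)"
      unfolding x'_def y' by (simp add: algebra_simps)
    then have eq: "f = e s * x' + e t * y'" by (simp add: xy)
    have y'd: "degree y' < n" using degree_mod_less'[of "e s" "f * y"] ds s0 by (cases "y' = 0") (auto simp: y'_def)
    have "degree (f - e t * y') \<le> 2 * n"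
      using f y'd dt degree_mult_le[of "e t" y'] by (intro degree_diff_le) (auto simp: polys_le_def)
    then have "degree x' \<le> n" using eq by (intro quot) simp
    then show ?thesis using eq y'd by (intro bexI[of _ x'] bexI[of _ y']) (auto simp: polys_le_def)
  qed
  show "\<exists>q\<in>polys_le n. f = e t * q \<and> h = - (e s * q)"
    if f: "f \<in> polys_le (2 * n)" "h \<in> polys_le (2 * n)" and syz: "e s * f + e t * h = 0" for f h
  proof -
    define q where "q = y * f - x * h"
    have et: "e t * h = - (e s * f)" using syz by (simp add: eq_neg_iff_add_eq_0 add.commute)
    have "h = h * (x * e s + y * e t)" by (simp add: xy)
    also have "\<dots> = e s * (x * h) + y * (e t * h)" by (simp add: algebra_simps)
    also have "\<dots> = - (e s * q)" unfolding et q_def by (simp add: algebra_simps)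
    finally have h: "h = - (e s * q)" .
    have "e s * f = - (e t * h)" by (simp add: et)
    also have "\<dots> = e s * (e t * q)" unfolding h by (simp add: algebra_simps)
    finally have "e s * f = e s * (e t * q)" .
    then have "f = e t * q" using s0 by simp
    moreover have "degree q \<le> n" using f h by (intro quot) (simp add: polys_le_def)
    ultimately show ?thesis using h by (auto simp: polys_le_def)
  qed
  show "f = 0" if "f \<in> polys_le (2 * n)" "e s * f = 0" for f using that s0 by simp
qed

text \<open>
  Let \<open>P\<close>, \<open>Q\<close> be the products of the \<open>t - a\<^sub>l\<^sub>,\<^sub>j u\<close> over the indices \<open>l\<close> up to \<open>m\<close> and beyond \<open>m\<close>.
  On the component \<open>j\<close> the basis sections span the forms \<open>t f Q + u h P\<close> with \<open>f\<close>, \<open>h\<close> arbitrary forms of degree one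
  less than \<open>P\<close> and \<open>Q\<close>, respectively. Taking powers of \<open>t\<close> and of \<open>u\<close> for \<open>f\<close> and \<open>h\<close> yields two forms
  without common zeros. Exactness is known for them; the basis sections are added one at a time, and then
  the two forms themselves are redundant.
\<close>

lemma component_exact:
  assumes good: "distinct_nodes I a" and ne: "\<exists>l\<in>I. l \<le> m" "\<exists>l\<in>I. \<not> l \<le> m"
  shows "koszul_exact I (\<lambda>i. basis_sec m I a i $ j) p (polys_le (card I)) (polys_le (2 * card I))"
proof -
  note fin = distinct_nodesD(1)[OF good]
  define I1 I2 where "I1 = {l\<in>I. l \<le> m}" and "I2 = {l\<in>I. \<not> l \<le> m}"
  have I12: "I = I1 \<union> I2" "I1 \<inter> I2 = {}" "finite I1" "finite I2" "I1 \<noteq> {}" "I2 \<noteq> {}"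
    using fin ne by (auto simp: I1_def I2_def)
  have mem: "l \<in> I1 \<Longrightarrow> l \<in> I" "l \<in> I2 \<Longrightarrow> l \<in> I" "l \<in> I1 \<Longrightarrow> l \<le> m" "l \<in> I2 \<Longrightarrow> \<not> l \<le> m" for l
    by (auto simp: I1_def I2_def)
  have card: "card I = card I1 + card I2" "card I1 > 0" "card I2 > 0"
    using I12 by (auto simp: card_Un_disjoint card_gt_0_iff)
  have inj: "inj_on (\<lambda>l. a (l, j)) I1" "inj_on (\<lambda>l. a (l, j)) I2"
    using distinct_nodesD(4)[OF good, of j] I12(1) by (auto intro: inj_on_subset)
  define S where "S = [:0, 1:] ^ card I1 * lin_prod I2 a j"
  define T where "T = lin_prod I1 a j"
  obtain s where s: "s \<notin> I" using ex_new_if_finite[OF infinite_UNIV_nat fin] by blast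
  obtain t where t: "t \<notin> insert s I" using ex_new_if_finite[OF infinite_UNIV_nat, of "insert s I"] fin by blast
  define e where "e = (\<lambda>i. basis_sec m I a i $ j)(s := S, t := T)"
  have eI: "e i = basis_sec m I a i $ j" if "i \<in> I" for i using that s t by (auto simp: e_def)
  have est: "e s = S" "e t = T" using t by (auto simp: e_def)
  note mono = polys_le_closed
  have degS: "degree S = card I"
    unfolding S_def by (subst degree_mult_eq) (auto simp: degree_power_eq card)
  have "comaximal S T"
  proof -
    have a0: "comaximal [:0, 1:] [:- a (l, j), 1:]" if "l \<in> I1" for l
      using comaximal_linear[of 0 "a (l, j)"] distinct_nodesD(2)[OF good, of l j] that I12 by auto
    have ab: "comaximal [:- a (k, j), 1:] [:- a (l, j), 1:]" if "k \<in> I2" "l \<in> I1" for k l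
      using distinct_nodesD(3)[OF good, of k l j] that I12 by (intro comaximal_linear) auto
    show ?thesis
      unfolding S_def T_def lin_prod_def
      by (intro comaximal_mult comaximal_power comaximal_sym[OF comaximal_prod] comaximal_prod)
         (use a0 ab comaximal_sym in blast)+
  qed
  then have st: "koszul_exact {s, t} e q (polys_le (card I)) (polys_le (2 * card I))" for q
    using t degS card by (intro pencil_exact) (auto simp: est T_def)
  have mult: "e i * x \<in> polys_le (2 * card I)" if "i \<in> insert s (insert t I)" "x \<in> polys_le (card I)" for i x
  proof -
    have "degree (e i) \<le> card I"
      using that(1) degS card basis_sec_deg[OF fin, of _ m a] by (auto simp: est eI T_def secs_le_def)
    then show ?thesis using that(2) degree_mult_le[of "e i" x] by (auto simp: polys_le_def)
  qed
  have "koszul_exact (A \<union> {s, t}) e q (polys_le (card I)) (polys_le (2 * card I))" if "finite A" "A \<subseteq> I" for A q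
    using that
  proof (induction A arbitrary: q rule: finite_induct)
    case empty
    then show ?case using st by simp
  next
    case (insert v A)
    have "koszul_exact (insert v (A \<union> {s, t})) e q (polys_le (card I)) (polys_le (2 * card I))"
      using insert s t by (intro koszul_exact_insert mono mult) auto
    then show ?case by (simp only: Un_insert_left)
  qed
  from this[OF fin order_refl, of p]
  have all: "koszul_exact (insert s (insert t I)) e p (polys_le (card I)) (polys_le (2 * card I))"
    by (simp only: Un_insert_right Un_empty_right)
  have split1: "lin_prod (I - {l}) a j = lin_prod (I1 - {l}) a j * lin_prod I2 a j" if "l \<in> I1" for l
  proof -
    have "I - {l} = (I1 - {l}) \<union> I2" using that I12 by auto
    then show ?thesis unfolding lin_prod_def using I12 by (simp only:) (intro prod.union_disjoint, auto)
  qed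
  have split2: "lin_prod (I - {l}) a j = lin_prod I1 a j * lin_prod (I2 - {l}) a j" if "l \<in> I2" for l
  proof -
    have "I - {l} = I1 \<union> (I2 - {l})" using that I12 by auto
    then show ?thesis unfolding lin_prod_def using I12 by (simp only:) (intro prod.union_disjoint, auto)
  qed
  have smult_closed: "[:c:] * x \<in> polys_le (card I)" if "x \<in> polys_le (card I)" for c x
    using that by (auto simp: polys_le_def intro: degree_smult_le[THEN order_trans])
  have "\<exists>c. S = (\<Sum>i\<in>I. [:c i:] * e i)"
  proof -
    obtain c where c: "[:0, 1:] ^ (card I1 - 1) = (\<Sum>l\<in>I1. smult (c l) (lin_prod (I1 - {l}) a j))"
      using lagrange_span[OF I12(3) inj(1), of "[:0, 1:] ^ (card I1 - 1)"] card
      unfolding lin_prod_def by (auto simp: degree_power_eq)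
    have "S = [:0, 1:] * ([:0, 1:] ^ (card I1 - 1) * lin_prod I2 a j)"
      using card(2) unfolding S_def by (metis mult.assoc power_eq_if not_less_zero)
    also have "\<dots> = (\<Sum>l\<in>I1. smult (c l) ([:0, 1:] * lin_prod (I - {l}) a j))"
      unfolding c by (simp add: sum_distrib_left sum_distrib_right split1 del: mult_pCons_left)
    also have "\<dots> = (\<Sum>l\<in>I1. [:if j = 1 then c l else - c l:] * e l)"
      by (intro sum.cong refl) (auto simp: eI mem basis_sec_def)
    also have "\<dots> = (\<Sum>l\<in>I. [:if l \<in> I1 then (if j = 1 then c l else - c l) else 0:] * e l)"
      by (rule sum.mono_neutral_cong_left) (use mem fin in auto)
    finally show ?thesis
      by (intro exI[of _ "\<lambda>l. if l \<in> I1 then (if j = 1 then c l else - c l) else 0"])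
  qed
  then obtain c where c: "S = (\<Sum>i\<in>I. [:c i:] * e i)" by blast
  have "\<exists>c. T = (\<Sum>i\<in>I. [:c i:] * e i)"
  proof -
    obtain c where c: "1 = (\<Sum>l\<in>I2. smult (c l) (lin_prod (I2 - {l}) a j))"
      using lagrange_span[OF I12(4) inj(2), of 1] card by (auto simp: lin_prod_def)
    have "T = T * 1" by simp
    also have "\<dots> = (\<Sum>l\<in>I2. smult (c l) (lin_prod (I - {l}) a j))"
      unfolding c T_def by (simp add: sum_distrib_left split2)
    also have "\<dots> = (\<Sum>l\<in>I2. [:c l / a (l, j):] * e l)"
      by (intro sum.cong refl) (auto simp: eI mem distinct_nodesD(2)[OF good] basis_sec_def)
    also have "\<dots> = (\<Sum>l\<in>I. [:if l \<in> I2 then c l / a (l, j) else 0:] * e l)"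
      by (rule sum.mono_neutral_cong_left) (use mem fin in auto)
    finally show ?thesis by (intro exI[of _ "\<lambda>l. if l \<in> I2 then c l / a (l, j) else 0"])
  qed
  then obtain d where d: "T = (\<Sum>i\<in>I. [:d i:] * e i)" by blast
  have "koszul_exact (insert t I) e p (polys_le (card I)) (polys_le (2 * card I))"
  proof (rule koszul_exact_drop[where s = s and c = "\<lambda>i. if i = t then 0 else [:c i:]"])
    have "(\<Sum>i\<in>I. (if i = t then 0 else [:c i:]) * e i) = S"
      unfolding c by (intro sum.cong) (use t in auto)
    then show "e s = (\<Sum>i\<in>insert t I. (if i = t then 0 else [:c i:]) * e i)"
      using t fin by (simp add: est)
  qed (use fin s t all mono smult_closed in \<open>auto simp: polys_le_def\<close>)
  then have "koszul_exact I e p (polys_le (card I)) (polys_le (2 * card I))"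
    by (rule koszul_exact_drop[where s = t and c = "\<lambda>i. [:d i:]", rotated -1])
       (use fin s t mono smult_closed d in \<open>auto simp: est\<close>)
  then show ?thesis
    by (rule koszul_exact_cong) (simp add: eI)
qed

section \<open>Projection from the nodes\<close>

text \<open>
  The node \<open>P\<close> as a point of projective space.
\<close>

definition node_vec :: "nat \<Rightarrow> nat set \<Rightarrow> (nat \<times> 2 \<Rightarrow> complex) \<Rightarrow> pt \<Rightarrow> nat \<Rightarrow> complex" where
  "node_vec m I a P i = pt_eval a (card I) 1 P (basis_sec m I a i $ 1)"

text \<open>
  Taking node differences is compatible with the differential: at \<open>P\<close> the basis sections of the two
  components differ by the gluing factor.
\<close>

lemma node_contract:
  assumes good: "distinct_nodes I a" and P: "P \<in> pts I" and y: "\<And>xs. y xs \<in> secs_le (card I)"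
  shows "pt_eval a (2 * card I) 1 P (contract I (basis_sec m I a) y xs $ 1)
      - pt_glue m I a P ^ 2 * pt_eval a (2 * card I) 2 P (contract I (basis_sec m I a) y xs $ 2)
    = contract I (node_vec m I a P) (\<lambda>ys. node_diff m I a P (y ys)) xs"
proof -
  have eval: "pt_eval a (2 * card I) j P (contract I (basis_sec m I a) y xs $ j)
      = (\<Sum>i\<in>I. pt_eval a (card I) j P (basis_sec m I a i $ j) * pt_eval a (card I) j P (y (i # xs) $ j))" for j
  proof -
    have "pt_eval a (2 * card I) j P (basis_sec m I a i $ j * y (i # xs) $ j)
        = pt_eval a (card I) j P (basis_sec m I a i $ j) * pt_eval a (card I) j P (y (i # xs) $ j)" if "i \<in> I" for i
      unfolding mult_2 using basis_sec_deg[OF distinct_nodesD(1)[OF good] that] y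
      by (intro pt_eval_mult) (auto simp: secs_le_def)
    then show ?thesis by (simp add: contract_def pt_eval_sum)
  qed
  have vec: "node_vec m I a P i = pt_glue m I a P * pt_eval a (card I) 2 P (basis_sec m I a i $ 2)" if "i \<in> I" for i
    using basis_sec_in[OF good that] P by (simp add: node_vec_def sec_ring_def)
  have "contract I (node_vec m I a P) (\<lambda>ys. node_diff m I a P (y ys)) xs
      = (\<Sum>i\<in>I. node_vec m I a P i * pt_eval a (card I) 1 P (y (i # xs) $ 1))
        - (\<Sum>i\<in>I. node_vec m I a P i * (pt_glue m I a P * pt_eval a (card I) 2 P (y (i # xs) $ 2)))"
    by (simp add: contract_def node_diff_def right_diff_distrib sum_subtractf)
  also have "(\<Sum>i\<in>I. node_vec m I a P i * (pt_glue m I a P * pt_eval a (card I) 2 P (y (i # xs) $ 2)))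
      = pt_glue m I a P ^ 2 * (\<Sum>i\<in>I. pt_eval a (card I) 2 P (basis_sec m I a i $ 2) * pt_eval a (card I) 2 P (y (i # xs) $ 2))"
    unfolding sum_distrib_left by (intro sum.cong refl) (simp add: vec power2_eq_square)
  finally show ?thesis unfolding eval node_vec_def[symmetric] by simp
qed

lemma contract_basis_deg:
  assumes "finite I" "y \<in> cochains I (Suc p) (secs_le d)"
  shows "contract I (basis_sec m I a) y \<in> cochains I p (secs_le (card I + d))"
  by (rule contract_cochains[OF assms(2)])
     (use secs_le_subspace basis_sec_deg[OF assms(1)] in \<open>auto intro: sec_subspaceD(1) secs_le_mult\<close>)

text \<open>
  The node differences prescribed for \<open>y\<close> are themselves boundaries, so for any lift of them the differential
  has matching values at the nodes. It is a cycle of the curve, hence a boundary by hypothesis, and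
  the lift can be corrected by sections.
\<close>

lemma lift_cocycle:
  assumes good: "distinct_nodes I a"
    and ex: "koszul_exact I (basis_sec m I a) p (sec_ring m I a 1) (sec_ring m I a 2)"
    and w: "\<And>P. P \<in> pts I \<Longrightarrow> w P \<in> cochains I (Suc (Suc p)) UNIV"
  shows "\<exists>y\<in>cochains I (Suc p) (secs_le (card I)). (\<forall>xs. contract I (basis_sec m I a) y xs = 0) \<and>
    (\<forall>P\<in>pts I. \<forall>xs. node_diff m I a P (y xs) = contract I (node_vec m I a P) (w P) xs)"
proof -
  let ?E = "basis_sec m I a"
  note fin = distinct_nodesD(1)[OF good]
  have finP: "finite (pts I)" using fin by (simp add: pts_def)
  note F = sec_subspaceD[OF secs_le_subspace[of "card I"]]
  obtain \<sigma> where \<sigma>: "\<And>P. P \<in> pts I \<Longrightarrow> \<sigma> P \<in> secs_le (card I)"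
    and \<sigma>': "\<And>P Q. P \<in> pts I \<Longrightarrow> Q \<in> pts I \<Longrightarrow> node_diff m I a Q (\<sigma> P) = (if Q = P then 1 else 0)"
  proof -
    have "\<forall>P\<in>pts I. \<exists>s. s \<in> secs_le (card I) \<and> (\<forall>Q\<in>pts I. node_diff m I a Q s = (if Q = P then 1 else 0))"
      using node_lift[OF good] by blast
    then have "\<exists>\<sigma>. \<forall>P\<in>pts I. \<sigma> P \<in> secs_le (card I) \<and> (\<forall>Q\<in>pts I. node_diff m I a Q (\<sigma> P) = (if Q = P then 1 else 0))"
      by (rule bchoice)
    then show thesis using that by blast
  qed
  define v where "v P = contract I (node_vec m I a P) (w P)" for P
  have v: "v P \<in> cochains I (Suc p) UNIV" if "P \<in> pts I" for P
    unfolding v_def using w[OF that] by (rule contract_cochains) auto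
  define y0 where "y0 = (\<lambda>xs. \<Sum>P\<in>pts I. sconst (v P xs) * \<sigma> P)"
  have y0: "y0 \<in> cochains I (Suc p) (secs_le (card I))"
    unfolding y0_def
  proof (rule cochains_sum[OF F(1)])
    show "(\<lambda>xs. sconst (v P xs) * \<sigma> P) \<in> cochains I (Suc p) (secs_le (card I))" if "P \<in> pts I" for P
      by (rule cochains_map[OF v[OF that], of "\<lambda>c. sconst c * \<sigma> P"]) (use F(2) \<sigma>[OF that] in \<open>auto simp: sconst_uminus\<close>)
  qed
  have d0: "node_diff m I a P (y0 xs) = v P xs" if "P \<in> pts I" for P xs
  proof -
    have "node_diff m I a P (y0 xs) = (\<Sum>Q\<in>pts I. if Q = P then v P xs else 0)"
      unfolding y0_def node_diff_sum node_diff_scale by (intro sum.cong refl) (use \<sigma>' that in auto)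
    then show ?thesis using that finP by simp
  qed
  have "contract I ?E y0 \<in> cochains I p (sec_ring m I a 2)"
  proof -
    have c: "contract I ?E y0 \<in> cochains I p (secs_le (card I + card I))" by (rule contract_basis_deg[OF fin y0])
    have "contract I ?E y0 xs \<in> sec_ring m I a 2" for xs
    proof -
      have "pt_eval a (2 * card I) 1 P (contract I ?E y0 xs $ 1)
          = pt_glue m I a P ^ 2 * pt_eval a (2 * card I) 2 P (contract I ?E y0 xs $ 2)" if P: "P \<in> pts I" for P
      proof -
        have "(\<lambda>ys. node_diff m I a P (y0 ys)) = v P" using d0[OF P] by auto
        then have "contract I (node_vec m I a P) (\<lambda>ys. node_diff m I a P (y0 ys)) xs = 0"
          unfolding v_def using contract_contract[OF cochainsD(1)[OF w[OF P]]] by simp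
        then show ?thesis using node_contract[where y = y0 and m = m and xs = xs, OF good P cochainsD(2)[OF y0]] by simp
      qed
      then show ?thesis using cochainsD(2)[OF c, of xs] by (simp add: sec_ring_def mult_2)
    qed
    then show ?thesis using c unfolding cochains_def by blast
  qed
  from koszul_exactD[OF ex this] contract_contract[OF cochainsD(1)[OF y0]]
  obtain y1 where y1: "y1 \<in> cochains I (Suc p) (sec_ring m I a 1)" and e1: "\<And>xs. contract I ?E y1 xs = contract I ?E y0 xs"
    by blast
  have "y1 \<in> cochains I (Suc p) (secs_le (card I))"
    using y1 by (rule cochains_mono) (auto simp: sec_ring_1_iff[unfolded One_nat_def])
  then have "(\<lambda>xs. y0 xs - y1 xs) \<in> cochains I (Suc p) (secs_le (card I))"
    by (intro cochains_diff F(1) y0)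
  moreover have "contract I ?E (\<lambda>xs. y0 xs - y1 xs) xs = 0" for xs by (simp add: contract_diff e1)
  moreover have "node_diff m I a P (y0 xs - y1 xs) = v P xs" if "P \<in> pts I" for P xs
    using d0[OF that] cochainsD(2)[OF y1, of xs] that by (simp add: node_diff_diff sec_ring_1_iff[unfolded One_nat_def])
  ultimately show ?thesis unfolding v_def by (intro bexI[of _ "\<lambda>xs. y0 xs - y1 xs"]) auto
qed

text \<open>
  The linear forms that vanish at the two preimages of the node \<open>s\<close>. Multiplication by them
  identifies sections on the normalization with sections on the curve that vanish at this node.
\<close>

definition node_form :: "(nat \<times> 2 \<Rightarrow> complex) \<Rightarrow> nat \<Rightarrow> sec" where
  "node_form a s = (\<chi> j. [:- a (s, j), 1:])"

lemma basis_sec_remove: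
  assumes "finite I" "s \<in> I" "i \<in> I - {s}"
  shows "basis_sec m I a i = node_form a s * basis_sec m (I - {s}) a i"
proof -
  have "lin_prod (I - {i}) a j = [:- a (s, j), 1:] * lin_prod (I - {s} - {i}) a j" for j
    using lin_prod_remove[of "I - {i}" s a j] assms by (simp add: Diff_insert[symmetric] insert_commute)
  then show ?thesis
    by (simp add: basis_sec_def node_form_def vec_eq_iff mult.left_commute del: mult_pCons_left mult_pCons_right)
qed

lemma pt_denom_remove:
  assumes "finite I" "s \<in> I" "P \<in> pts (I - {s})"
  shows "pt_denom I a j P = pt_denom (I - {s}) a j P * pt_eval a 1 j P [:- a (s, j), 1:]"
proof (cases P)
  case (Fin l)
  then have "s \<in> I - {l}" "finite (I - {l})" using assms by (auto simp: pts_def)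
  then have "(\<Prod>r\<in>I - {l}. a (l, j) - a (r, j)) = (a (l, j) - a (s, j)) * (\<Prod>r\<in>I - {l} - {s}. a (l, j) - a (r, j))"
    by (intro prod.remove) auto
  moreover have "I - {l} - {s} = I - {s} - {l}" by auto
  ultimately show ?thesis by (simp add: Fin pt_denom_def pt_eval_def)
next
  case Zero
  have "(\<Prod>r\<in>I. - a (r, j)) = - a (s, j) * (\<Prod>r\<in>I - {s}. - a (r, j))"
    using assms by (intro prod.remove) auto
  then show ?thesis by (simp add: Zero pt_denom_def pt_eval_def)
qed (simp add: pt_denom_def pt_eval_def)

lemma node_form_nonzero:
  assumes "distinct_nodes I a" "s \<in> I" "P \<in> pts (I - {s})"
  shows "pt_eval a 1 j P [:- a (s, j), 1:] \<noteq> 0"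
  using assms distinct_nodesD(2,3)[OF assms(1)] by (cases P) (auto simp: pt_eval_def pts_def)

text \<open>
  The gluing factors before and after normalization differ by the ratio of the values of the two linear
  forms.
\<close>

lemma node_diff_remove:
  assumes "distinct_nodes I a" "s \<in> I" "P \<in> pts (I - {s})" "f \<in> secs_le (card (I - {s}))"
  shows "node_diff m I a P (node_form a s * f) = pt_eval a 1 1 P [:- a (s, 1), 1:] * node_diff m (I - {s}) a P f"
proof -
  have n: "card I = 1 + card (I - {s})" using assms(2) distinct_nodesD(1)[OF assms(1)] by (simp add: card.remove[of I s] del: card_Diff_insert)
  have "pt_eval a (card I) j P ((node_form a s * f) $ j)
      = pt_eval a 1 j P [:- a (s, j), 1:] * pt_eval a (card (I - {s})) j P (f $ j)" for j
    unfolding n using assms(4)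
    by (subst pt_eval_mult[symmetric]) (auto simp: node_form_def secs_le_def simp del: mult_pCons_left)
  then have "node_diff m I a P (node_form a s * f) = pt_eval a 1 1 P [:- a (s, 1), 1:] * pt_eval a (card (I - {s})) 1 P (f $ 1)
      - pt_glue m I a P * pt_eval a 1 2 P [:- a (s, 2), 1:] * pt_eval a (card (I - {s})) 2 P (f $ 2)"
    by (simp only: node_diff_def mult.assoc)
  also have "pt_glue m I a P * pt_eval a 1 2 P [:- a (s, 2), 1:] = pt_eval a 1 1 P [:- a (s, 1), 1:] * pt_glue m (I - {s}) a P"
    using node_form_nonzero[OF assms(1-3)]
    by (simp add: pt_glue_def pt_denom_remove[OF distinct_nodesD(1)[OF assms(1)] assms(2,3)])
  finally show ?thesis
    unfolding node_diff_def by (simp only: right_diff_distrib mult.assoc)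
qed

lemma node_vec_remove:
  assumes "distinct_nodes I a" "s \<in> I" "i \<in> I - {s}"
  shows "node_vec m I a P i = pt_eval a 1 1 P [:- a (s, 1), 1:] * node_vec m (I - {s}) a P i"
proof -
  note fin = distinct_nodesD(1)[OF assms(1)]
  have n: "card I = 1 + card (I - {s})" using assms(2) fin by (simp add: card.remove[of I s] del: card_Diff_insert)
  have "basis_sec m (I - {s}) a i \<in> secs_le (card (I - {s}))"
    using fin assms(3) by (intro basis_sec_deg) auto
  then show ?thesis
    unfolding node_vec_def basis_sec_remove[OF fin assms(2,3)] n
    by (subst pt_eval_mult[symmetric]) (auto simp: node_form_def secs_le_def simp del: mult_pCons_left)
qed

lemma node_vec_nonzero:
  assumes good: "distinct_nodes I a" and ne: "\<exists>l\<in>I. l \<le> m" "\<exists>l\<in>I. \<not> l \<le> m" and P: "P \<in> pts I"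
  shows "\<exists>i\<in>I. node_vec m I a P i \<noteq> 0"
proof (cases P)
  case (Fin l)
  then have "l \<in> I" using P by (auto simp: pts_def)
  then show ?thesis
    using pt_eval_basis(1)[OF good, of l l 1 m] pt_denom_nonzero[OF good P] Fin
    by (intro bexI[of _ l]) (auto simp: node_vec_def)
next
  case Zero
  then show ?thesis
    using ne(2) pt_eval_basis(2)[OF good, of _ 1 m] pt_denom_nonzero[OF good P] by (fastforce simp: node_vec_def)
next
  case Inf
  then show ?thesis
    using ne(1) pt_eval_basis(3)[OF good, of _ 1 m] by (fastforce simp: node_vec_def)
qed

text \<open>
  The lifting property of the normalization at \<open>s\<close>, read on the curve itself.
\<close>

lemma lift_cocycle_through_node:
  assumes good: "distinct_nodes I a" and s: "s \<in> I"
    and ex: "koszul_exact (I - {s}) (basis_sec m (I - {s}) a) p (sec_ring m (I - {s}) a 1) (sec_ring m (I - {s}) a 2)"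
    and w: "\<And>P. P \<in> pts I \<Longrightarrow> w P \<in> cochains (I - {s}) (Suc (Suc p)) UNIV"
    and ws: "\<And>xs. w (Fin s) xs = 0"
  shows "\<exists>y\<in>cochains I (Suc p) (secs_le (card I)). (\<forall>xs. contract I (basis_sec m I a) y xs = 0) \<and>
    (\<forall>P\<in>pts I. \<forall>xs. node_diff m I a P (y xs) = contract I (node_vec m I a P) (w P) xs)"
proof -
  let ?J = "I - {s}"
  note fin = distinct_nodesD(1)[OF good]
  have goodJ: "distinct_nodes ?J a" using good by (rule distinct_nodes_subset) auto
  have n: "card I = 1 + card ?J" using s fin by (simp add: card.remove[of I s] del: card_Diff_insert)
  have ptsJ: "P \<in> pts I" if "P \<in> pts ?J" for P using that by (auto simp: pts_def)
  have "\<exists>y\<in>cochains ?J (Suc p) (secs_le (card ?J)). (\<forall>xs. contract ?J (basis_sec m ?J a) y xs = 0) \<and>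
    (\<forall>P\<in>pts ?J. \<forall>xs. node_diff m ?J a P (y xs) = contract ?J (node_vec m ?J a P) (w P) xs)"
    by (rule lift_cocycle[OF goodJ ex]) (use w ptsJ in blast)
  then obtain y where y: "y \<in> cochains ?J (Suc p) (secs_le (card ?J))"
    and dy: "\<And>xs. contract ?J (basis_sec m ?J a) y xs = 0"
    and ny: "\<And>P xs. P \<in> pts ?J \<Longrightarrow> node_diff m ?J a P (y xs) = contract ?J (node_vec m ?J a P) (w P) xs"
    by blast
  define y' where "y' = (\<lambda>xs. node_form a s * y xs)"
  have nf: "node_form a s \<in> secs_le 1" by (simp add: secs_le_def node_form_def)
  have y'J: "y' \<in> cochains ?J (Suc p) (secs_le (card I))"
    unfolding y'_def n
    by (rule cochains_map[OF y, of "\<lambda>t. node_form a s * t"]) (use secs_le_mult[OF nf] in auto)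
  then have y': "y' \<in> cochains I (Suc p) (secs_le (card I))" by (rule cochains_mono) auto
  have "contract I (basis_sec m I a) y' xs = 0" for xs
  proof -
    have "contract I (basis_sec m I a) y' xs = contract ?J (basis_sec m I a) y' xs"
      by (rule contract_mono[OF y'J]) (use fin in auto)
    also have "\<dots> = (\<Sum>i\<in>?J. node_form a s * node_form a s * (basis_sec m ?J a i * y (i # xs)))"
      unfolding contract_def y'_def by (intro sum.cong refl) (simp add: basis_sec_remove[OF fin s] mult_ac)
    also have "\<dots> = node_form a s * node_form a s * contract ?J (basis_sec m ?J a) y xs"
      by (simp add: contract_def sum_distrib_left)
    finally show ?thesis using dy by simp
  qed
  moreover have "node_diff m I a P (y' xs) = contract I (node_vec m I a P) (w P) xs" if P: "P \<in> pts I" for P xs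
  proof (cases "P = Fin s")
    case True
    have "node_diff m I a P (y' xs) = 0"
      by (simp add: True node_diff_def pt_eval_def y'_def node_form_def)
    moreover have "w P = (\<lambda>_. 0)" using ws True by auto
    ultimately show ?thesis by (simp add: contract_def)
  next
    case False
    then have PJ: "P \<in> pts ?J" using P by (auto simp: pts_def)
    let ?c = "pt_eval a 1 1 P [:- a (s, 1), 1:]"
    have "node_diff m I a P (y' xs) = ?c * contract ?J (node_vec m ?J a P) (w P) xs"
      unfolding y'_def ny[OF PJ, symmetric] by (rule node_diff_remove[OF good s PJ cochainsD(2)[OF y]])
    also have "\<dots> = contract ?J (node_vec m I a P) (w P) xs"
      unfolding contract_def sum_distrib_left by (intro sum.cong refl) (simp add: node_vec_remove[OF good s])
    also have "\<dots> = contract I (node_vec m I a P) (w P) xs"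
      by (rule contract_mono[OF w[OF P], symmetric]) (use fin in auto)
    finally show ?thesis .
  qed
  ultimately show ?thesis using y' by blast
qed

text \<open>
  The indices in \<open>S\<close> belong to nodes which are coordinate points. A multi-index of length \<open>p + 2\<close> misses one
  of them, so everything reduces to sections that vanish at one of these nodes.
\<close>

theorem koszul_exact_from_projections:
  assumes good: "distinct_nodes I a" and S: "S \<subseteq> I" "\<And>s. s \<in> S \<Longrightarrow> m < s" "p + 3 \<le> card S" and ne: "\<exists>l\<in>I. l \<le> m"
    and ex: "\<And>s. s \<in> S \<Longrightarrow>
      koszul_exact (I - {s}) (basis_sec m (I - {s}) a) p (sec_ring m (I - {s}) a 1) (sec_ring m (I - {s}) a 2)"
  shows "koszul_exact I (basis_sec m I a) p (sec_ring m I a 1) (sec_ring m I a 2)"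
proof (rule koszul_exactI)
  let ?E = "basis_sec m I a" and ?x = "node_vec m I a" and ?D = "node_diff m I a"
  note fin = distinct_nodesD(1)[OF good]
  have finS: "finite S" using S(1) fin by (rule finite_subset)
  have "S \<noteq> {}" using S(3) by auto
  then have ne2: "\<exists>l\<in>I. \<not> l \<le> m" using S(1,2) by fastforce
  note F = sec_subspaceD[OF secs_le_subspace[of "card I"]]
  fix Z assume Z: "Z \<in> cochains I p (sec_ring m I a 2)" and cyc: "\<And>xs. contract I ?E Z xs = 0"
  \<comment> \<open>On the disjoint union of the two components the cycle is a boundary.\<close>
  have "\<exists>Y\<in>cochains I (Suc p) (polys_le (card I)). \<forall>xs. contract I (\<lambda>i. ?E i $ j) Y xs = Z xs $ j" for j
  proof -
    have "(\<lambda>xs. Z xs $ j) \<in> cochains I p (polys_le (2 * card I))"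
      by (rule cochains_map[OF Z]) (auto simp: sec_ring_def secs_le_def polys_le_def)
    moreover have "contract I (\<lambda>i. ?E i $ j) (\<lambda>xs. Z xs $ j) xs = 0" for xs
      using arg_cong[OF cyc[of xs], of "\<lambda>s. s $ j"] by (simp add: contract_def)
    ultimately show ?thesis
      using koszul_exactD[OF component_exact[OF good ne ne2, of j p]] by metis
  qed
  then obtain Yc where Yc: "\<And>j. Yc j \<in> cochains I (Suc p) (polys_le (card I))"
    and dYc: "\<And>j xs. contract I (\<lambda>i. ?E i $ j) (Yc j) xs = Z xs $ j" by metis
  define Y where "Y = (\<lambda>xs. (\<chi> j. Yc j xs) :: sec)"
  have Y: "Y \<in> cochains I (Suc p) (secs_le (card I))"
  proof (rule cochainsI)
    show "alternating Y"
      unfolding alternating_def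
    proof (intro allI)
      fix xs i j ys
      have "Yc k (xs @ i # j # ys) = - Yc k (xs @ j # i # ys)" for k
        by (rule alternatingD[OF cochainsD(1)[OF Yc]])
      then show "Y (xs @ i # j # ys) = - Y (xs @ j # i # ys)" by (simp add: Y_def vec_eq_iff)
    qed
    show "Y xs \<in> secs_le (card I)" for xs
      using cochainsD(2)[OF Yc] by (simp add: Y_def secs_le_def polys_le_def)
    show "length xs = Suc p" "set xs \<subseteq> I" if "Y xs \<noteq> 0" for xs
    proof -
      obtain j where "Yc j xs \<noteq> 0" using \<open>Y xs \<noteq> 0\<close> by (auto simp: Y_def vec_eq_iff)
      then show "length xs = Suc p" "set xs \<subseteq> I" using cochainsD(3,4)[OF Yc] by auto
    qed
  qed
  have dY: "contract I ?E Y xs = Z xs" for xs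
    using dYc[of _ xs] by (simp add: vec_eq_iff contract_def Y_def)
  have yb: "(\<lambda>xs. ?D P (Y xs)) \<in> cochains I (Suc p) UNIV" for P
    by (rule cochains_map[OF Y]) (auto simp: node_diff_diff[of _ _ _ _ 0, simplified])
  have dyb: "contract I (?x P) (\<lambda>xs. ?D P (Y xs)) xs = 0" if P: "P \<in> pts I" for P xs
    using node_contract[where y = Y and m = m and xs = xs, OF good P cochainsD(2)[OF Y]] cochainsD(2)[OF Z, of xs] P
    by (simp add: dY sec_ring_def)
  \<comment> \<open>Over a node, wedging with a vector on which the point \<open>P\<close> takes the value \<open>1\<close> is a contracting homotopy.\<close>
  have "\<exists>w\<in>cochains I (Suc (Suc p)) UNIV. \<forall>xs. contract I (?x P) w xs = ?D P (Y xs)" if P: "P \<in> pts I" for P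
  proof -
    obtain k where k: "k \<in> I" "?x P k \<noteq> 0" using node_vec_nonzero[OF good ne ne2 P] by blast
    let ?c = "\<lambda>i. if i = k then 1 / ?x P k else 0"
    have "(\<Sum>i\<in>I. ?c i * ?x P i) = (\<Sum>i\<in>I. if i = k then 1 else 0)"
      by (intro sum.cong) (use k in auto)
    then have 1: "(\<Sum>i\<in>I. ?c i * ?x P i) = 1" using k fin by simp
    have "contract I (?x P) (\<lambda>xs. ?D P (Y xs)) = (\<lambda>_. 0)" using dyb[OF P] by auto
    then have "contract I (?x P) (vwedge ?c (\<lambda>xs. ?D P (Y xs))) xs = ?D P (Y xs)" for xs
      unfolding contract_wedge 1 by simp
    moreover have "vwedge ?c (\<lambda>xs. ?D P (Y xs)) \<in> cochains I (Suc (Suc p)) UNIV"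
      by (rule wedge_cochains[OF yb order_refl]) (use k in \<open>auto split: if_splits\<close>)
    ultimately show ?thesis by blast
  qed
  then obtain w where w: "\<And>P. P \<in> pts I \<Longrightarrow> w P \<in> cochains I (Suc (Suc p)) UNIV"
    and dw: "\<And>P xs. P \<in> pts I \<Longrightarrow> contract I (?x P) (w P) xs = ?D P (Y xs)" by metis
  \<comment> \<open>The choice depends on the set of indices only, hence it is compatible with antisymmetry.\<close>
  define node where "node A = (SOME s. s \<in> S \<and> s \<notin> A)" for A
  have node: "node (set xs) \<in> S" "node (set xs) \<notin> set xs" if "length xs = Suc (Suc p)" for xs
  proof -
    have "\<not> S \<subseteq> set xs"
    proof
      assume "S \<subseteq> set xs"
      then have "card S \<le> length xs" using card_mono[of "set xs" S] card_length[of xs] by simp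
      then show False using S(3) that by simp
    qed
    then have "\<exists>s. s \<in> S \<and> s \<notin> set xs" by blast
    then show "node (set xs) \<in> S" "node (set xs) \<notin> set xs"
      unfolding node_def by (metis (mono_tags, lifting) someI_ex)+
  qed
  have FinS: "Fin s \<in> pts I" if "s \<in> S" for s using that S(1) by (auto simp: pts_def)
  define \<mu> where "\<mu> xs = (if length xs = Suc (Suc p) then w (Fin (node (set xs))) xs else 0)" for xs
  have \<mu>: "\<mu> \<in> cochains I (Suc (Suc p)) UNIV"
  proof (rule cochainsI)
    show "alternating \<mu>"
      unfolding alternating_def
    proof (intro allI)
      fix xs i j ys
      show "\<mu> (xs @ i # j # ys) = - \<mu> (xs @ j # i # ys)"
      proof (cases "length (xs @ i # j # ys) = Suc (Suc p)")
        case True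
        have "node (set (xs @ i # j # ys)) = node (set (xs @ j # i # ys))" by (simp add: insert_commute)
        then show ?thesis
          using True alternatingD[OF cochainsD(1)[OF w[OF FinS[OF node(1)[OF True]]]], of xs i j ys]
          by (simp add: \<mu>_def)
      qed (simp add: \<mu>_def)
    qed
    show len: "length xs = Suc (Suc p)" if "\<mu> xs \<noteq> 0" for xs
      using that by (simp add: \<mu>_def split: if_splits)
    show "set xs \<subseteq> I" if "\<mu> xs \<noteq> 0" for xs
      using that len[OF that] by (intro cochainsD(4)[OF w[OF FinS[OF node(1)[OF len[OF that]]]]]) (simp add: \<mu>_def)
  qed simp
  \<comment> \<open>Constants on one component change all node differences by the same amount; this is used to make
    the part of \<open>w\<close> treated at a node vanish at this node.\<close>
  define \<mu>' where "\<mu>' xs = ((\<chi> j. if j = 1 then [:\<mu> xs:] else 0) :: sec)" for xs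
  have \<mu>': "\<mu>' \<in> cochains I (Suc (Suc p)) (secs_le 0)"
    unfolding \<mu>'_def
    by (rule cochains_map[OF \<mu>, of "\<lambda>c. (\<chi> j. if j = 1 then [:c:] else 0)"]) (auto simp: vec_eq_iff secs_le_def)
  define Y1 where "Y1 = (\<lambda>xs. Y xs - contract I ?E \<mu>' xs)"
  have Y1: "Y1 \<in> cochains I (Suc p) (secs_le (card I))"
    unfolding Y1_def using contract_basis_deg[OF fin \<mu>'] by (intro cochains_diff Y F(1)) auto
  have dY1: "contract I ?E Y1 xs = Z xs" for xs
    unfolding Y1_def contract_diff dY using contract_contract[OF cochainsD(1)[OF \<mu>']] by simp
  define w1 where "w1 P xs = w P xs - \<mu> xs" for P xs
  have w1: "w1 P \<in> cochains I (Suc (Suc p)) UNIV" if "P \<in> pts I" for P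
    unfolding w1_def[abs_def] using w[OF that] \<mu> by (intro cochains_diff) auto
  have DY1: "?D P (Y1 xs) = contract I (?x P) (w1 P) xs" if P: "P \<in> pts I" for P xs
  proof -
    have "?D P (contract I ?E \<mu>' xs) = (\<Sum>i\<in>I. ?x P i * \<mu> (i # xs))"
      by (simp add: contract_def node_diff_sum)
         (simp add: node_diff_def \<mu>'_def node_vec_def pt_eval_smult mult.commute)
    then show ?thesis
      using dw[OF P, of xs] by (simp add: Y1_def w1_def[abs_def] node_diff_diff contract_diff) (simp add: contract_def)
  qed
  \<comment> \<open>The part of \<open>w1\<close> that is treated by projection from the node \<open>s\<close>.\<close>
  define w2 where "w2 s P xs = (if length xs = Suc (Suc p) \<and> node (set xs) = s then w1 P xs else 0)" for s P xs
  have w2: "w2 s P \<in> cochains (I - {s}) (Suc (Suc p)) UNIV" if P: "P \<in> pts I" for s P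
  proof (rule cochainsI)
    show "alternating (w2 s P)"
      unfolding alternating_def
    proof (intro allI)
      fix xs i j ys
      have "node (set (xs @ i # j # ys)) = node (set (xs @ j # i # ys))" by (simp add: insert_commute)
      then show "w2 s P (xs @ i # j # ys) = - w2 s P (xs @ j # i # ys)"
        using alternatingD[OF cochainsD(1)[OF w1[OF P]], of xs i j ys] by (simp add: w2_def)
    qed
    show "length xs = Suc (Suc p)" "set xs \<subseteq> I - {s}" if "w2 s P xs \<noteq> 0" for xs
      using that cochainsD(4)[OF w1[OF P], of xs] node(2)[of xs] by (auto simp: w2_def split: if_splits)
  qed simp
  have "w2 s (Fin s) xs = 0" for s xs by (simp add: w2_def w1_def \<mu>_def)
  then have "\<exists>y\<in>cochains I (Suc p) (secs_le (card I)). (\<forall>xs. contract I ?E y xs = 0) \<and>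
    (\<forall>P\<in>pts I. \<forall>xs. ?D P (y xs) = contract I (?x P) (w2 s P) xs)" if "s \<in> S" for s
    using that S(1) by (intro lift_cocycle_through_node[OF good _ ex[OF that] w2]) auto
  then obtain y where y: "\<And>s. s \<in> S \<Longrightarrow> y s \<in> cochains I (Suc p) (secs_le (card I))"
    and dy: "\<And>s xs. s \<in> S \<Longrightarrow> contract I ?E (y s) xs = 0"
    and Dy: "\<And>s P xs. s \<in> S \<Longrightarrow> P \<in> pts I \<Longrightarrow> ?D P (y s xs) = contract I (?x P) (w2 s P) xs" by metis
  have w2_sum: "(\<Sum>s\<in>S. w2 s P xs) = w1 P xs" if P: "P \<in> pts I" for P xs
  proof (cases "length xs = Suc (Suc p)")
    case True
    have "(\<Sum>s\<in>S. w2 s P xs) = (\<Sum>s\<in>S. if s = node (set xs) then w1 P xs else 0)"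
      by (intro sum.cong) (auto simp: w2_def True)
    then show ?thesis using finS node(1)[OF True] by simp
  next
    case False
    then show ?thesis using cochainsD(5)[OF w1[OF P]] by (simp add: w2_def)
  qed
  define Y2 where "Y2 = (\<lambda>xs. Y1 xs - (\<Sum>s\<in>S. y s xs))"
  have Y2: "Y2 \<in> cochains I (Suc p) (secs_le (card I))"
    unfolding Y2_def by (intro cochains_diff Y1 F(1) cochains_sum y)
  have "?D P (Y2 xs) = 0" if P: "P \<in> pts I" for P xs
  proof -
    have "(\<Sum>s\<in>S. ?D P (y s xs)) = contract I (?x P) (\<lambda>xs. \<Sum>s\<in>S. w2 s P xs) xs"
      by (simp add: Dy P contract_sum)
    also have "(\<lambda>xs. \<Sum>s\<in>S. w2 s P xs) = w1 P" using w2_sum[OF P] by auto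
    finally show ?thesis by (simp add: Y2_def node_diff_diff node_diff_sum DY1[OF P])
  qed
  then have "Y2 xs \<in> sec_ring m I a 1" for xs
    using cochainsD(2)[OF Y2] by (simp add: sec_ring_1_iff[unfolded One_nat_def])
  then have "Y2 \<in> cochains I (Suc p) (sec_ring m I a 1)" using Y2 unfolding cochains_def by blast
  moreover have "contract I ?E Y2 xs = Z xs" for xs
    by (simp add: Y2_def contract_diff contract_sum dY1 dy)
  ultimately show "\<exists>Y\<in>cochains I (Suc p) (sec_ring m I a 1). \<forall>xs. contract I ?E Y xs = Z xs" by blast
qed

section \<open>Exactness is an open condition\<close>

lemma polynomial_fun_uminus: "polynomial_fun K f \<Longrightarrow> polynomial_fun K (\<lambda>x. - f x)"
  using polynomial_fun.mult[OF polynomial_fun.const[of K "-1"]] by simp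

lemma polynomial_fun_diff: "polynomial_fun K f \<Longrightarrow> polynomial_fun K h \<Longrightarrow> polynomial_fun K (\<lambda>x. f x - h x)"
  using polynomial_fun.add[OF _ polynomial_fun_uminus] by fastforce

lemma polynomial_fun_sum:
  "(\<And>i. i \<in> A \<Longrightarrow> polynomial_fun K (f i)) \<Longrightarrow> polynomial_fun K (\<lambda>x. \<Sum>i\<in>A. f i x)"
  by (induction A rule: infinite_finite_induct) (auto intro: polynomial_fun.const polynomial_fun.add)

lemma polynomial_fun_prod:
  "(\<And>i. i \<in> A \<Longrightarrow> polynomial_fun K (f i)) \<Longrightarrow> polynomial_fun K (\<lambda>x. \<Prod>i\<in>A. f i x)"
  by (induction A rule: infinite_finite_induct) (auto intro: polynomial_fun.const polynomial_fun.mult)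

lemma polynomial_fun_power: "polynomial_fun K f \<Longrightarrow> polynomial_fun K (\<lambda>x. f x ^ n)"
  by (induction n) (auto intro: polynomial_fun.const polynomial_fun.mult)

lemmas polynomial_fun_intros = polynomial_fun.const polynomial_fun.coord polynomial_fun.add polynomial_fun.mult
  polynomial_fun_uminus polynomial_fun_diff polynomial_fun_sum polynomial_fun_prod polynomial_fun_power

text \<open>
  Gaussian elimination with a pivot that is nonzero at \<open>a0\<close>; the product of the pivots is the polynomial
  sought. The set \<open>R\<close> of rows may be infinite.
\<close>

lemma injective_open:
  assumes "finite C" "\<And>r c. r \<in> R \<Longrightarrow> c \<in> C \<Longrightarrow> polynomial_fun K (M r c)"
    and "\<And>x :: 'c \<Rightarrow> complex. (\<forall>r\<in>R. (\<Sum>c\<in>C. M r c a0 * x c) = 0) \<Longrightarrow> \<forall>c\<in>C. x c = 0"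
  shows "\<exists>f. polynomial_fun K f \<and> f a0 \<noteq> 0 \<and>
    (\<forall>a. f a \<noteq> 0 \<longrightarrow> (\<forall>x. (\<forall>r\<in>R. (\<Sum>c\<in>C. M r c a * x c) = 0) \<longrightarrow> (\<forall>c\<in>C. x c = 0)))"
  using assms
proof (induction C arbitrary: M rule: finite_induct)
  case empty
  show ?case using polynomial_fun.const[of K 1] by (intro exI[of _ "\<lambda>_. 1"]) auto
next
  case (insert k C)
  have "\<exists>r\<in>R. M r k a0 \<noteq> 0"
  proof (rule ccontr)
    assume "\<not> ?thesis"
    then have "\<forall>r\<in>R. (\<Sum>c\<in>insert k C. M r c a0 * (if c = k then 1 else 0)) = 0"
      using insert.hyps by (auto intro!: sum.neutral)
    from insert.prems(2)[OF this] show False by simp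
  qed
  then obtain r0 where r0: "r0 \<in> R" "M r0 k a0 \<noteq> 0" by blast
  define M' where "M' r c a = M r0 k a * M r c a - M r k a * M r0 c a" for r c a
  have M'_sum: "(\<Sum>c\<in>C. M' r c a * x c)
      = M r0 k a * (\<Sum>c\<in>C. M r c a * x c) - M r k a * (\<Sum>c\<in>C. M r0 c a * x c)" for r a x
    by (simp add: M'_def left_diff_distrib sum_subtractf sum_distrib_left mult.assoc)
  have "\<exists>f. polynomial_fun K f \<and> f a0 \<noteq> 0 \<and>
    (\<forall>a. f a \<noteq> 0 \<longrightarrow> (\<forall>x. (\<forall>r\<in>R. (\<Sum>c\<in>C. M' r c a * x c) = 0) \<longrightarrow> (\<forall>c\<in>C. x c = 0)))"
  proof (rule insert.IH)
    show "polynomial_fun K (M' r c)" if "r \<in> R" "c \<in> C" for r c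
      unfolding M'_def[abs_def] using that insert.prems(1) r0(1) by (intro polynomial_fun_intros) auto
    fix x :: "'c \<Rightarrow> complex" assume x: "\<forall>r\<in>R. (\<Sum>c\<in>C. M' r c a0 * x c) = 0"
    define y where "y = x(k := - (\<Sum>c\<in>C. M r0 c a0 * x c) / M r0 k a0)"
    have yC: "(\<Sum>c\<in>C. M r c a0 * y c) = (\<Sum>c\<in>C. M r c a0 * x c)" for r
      using insert.hyps(2) by (intro sum.cong) (auto simp: y_def)
    have "\<forall>r\<in>R. (\<Sum>c\<in>insert k C. M r c a0 * y c) = 0"
    proof
      fix r assume "r \<in> R"
      then have "M r0 k a0 * (\<Sum>c\<in>C. M r c a0 * x c) - M r k a0 * (\<Sum>c\<in>C. M r0 c a0 * x c) = 0"
        unfolding M'_sum[symmetric] using x by blast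
      moreover have "M r0 k a0 * y k = - (\<Sum>c\<in>C. M r0 c a0 * x c)"
        using r0(2) by (simp add: y_def)
      ultimately have "M r0 k a0 * (M r k a0 * y k + (\<Sum>c\<in>C. M r c a0 * x c)) = 0"
        by (simp add: distrib_left mult.left_commute[of "M r0 k a0"])
      then show "(\<Sum>c\<in>insert k C. M r c a0 * y c) = 0"
        using r0(2) insert.hyps by (simp add: yC)
    qed
    from insert.prems(2)[OF this] have "\<forall>c\<in>insert k C. y c = 0" .
    then show "\<forall>c\<in>C. x c = 0" using insert.hyps(2) by (auto simp: y_def split: if_splits)
  qed
  then obtain f where f: "polynomial_fun K f" "f a0 \<noteq> 0"
    "\<And>a x. f a \<noteq> 0 \<Longrightarrow> (\<forall>r\<in>R. (\<Sum>c\<in>C. M' r c a * x c) = 0) \<Longrightarrow> \<forall>c\<in>C. x c = 0" by blast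
  have "\<forall>c\<in>insert k C. x c = 0"
    if a: "f a * M r0 k a \<noteq> 0" and x: "\<forall>r\<in>R. (\<Sum>c\<in>insert k C. M r c a * x c) = 0" for a x
  proof -
    have eq: "(\<Sum>c\<in>C. M r c a * x c) = - (M r k a * x k)" if "r \<in> R" for r
      using x that insert.hyps by (simp add: eq_neg_iff_add_eq_0 add.commute)
    have "\<forall>r\<in>R. (\<Sum>c\<in>C. M' r c a * x c) = 0"
      unfolding M'_sum using eq r0(1) by (simp add: mult_ac)
    then have "\<forall>c\<in>C. x c = 0" using a by (intro f(3)) auto
    then show ?thesis using eq[OF r0(1)] a by simp
  qed
  moreover have "polynomial_fun K (\<lambda>a. f a * M r0 k a)"
    using f(1) insert.prems(1)[OF r0(1)] by (intro polynomial_fun.mult) auto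
  ultimately show ?case using f(2) r0(2) by (intro exI[of _ "\<lambda>a. f a * M r0 k a"]) auto
qed

text \<open>
  Here \<open>A\<close> consists of vectors indexed by \<open>X\<close> and \<open>B\<close> of equations indexed by \<open>R\<close>; exactness means that the
  solutions of \<open>B\<close> are spanned by \<open>A\<close>. If \<open>A\<close> has an entry in the row \<open>y0\<close> that is nonzero at \<open>a0\<close>, then
  the vector containing it is used to clear this row, and the row can be dropped. If there is no
  such entry, then \<open>B\<close> is injective at \<open>a0\<close>, and injectivity is open.
\<close>

lemma exactness_open:
  fixes A :: "'x \<Rightarrow> 'y \<Rightarrow> ('i \<Rightarrow> complex) \<Rightarrow> complex" and B :: "'r \<Rightarrow> 'y \<Rightarrow> ('i \<Rightarrow> complex) \<Rightarrow> complex"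
  assumes "finite Y" "finite X" "\<And>x y. x \<in> X \<Longrightarrow> y \<in> Y \<Longrightarrow> polynomial_fun K (A x y)"
    and polB: "\<And>r y. r \<in> R \<Longrightarrow> y \<in> Y \<Longrightarrow> polynomial_fun K (B r y)"
    and "\<And>z. (\<forall>r\<in>R. (\<Sum>y\<in>Y. B r y a0 * z y) = 0) \<Longrightarrow> \<exists>c. \<forall>y\<in>Y. z y = (\<Sum>x\<in>X. c x * A x y a0)"
  shows "\<exists>f. polynomial_fun K f \<and> f a0 \<noteq> 0 \<and>
    (\<forall>a. f a \<noteq> 0 \<and> (\<forall>x\<in>X. \<forall>r\<in>R. (\<Sum>y\<in>Y. B r y a * A x y a) = 0) \<longrightarrow>
      (\<forall>z. (\<forall>r\<in>R. (\<Sum>y\<in>Y. B r y a * z y) = 0) \<longrightarrow> (\<exists>c. \<forall>y\<in>Y. z y = (\<Sum>x\<in>X. c x * A x y a))))"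
  using assms(1,3-)
proof (induction Y arbitrary: A rule: finite_psubset_induct)
  case (psubset Y)
  show ?case
  proof (cases "\<forall>x\<in>X. \<forall>y\<in>Y. A x y a0 = 0")
    case True
    have "\<exists>f. polynomial_fun K f \<and> f a0 \<noteq> 0 \<and>
        (\<forall>a. f a \<noteq> 0 \<longrightarrow> (\<forall>z. (\<forall>r\<in>R. (\<Sum>y\<in>Y. B r y a * z y) = 0) \<longrightarrow> (\<forall>y\<in>Y. z y = 0)))"
    proof (rule injective_open[OF psubset.hyps(1) psubset.prems(2)])
      fix z assume "\<forall>r\<in>R. (\<Sum>y\<in>Y. B r y a0 * z y) = 0"
      then obtain c where "\<forall>y\<in>Y. z y = (\<Sum>x\<in>X. c x * A x y a0)" using psubset.prems(3) by blast
      then show "\<forall>y\<in>Y. z y = 0" using True by simp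
    qed
    then obtain f where f: "polynomial_fun K f" "f a0 \<noteq> 0"
      "\<And>a z. f a \<noteq> 0 \<Longrightarrow> \<forall>r\<in>R. (\<Sum>y\<in>Y. B r y a * z y) = 0 \<Longrightarrow> \<forall>y\<in>Y. z y = 0" by blast
    show ?thesis
    proof (intro exI conjI allI impI)
      fix a z assume "f a \<noteq> 0 \<and> (\<forall>x\<in>X. \<forall>r\<in>R. (\<Sum>y\<in>Y. B r y a * A x y a) = 0)"
        and "\<forall>r\<in>R. (\<Sum>y\<in>Y. B r y a * z y) = 0"
      then have "\<forall>y\<in>Y. z y = 0" using f(3) by blast
      then show "\<forall>y\<in>Y. z y = (\<Sum>x\<in>X. 0 * A x y a)" by simp
    qed (use f in auto)
  next
    case False
    then obtain x0 y0 where x0: "x0 \<in> X" and y0: "y0 \<in> Y" and nz: "A x0 y0 a0 \<noteq> 0" by blast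
    define Y' where "Y' = Y - {y0}"
    have Y': "Y' \<subset> Y" "finite Y'" "\<And>h. (\<Sum>y\<in>Y. h y) = h y0 + (\<Sum>y\<in>Y'. h y :: complex)"
      using y0 psubset.hyps(1) by (auto simp: Y'_def sum.remove)
    define A' where "A' x y a = A x0 y0 a * A x y a - A x y0 a * A x0 y a" for x y a
    have "\<exists>f. polynomial_fun K f \<and> f a0 \<noteq> 0 \<and>
      (\<forall>a. f a \<noteq> 0 \<and> (\<forall>x\<in>X. \<forall>r\<in>R. (\<Sum>y\<in>Y'. B r y a * A' x y a) = 0) \<longrightarrow>
      (\<forall>z. (\<forall>r\<in>R. (\<Sum>y\<in>Y'. B r y a * z y) = 0) \<longrightarrow> (\<exists>c. \<forall>y\<in>Y'. z y = (\<Sum>x\<in>X. c x * A' x y a))))"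
    proof (rule psubset.IH[OF Y'(1)])
      show "polynomial_fun K (A' x y)" if "x \<in> X" "y \<in> Y'" for x y
        unfolding A'_def[abs_def] using that psubset.prems(1) x0 y0 Y'(1) by (intro polynomial_fun_intros) auto
      show "polynomial_fun K (B r y)" if "r \<in> R" "y \<in> Y'" for r y
        using that psubset.prems(2) Y'(1) by blast
      fix z assume z: "\<forall>r\<in>R. (\<Sum>y\<in>Y'. B r y a0 * z y) = 0"
      have "(\<Sum>y\<in>Y'. B r y a0 * (z(y0 := 0)) y) = (\<Sum>y\<in>Y'. B r y a0 * z y)" for r
        by (intro sum.cong) (auto simp: Y'_def)
      then have "\<forall>r\<in>R. (\<Sum>y\<in>Y. B r y a0 * (z(y0 := 0)) y) = 0" using z by (simp add: Y'(3))
      then obtain c where c: "\<forall>y\<in>Y. (z(y0 := 0)) y = (\<Sum>x\<in>X. c x * A x y a0)" using psubset.prems(3) by blast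
      have c0: "(\<Sum>x\<in>X. c x * A x y0 a0) = 0" using c y0 by auto
      have "z y = (\<Sum>x\<in>X. (c x / A x0 y0 a0) * A' x y a0)" if "y \<in> Y'" for y
      proof -
        have "(\<Sum>x\<in>X. (c x / A x0 y0 a0) * A' x y a0)
            = (\<Sum>x\<in>X. c x * A x y a0 - (c x * A x y0 a0) * (A x0 y a0 / A x0 y0 a0))"
          by (intro sum.cong refl) (use nz in \<open>simp add: A'_def field_simps\<close>)
        also have "\<dots> = z y"
          unfolding sum_subtractf sum_distrib_right[symmetric] c0 using c that by (auto simp: Y'_def)
        finally show ?thesis by simp
      qed
      then show "\<exists>c. \<forall>y\<in>Y'. z y = (\<Sum>x\<in>X. c x * A' x y a0)"
        by (intro exI[of _ "\<lambda>x. c x / A x0 y0 a0"]) simp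
    qed
    then obtain f where f: "polynomial_fun K f" "f a0 \<noteq> 0"
      and fex: "\<And>a z. f a \<noteq> 0 \<Longrightarrow> \<forall>x\<in>X. \<forall>r\<in>R. (\<Sum>y\<in>Y'. B r y a * A' x y a) = 0 \<Longrightarrow>
        \<forall>r\<in>R. (\<Sum>y\<in>Y'. B r y a * z y) = 0 \<Longrightarrow> \<exists>c. \<forall>y\<in>Y'. z y = (\<Sum>x\<in>X. c x * A' x y a)" by blast
    show ?thesis
    proof (intro exI[of _ "\<lambda>a. f a * A x0 y0 a"] conjI allI impI)
      show "polynomial_fun K (\<lambda>a. f a * A x0 y0 a)" by (intro polynomial_fun_intros f psubset.prems x0 y0)
      show "f a0 * A x0 y0 a0 \<noteq> 0" using f nz by simp
      fix a z
      assume a: "f a * A x0 y0 a \<noteq> 0 \<and> (\<forall>x\<in>X. \<forall>r\<in>R. (\<Sum>y\<in>Y. B r y a * A x y a) = 0)"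
        and z: "\<forall>r\<in>R. (\<Sum>y\<in>Y. B r y a * z y) = 0"
      have nz': "A x0 y0 a \<noteq> 0" using a by auto
      have BA: "(\<Sum>y\<in>Y'. B r y a * A x y a) = - (B r y0 a * A x y0 a)" if "x \<in> X" "r \<in> R" for x r
        using a that by (simp add: Y'(3) eq_neg_iff_add_eq_0 add.commute)
      have Bz: "(\<Sum>y\<in>Y'. B r y a * z y) = - (B r y0 a * z y0)" if "r \<in> R" for r
        using z that by (simp add: Y'(3) eq_neg_iff_add_eq_0 add.commute)
      have lin: "(\<Sum>y\<in>Y'. B r y a * (s * g y - t * h y))
          = s * (\<Sum>y\<in>Y'. B r y a * g y) - t * (\<Sum>y\<in>Y'. B r y a * h y)" for r s t g h
        by (simp add: algebra_simps sum_subtractf sum_distrib_left)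
      have "\<exists>c. \<forall>y\<in>Y'. A x0 y0 a * z y - z y0 * A x0 y a = (\<Sum>x\<in>X. c x * A' x y a)"
      proof (rule fex)
        show "f a \<noteq> 0" using a by auto
        show "\<forall>x\<in>X. \<forall>r\<in>R. (\<Sum>y\<in>Y'. B r y a * A' x y a) = 0"
          unfolding A'_def lin using BA x0 by (simp add: mult_ac)
        show "\<forall>r\<in>R. (\<Sum>y\<in>Y'. B r y a * (A x0 y0 a * z y - z y0 * A x0 y a)) = 0"
          unfolding lin using BA Bz x0 by (simp add: mult_ac)
      qed
      then obtain c where c: "\<And>y. y \<in> Y' \<Longrightarrow> A x0 y0 a * z y - z y0 * A x0 y a = (\<Sum>x\<in>X. c x * A' x y a)" by blast
      define k where "k = (z y0 - (\<Sum>x\<in>X. c x * A x y0 a)) / A x0 y0 a"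
      have comb: "(\<Sum>x\<in>X. (c x + (if x = x0 then k else 0)) * A x y a) = (\<Sum>x\<in>X. c x * A x y a) + k * A x0 y a" for y
      proof -
        have "(\<Sum>x\<in>X. (if x = x0 then k else 0) * A x y a) = (\<Sum>x\<in>X. if x = x0 then k * A x0 y a else 0)"
          by (intro sum.cong) auto
        then show ?thesis using x0 assms(2) by (simp add: distrib_right sum.distrib)
      qed
      show "\<exists>c. \<forall>y\<in>Y. z y = (\<Sum>x\<in>X. c x * A x y a)"
      proof (intro exI[of _ "\<lambda>x. c x + (if x = x0 then k else 0)"] ballI)
        fix y assume "y \<in> Y"
        show "z y = (\<Sum>x\<in>X. (c x + (if x = x0 then k else 0)) * A x y a)"
        proof (cases "y = y0")
          case True
          then show ?thesis unfolding comb using nz' by (simp add: k_def)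
        next
          case False
          then have "A x0 y0 a * z y - z y0 * A x0 y a = (\<Sum>x\<in>X. c x * A' x y a)"
            using \<open>y \<in> Y\<close> by (intro c) (simp add: Y'_def)
          also have "\<dots> = A x0 y0 a * (\<Sum>x\<in>X. c x * A x y a) - (\<Sum>x\<in>X. c x * A x y0 a) * A x0 y a"
            by (simp add: A'_def algebra_simps sum_subtractf sum_distrib_left)
          finally have "A x0 y0 a * z y = A x0 y0 a * (\<Sum>x\<in>X. c x * A x y a)
              + (z y0 - (\<Sum>x\<in>X. c x * A x y0 a)) * A x0 y a"
            by (simp add: algebra_simps)
          also have "z y0 - (\<Sum>x\<in>X. c x * A x y0 a) = A x0 y0 a * k" using nz' by (simp add: k_def)
          finally have "A x0 y0 a * z y = A x0 y0 a * ((\<Sum>x\<in>X. c x * A x y a) + k * A x0 y a)"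
            by (simp add: distrib_left mult.assoc)
          then show ?thesis unfolding comb using nz' by simp
        qed
      qed
    qed
  qed
qed

definition polynomial_form :: "'i set \<Rightarrow> 'y set \<Rightarrow> (('i \<Rightarrow> complex) \<Rightarrow> ('y \<Rightarrow> complex) \<Rightarrow> complex) \<Rightarrow> bool" where
  "polynomial_form K Y \<Phi> \<longleftrightarrow>
     (\<exists>b. (\<forall>y\<in>Y. polynomial_fun K (b y)) \<and> (\<forall>a z. \<Phi> a z = (\<Sum>y\<in>Y. b y a * z y)))"

lemma polynomial_form_coord:
  fixes y :: 'y
  assumes "finite Y" "y \<in> Y"
  shows "polynomial_form K Y (\<lambda>a z. z y)"
  unfolding polynomial_form_def
proof (intro exI[of _ "\<lambda>y' a. if y' = y then 1 else 0"] conjI ballI allI)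
  show "polynomial_fun K (\<lambda>a. if y' = y then 1 else 0)" for y' by (intro polynomial_fun.const)
  fix z :: "'y \<Rightarrow> complex"
  have "(\<Sum>y'\<in>Y. (if y' = y then 1 else 0) * z y') = (\<Sum>y'\<in>Y. if y' = y then z y else 0)"
    by (intro sum.cong) auto
  then show "z y = (\<Sum>y'\<in>Y. (if y' = y then 1 else 0) * z y')" using assms by simp
qed

lemma polynomial_form_0: "polynomial_form K Y (\<lambda>a z. 0)"
  unfolding polynomial_form_def
  by (intro exI[of _ "\<lambda>y a. 0"]) (auto intro: polynomial_fun.const)

lemma polynomial_form_add:
  assumes "polynomial_form K Y \<Phi>" "polynomial_form K Y \<Psi>"
  shows "polynomial_form K Y (\<lambda>a z. \<Phi> a z + \<Psi> a z)"
proof -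
  obtain b c where "\<forall>y\<in>Y. polynomial_fun K (b y)" "\<forall>a z. \<Phi> a z = (\<Sum>y\<in>Y. b y a * z y)"
    "\<forall>y\<in>Y. polynomial_fun K (c y)" "\<forall>a z. \<Psi> a z = (\<Sum>y\<in>Y. c y a * z y)"
    using assms unfolding polynomial_form_def by blast
  then show ?thesis unfolding polynomial_form_def
    by (intro exI[of _ "\<lambda>y a. b y a + c y a"]) (auto intro: polynomial_fun.add simp: distrib_right sum.distrib)
qed

lemma polynomial_form_mult:
  assumes "polynomial_form K Y \<Phi>" "polynomial_fun K f"
  shows "polynomial_form K Y (\<lambda>a z. f a * \<Phi> a z)"
proof -
  obtain b where "\<forall>y\<in>Y. polynomial_fun K (b y)" "\<forall>a z. \<Phi> a z = (\<Sum>y\<in>Y. b y a * z y)"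
    using assms unfolding polynomial_form_def by blast
  then show ?thesis unfolding polynomial_form_def
    by (intro exI[of _ "\<lambda>y a. f a * b y a"]) (auto intro: polynomial_fun.mult assms(2) simp: sum_distrib_left mult.assoc)
qed

lemma polynomial_form_sum:
  "(\<And>i. i \<in> A \<Longrightarrow> polynomial_form K Y (\<Phi> i)) \<Longrightarrow> polynomial_form K Y (\<lambda>a z. \<Sum>i\<in>A. \<Phi> i a z)"
  by (induction A rule: infinite_finite_induct) (auto intro: polynomial_form_0 polynomial_form_add)

lemma exactness_open_forms:
  fixes A :: "'x \<Rightarrow> 'y \<Rightarrow> ('i \<Rightarrow> complex) \<Rightarrow> complex"
  assumes "finite Y" "finite X" "\<And>x y. x \<in> X \<Longrightarrow> y \<in> Y \<Longrightarrow> polynomial_fun K (A x y)"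
    and forms: "\<And>\<Phi>. \<Phi> \<in> R \<Longrightarrow> polynomial_form K Y \<Phi>"
    and ex: "\<And>z. (\<forall>\<Phi>\<in>R. \<Phi> a0 z = 0) \<Longrightarrow> \<exists>c. \<forall>y\<in>Y. z y = (\<Sum>x\<in>X. c x * A x y a0)"
  shows "\<exists>f. polynomial_fun K f \<and> f a0 \<noteq> 0 \<and>
    (\<forall>a. f a \<noteq> 0 \<and> (\<forall>x\<in>X. \<forall>\<Phi>\<in>R. \<Phi> a (\<lambda>y. A x y a) = 0) \<longrightarrow>
      (\<forall>z. (\<forall>\<Phi>\<in>R. \<Phi> a z = 0) \<longrightarrow> (\<exists>c. \<forall>y\<in>Y. z y = (\<Sum>x\<in>X. c x * A x y a))))"
proof -
  have "\<forall>\<Phi>\<in>R. \<exists>b. (\<forall>y\<in>Y. polynomial_fun K (b y)) \<and> (\<forall>a z. \<Phi> a z = (\<Sum>y\<in>Y. b y a * z y))"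
    using forms unfolding polynomial_form_def by blast
  then have "\<exists>B. \<forall>\<Phi>\<in>R. (\<forall>y\<in>Y. polynomial_fun K (B \<Phi> y)) \<and> (\<forall>a z. \<Phi> a z = (\<Sum>y\<in>Y. B \<Phi> y a * z y))"
    by (rule bchoice)
  then obtain B where B: "\<And>\<Phi> y. \<Phi> \<in> R \<Longrightarrow> y \<in> Y \<Longrightarrow> polynomial_fun K (B \<Phi> y)"
    "\<And>\<Phi> a z. \<Phi> \<in> R \<Longrightarrow> \<Phi> a z = (\<Sum>y\<in>Y. B \<Phi> y a * z y)" by blast
  have "\<exists>f. polynomial_fun K f \<and> f a0 \<noteq> 0 \<and>
    (\<forall>a. f a \<noteq> 0 \<and> (\<forall>x\<in>X. \<forall>\<Phi>\<in>R. (\<Sum>y\<in>Y. B \<Phi> y a * A x y a) = 0) \<longrightarrow>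
      (\<forall>z. (\<forall>\<Phi>\<in>R. (\<Sum>y\<in>Y. B \<Phi> y a * z y) = 0) \<longrightarrow> (\<exists>c. \<forall>y\<in>Y. z y = (\<Sum>x\<in>X. c x * A x y a))))"
    by (rule exactness_open[OF assms(1,2)]) (use assms(3) B ex in \<open>simp_all add: B(2)[symmetric]\<close>)
  then show ?thesis by (simp add: B(2)[symmetric])
qed

section \<open>Openness of the vanishing of Koszul cohomology\<close>

text \<open>
  The coordinate with indices \<open>K\<close> of the wedge product of the basis vectors with indices \<open>J\<close>: a minor of the
  identity matrix. It does not depend on the parameters of the curve.
\<close>

primrec minor :: "'i list \<Rightarrow> 'i list \<Rightarrow> complex" where
  "minor [] = (\<lambda>K. if K = [] then 1 else 0)"
| "minor (j # J) = vwedge (\<lambda>i. if i = j then 1 else 0) (minor J)"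

lemma sconst_diff: "sconst (c - d) = sconst c - sconst d"
  using sconst_add[of c "- d"] by (simp add: sconst_uminus)

lemma vwedge_sconst:
  "vwedge (\<lambda>i. sconst (c i)) (\<lambda>K. sconst (w K) * u) xs = sconst (vwedge c w xs) * u"
  by (induction xs arbitrary: w) (auto simp: sconst_diff sconst_mult algebra_simps)

lemma contract_mult: "contract I e (\<lambda>K. c * w K) xs = c * contract I e w xs"
  by (simp add: contract_def sum_distrib_left mult.left_commute)

context koszul_basis
begin

lemma coords_minor: "set J \<subseteq> I \<Longrightarrow> coords (map E J) u = (\<lambda>K. sconst (minor J K) * u)"
proof (induction J)
  case (Cons j J)
  have "(\<lambda>i. sconst (\<kappa> i (E j))) = (\<lambda>i. sconst (if i = j then 1 else 0))"
    using kappa_E[of j] Cons.prems by auto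
  then have "coords (map E (j # J)) u = vwedge (\<lambda>i. sconst (if i = j then 1 else 0)) (\<lambda>K. sconst (minor J K) * u)"
    using Cons by simp
  then show ?case by (simp only: vwedge_sconst minor.simps)
qed auto

lemma minor_cochains:
  assumes "J \<in> index_lists I p" "sec_subspace W" "u \<in> W"
  shows "(\<lambda>K. sconst (minor J K) * u) \<in> cochains I p W"
  using coords_cochains[OF assms(2,3), of "map E J"] assms(1) by (simp add: coords_minor index_lists_def)

text \<open>
  Antisymmetric arrays are combinations of minors; so boundaries become linear combinations of finitely many
  explicit vectors, without a side condition of antisymmetry on the coefficients.
\<close>

lemma cochain_expansion:
  assumes Y: "Y \<in> cochains I p V"
  shows "Y K = (\<Sum>(J, i)\<in>index_lists I p \<times> I. sconst (\<kappa> i (Y J) / fact p) * (sconst (minor J K) * E i))"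
proof -
  have "(\<Sum>J\<in>index_lists I p. sconst (minor J K) * Y J) = of_nat (fact p) * Y K"
    using coords_basis_sum[OF Y, of K] by (simp add: coords_minor index_lists_def)
  moreover have "sconst (1 / fact p) * of_nat (fact p) = 1"
    unfolding sconst_of_nat[symmetric] sconst_mult[symmetric] by simp
  ultimately have "Y K = sconst (1 / fact p) * (\<Sum>J\<in>index_lists I p. sconst (minor J K) * Y J)"
    by (simp add: mult.assoc[symmetric])
  also have "\<dots> = (\<Sum>J\<in>index_lists I p. sconst (1 / fact p) * (sconst (minor J K) * (\<Sum>i\<in>I. sconst (\<kappa> i (Y J)) * E i)))"
    using expand[OF cochainsD(2)[OF Y]] by (simp add: sum_distrib_left)
  also have "\<dots> = (\<Sum>J\<in>index_lists I p. \<Sum>i\<in>I. sconst (\<kappa> i (Y J) / fact p) * (sconst (minor J K) * E i))"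
  proof -
    have "sconst (1 / fact p) * sconst c = sconst (c / fact p)" for c by (simp add: sconst_mult[symmetric])
    then show ?thesis unfolding sum_distrib_left
      by (intro sum.cong refl) (metis (no_types, lifting) mult.assoc mult.left_commute)
  qed
  finally show ?thesis by (simp add: sum.cartesian_product split_def)
qed

end

definition poly_coeffs_fun :: "'i set \<Rightarrow> (('i \<Rightarrow> complex) \<Rightarrow> complex poly) \<Rightarrow> bool" where
  "poly_coeffs_fun K F \<longleftrightarrow> (\<forall>n. polynomial_fun K (\<lambda>a. coeff (F a) n))"

lemma poly_coeffs_fun_const: "poly_coeffs_fun K (\<lambda>_. f)"
  by (simp add: poly_coeffs_fun_def polynomial_fun.const)

lemma poly_coeffs_fun_mult:
  "poly_coeffs_fun K F \<Longrightarrow> poly_coeffs_fun K G \<Longrightarrow> poly_coeffs_fun K (\<lambda>a. F a * G a)"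
  unfolding poly_coeffs_fun_def coeff_mult by (intro allI polynomial_fun_sum polynomial_fun.mult) auto

lemma poly_coeffs_fun_prod:
  "(\<And>i. i \<in> A \<Longrightarrow> poly_coeffs_fun K (F i)) \<Longrightarrow> poly_coeffs_fun K (\<lambda>a. \<Prod>i\<in>A. F i a)"
  by (induction A rule: infinite_finite_induct) (auto intro: poly_coeffs_fun_const poly_coeffs_fun_mult)

lemma poly_coeffs_fun_sum:
  "(\<And>i. i \<in> A \<Longrightarrow> poly_coeffs_fun K (F i)) \<Longrightarrow> poly_coeffs_fun K (\<lambda>a. \<Sum>i\<in>A. F i a)"
  unfolding poly_coeffs_fun_def coeff_sum by (intro allI polynomial_fun_sum) auto

lemma poly_coeffs_fun_smult:
  "polynomial_fun K c \<Longrightarrow> poly_coeffs_fun K F \<Longrightarrow> poly_coeffs_fun K (\<lambda>a. smult (c a) (F a))"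
  unfolding poly_coeffs_fun_def coeff_smult by (auto intro: polynomial_fun.mult)

lemma poly_coeffs_fun_uminus: "poly_coeffs_fun K F \<Longrightarrow> poly_coeffs_fun K (\<lambda>a. - F a)"
  unfolding poly_coeffs_fun_def coeff_minus by (auto intro: polynomial_fun_uminus)

lemma poly_coeffs_fun_linear:
  assumes "polynomial_fun K c"
  shows "poly_coeffs_fun K (\<lambda>a. [:c a, 1:])"
  unfolding poly_coeffs_fun_def
proof
  show "polynomial_fun K (\<lambda>a. coeff [:c a, 1:] n)" for n
    by (cases n) (simp_all add: assms polynomial_fun.const)
qed

lemma poly_coeffs_fun_basis:
  assumes "l \<in> I"
  shows "poly_coeffs_fun (I \<times> UNIV) (\<lambda>a. basis_sec m I a l $ j)"
proof -
  have "poly_coeffs_fun (I \<times> UNIV) (\<lambda>a. lin_prod (I - {l}) a j)"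
    unfolding lin_prod_def
    by (intro poly_coeffs_fun_prod poly_coeffs_fun_linear polynomial_fun_intros) auto
  then show ?thesis
    unfolding basis_sec_def using assms
    by (cases "l \<le> m")
       (auto intro!: poly_coeffs_fun_smult poly_coeffs_fun_uminus poly_coeffs_fun_mult poly_coeffs_fun_const polynomial_fun_intros
         simp del: mult_pCons_left)
qed

lemma polynomial_fun_pt_denom:
  "P \<in> pts I \<Longrightarrow> polynomial_fun (I \<times> UNIV) (\<lambda>a. pt_denom I a j P)"
  by (cases P) (auto simp: pts_def pt_denom_def intro!: polynomial_fun_intros)

lemma polynomial_fun_pt_eval:
  "P \<in> pts I \<Longrightarrow> polynomial_fun (I \<times> UNIV) (\<lambda>a. pt_eval a d j P (monom 1 e))"
  by (cases P) (auto simp: pts_def pt_eval_def poly_monom intro!: polynomial_fun_intros)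

text \<open>
  Cochains with values in pairs of polynomials are encoded by vectors of coefficients; the three
  components of an index are the list, the component of the curve and the exponent.
\<close>

type_synonym cochain_index = "nat list \<times> 2 \<times> nat"

definition cochain_of :: "nat set \<Rightarrow> nat \<Rightarrow> nat \<Rightarrow> (cochain_index \<Rightarrow> complex) \<Rightarrow> nat list \<Rightarrow> sec" where
  "cochain_of I p d z K =
     (if K \<in> index_lists I p then (\<chi> j. \<Sum>e\<le>d. monom (z (K, j, e)) e) else 0)"

definition swap_form :: "nat list \<Rightarrow> nat \<Rightarrow> nat \<Rightarrow> nat list \<Rightarrow> 2 \<Rightarrow> nat \<Rightarrow>
    (nat \<times> 2 \<Rightarrow> complex) \<Rightarrow> (cochain_index \<Rightarrow> complex) \<Rightarrow> complex" where
  "swap_form xs i j ys k e a z = z (xs @ i # j # ys, k, e) + z (xs @ j # i # ys, k, e)"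

definition cycle_form :: "nat \<Rightarrow> nat set \<Rightarrow> nat list \<Rightarrow> 2 \<Rightarrow> nat \<Rightarrow>
    (nat \<times> 2 \<Rightarrow> complex) \<Rightarrow> (cochain_index \<Rightarrow> complex) \<Rightarrow> complex" where
  "cycle_form m I K j e a z = (\<Sum>i\<in>I. \<Sum>e'\<le>2 * card I.
     coeff (monom 1 e' * basis_sec m I a i $ j) e * z (i # K, j, e'))"

definition gluing_form :: "nat set \<Rightarrow> nat list \<Rightarrow> pt \<Rightarrow>
    (nat \<times> 2 \<Rightarrow> complex) \<Rightarrow> (cochain_index \<Rightarrow> complex) \<Rightarrow> complex" where
  "gluing_form I K P a z =
     pt_denom I a 2 P ^ 2 * (\<Sum>e\<le>2 * card I. pt_eval a (2 * card I) 1 P (monom 1 e) * z (K, 1, e))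
     + (- (pt_denom I a 1 P ^ 2)) * (\<Sum>e\<le>2 * card I. pt_eval a (2 * card I) 2 P (monom 1 e) * z (K, 2, e))"

text \<open>
  The linear equations for cycles: antisymmetry, vanishing of the differential, and gluing at the nodes. The
  gluing equations are multiplied by the denominator of the square of the gluing factor, in which the sign of
  the torsion bundle disappears.
\<close>

definition cycle_forms :: "nat \<Rightarrow> nat set \<Rightarrow> nat \<Rightarrow>
    ((nat \<times> 2 \<Rightarrow> complex) \<Rightarrow> (cochain_index \<Rightarrow> complex) \<Rightarrow> complex) set" where
  "cycle_forms m I p =
     {swap_form xs i j ys k e | xs i j ys k e. xs @ i # j # ys \<in> index_lists I p \<and> e \<le> 2 * card I}
     \<union> {cycle_form m I K j e | K j e q. p = Suc q \<and> K \<in> index_lists I q}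
     \<union> {gluing_form I K P | K P. K \<in> index_lists I p \<and> P \<in> pts I}"

definition cochain_indices :: "nat set \<Rightarrow> nat \<Rightarrow> cochain_index set" where
  "cochain_indices I p = index_lists I p \<times> UNIV \<times> {..2 * card I}"

lemma cycle_forms_polynomial:
  assumes fin: "finite I" and \<Phi>: "\<Phi> \<in> cycle_forms m I p"
  shows "polynomial_form (I \<times> UNIV) (cochain_indices I p) \<Phi>"
proof -
  have finY: "finite (cochain_indices I p)"
    using fin by (simp add: cochain_indices_def finite_index_lists)
  consider (swap) xs i j ys k e where "\<Phi> = swap_form xs i j ys k e" "xs @ i # j # ys \<in> index_lists I p" "e \<le> 2 * card I"
    | (cycle) K j e q where "\<Phi> = cycle_form m I K j e" "p = Suc q" "K \<in> index_lists I q"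
    | (node) K P where "\<Phi> = gluing_form I K P" "K \<in> index_lists I p" "P \<in> pts I"
    using \<Phi> unfolding cycle_forms_def by blast
  then show ?thesis
  proof cases
    case swap
    show ?thesis unfolding swap(1) swap_form_def[abs_def]
      by (intro polynomial_form_add polynomial_form_coord finY)
         (use swap in \<open>auto simp: cochain_indices_def index_lists_def\<close>)
  next
    case cycle
    have "polynomial_fun (I \<times> UNIV) (\<lambda>a. coeff (monom 1 e' * basis_sec m I a i $ j) e)" if "i \<in> I" for i e'
      using poly_coeffs_fun_mult[OF poly_coeffs_fun_const poly_coeffs_fun_basis[OF that]]
      unfolding poly_coeffs_fun_def by blast
    then show ?thesis unfolding cycle(1) cycle_form_def[abs_def]
      by (intro polynomial_form_sum polynomial_form_mult polynomial_form_coord finY)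
         (use cycle in \<open>auto simp: cochain_indices_def index_lists_def\<close>)
  next
    case node
    show ?thesis unfolding node(1) gluing_form_def[abs_def]
      by (intro polynomial_form_add polynomial_form_mult polynomial_form_sum polynomial_form_coord finY
          polynomial_fun_power polynomial_fun_uminus polynomial_fun_pt_denom polynomial_fun_pt_eval)
         (use node in \<open>auto simp: cochain_indices_def\<close>)
  qed
qed

lemma pt_glue_square: "pt_glue m I a P ^ 2 = (pt_denom I a 1 P / pt_denom I a 2 P) ^ 2"
  by (auto simp: pt_glue_def pt_sign_def power_mult_distrib split: pt.splits)

lemma coeff_cochain_of:
  "K \<in> index_lists I p \<Longrightarrow> coeff (cochain_of I p d z K $ j) e = (if e \<le> d then z (K, j, e) else 0)"
  by (auto simp: cochain_of_def coeff_sum)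

lemma cochain_of_coeff:
  assumes "Z \<in> cochains I p (secs_le d)"
  shows "cochain_of I p d (\<lambda>(K, j, e). coeff (Z K $ j) e) = Z"
proof
  fix K
  show "cochain_of I p d (\<lambda>(K, j, e). coeff (Z K $ j) e) K = Z K"
  proof (cases "K \<in> index_lists I p")
    case True
    have "coeff (Z K $ j) e = 0" if "\<not> e \<le> d" for j e
      using cochainsD(2)[OF assms, of K] that by (intro coeff_eq_0) (auto simp: secs_le_def not_le intro: le_less_trans)
    then show ?thesis
      by (auto simp: vec_eq_iff poly_eq_iff coeff_cochain_of[OF True])
  next
    case False
    then have "Z K = 0" using cochainsD(3,4)[OF assms, of K] by (auto simp: index_lists_def)
    then show ?thesis using False by (simp add: cochain_of_def)
  qed
qed

lemma cycle_forms_vanish_iff: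
  assumes good: "distinct_nodes I a"
  shows "(\<forall>\<Phi>\<in>cycle_forms m I p. \<Phi> a z = 0) \<longleftrightarrow>
    cochain_of I p (2 * card I) z \<in> cochains I p (sec_ring m I a 2) \<and>
    (\<forall>K. contract I (basis_sec m I a) (cochain_of I p (2 * card I) z) K = 0)"
proof -
  let ?Z = "cochain_of I p (2 * card I) z" and ?L = "index_lists I p"
  let ?A = "\<forall>xs i j ys k e. xs @ i # j # ys \<in> ?L \<and> e \<le> 2 * card I \<longrightarrow> swap_form xs i j ys k e a z = 0"
  let ?B = "\<forall>K j e q. p = Suc q \<and> K \<in> index_lists I q \<longrightarrow> cycle_form m I K j e a z = 0"
  let ?C = "\<forall>K P. K \<in> ?L \<and> P \<in> pts I \<longrightarrow> gluing_form I K P a z = 0"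
  have split: "(\<forall>\<Phi>\<in>cycle_forms m I p. \<Phi> a z = 0) \<longleftrightarrow> ?A \<and> ?B \<and> ?C"
    unfolding cycle_forms_def by blast
  have L_swap: "xs @ i # j # ys \<in> ?L \<longleftrightarrow> xs @ j # i # ys \<in> ?L" for xs i j ys
    by (auto simp: index_lists_def)
  have A: "?A \<longleftrightarrow> alternating ?Z"
  proof
    assume A: ?A
    show "alternating ?Z"
      unfolding alternating_def
    proof (intro allI)
      fix xs i j ys
      show "?Z (xs @ i # j # ys) = - ?Z (xs @ j # i # ys)"
      proof (cases "xs @ i # j # ys \<in> ?L")
        case True
        have "z (xs @ i # j # ys, k, e) = - z (xs @ j # i # ys, k, e)" if "e \<le> 2 * card I" for k e
          using A True that unfolding swap_form_def by (metis eq_neg_iff_add_eq_0)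
        then show ?thesis
          using True L_swap[of xs i j ys] by (auto simp: vec_eq_iff poly_eq_iff coeff_cochain_of)
      next
        case False
        then show ?thesis using L_swap[of xs i j ys] by (simp add: cochain_of_def)
      qed
    qed
  next
    assume alt: "alternating ?Z"
    show ?A
    proof (intro allI impI)
      fix xs i j ys and k :: 2 and e assume *: "xs @ i # j # ys \<in> ?L \<and> e \<le> 2 * card I"
      have "coeff (?Z (xs @ i # j # ys) $ k) e = - coeff (?Z (xs @ j # i # ys) $ k) e"
        by (subst alternatingD[OF alt]) simp
      then show "swap_form xs i j ys k e a z = 0"
        using * L_swap[of xs i j ys] by (simp add: coeff_cochain_of swap_form_def)
    qed
  qed
  have sup: "?Z K \<noteq> 0 \<Longrightarrow> length K = p" "?Z K \<noteq> 0 \<Longrightarrow> set K \<subseteq> I" for K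
    by (auto simp: cochain_of_def index_lists_def split: if_splits)
  have deg: "?Z K \<in> secs_le (2 * card I)" for K
    by (auto simp: cochain_of_def secs_le_def degree_monom_le[THEN order_trans] intro!: degree_sum_le)
  have nodeF: "gluing_form I K P a z = pt_denom I a 2 P ^ 2 * pt_eval a (2 * card I) 1 P (?Z K $ 1)
      - pt_denom I a 1 P ^ 2 * pt_eval a (2 * card I) 2 P (?Z K $ 2)" if "K \<in> ?L" for K P
  proof -
    have "pt_eval a (2 * card I) j P (?Z K $ j) = (\<Sum>e\<le>2 * card I. pt_eval a (2 * card I) j P (monom 1 e) * z (K, j, e))" for j
    proof -
      have "monom (z (K, j, e)) e = smult (z (K, j, e)) (monom 1 e)" for e by (simp add: smult_monom)
      then show ?thesis using that by (simp add: cochain_of_def pt_eval_sum pt_eval_smult mult.commute)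
    qed
    then show ?thesis by (simp add: gluing_form_def)
  qed
  have C: "?C \<longleftrightarrow> (\<forall>K. ?Z K \<in> sec_ring m I a 2)"
  proof -
    have "gluing_form I K P a z = 0 \<longleftrightarrow> pt_eval a (2 * card I) 1 P (?Z K $ 1)
        = pt_glue m I a P ^ 2 * pt_eval a (2 * card I) 2 P (?Z K $ 2)" if "K \<in> ?L" "P \<in> pts I" for K P
      unfolding nodeF[OF that(1)] pt_glue_square
      using pt_denom_nonzero[OF good that(2), of 1] pt_denom_nonzero[OF good that(2), of 2]
      by (simp add: power_divide field_simps)
    then have "?C \<longleftrightarrow> (\<forall>K\<in>?L. ?Z K \<in> sec_ring m I a 2)"
      using deg by (auto simp: sec_ring_def)
    moreover have "?Z K \<in> sec_ring m I a 2" if "K \<notin> ?L" for K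
      using that sec_subspaceD(3)[OF sec_ring_subspace] by (simp add: cochain_of_def)
    ultimately show ?thesis by blast
  qed
  have cycF: "cycle_form m I K j e a z = coeff (contract I (basis_sec m I a) ?Z K $ j) e"
    if K: "p = Suc q" "K \<in> index_lists I q" for K j e q
  proof -
    have "basis_sec m I a i $ j * ?Z (i # K) $ j
        = (\<Sum>e'\<le>2 * card I. smult (z (i # K, j, e')) (monom 1 e' * basis_sec m I a i $ j))" if "i \<in> I" for i
    proof -
      have "i # K \<in> ?L" using K that by (auto simp: index_lists_def)
      then have "basis_sec m I a i $ j * ?Z (i # K) $ j
          = (\<Sum>e'\<le>2 * card I. basis_sec m I a i $ j * monom (z (i # K, j, e')) e')"
        by (simp add: cochain_of_def sum_distrib_left)
      also have "\<dots> = (\<Sum>e'\<le>2 * card I. smult (z (i # K, j, e')) (monom 1 e' * basis_sec m I a i $ j))"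
        by (intro sum.cong refl) (metis mult.commute mult.right_neutral mult_smult_left smult_monom)
      finally show ?thesis .
    qed
    then have "contract I (basis_sec m I a) ?Z K $ j
        = (\<Sum>i\<in>I. \<Sum>e'\<le>2 * card I. smult (z (i # K, j, e')) (monom 1 e' * basis_sec m I a i $ j))"
      by (simp add: contract_def)
    then show ?thesis
      unfolding cycle_form_def by (simp add: coeff_sum mult.commute[of "z _"])
  qed
  have B: "?B \<longleftrightarrow> (\<forall>K. contract I (basis_sec m I a) ?Z K = 0)"
  proof
    assume B: ?B
    show "\<forall>K. contract I (basis_sec m I a) ?Z K = 0"
    proof
      fix K
      show "contract I (basis_sec m I a) ?Z K = 0"
      proof (cases "\<exists>q. p = Suc q \<and> K \<in> index_lists I q")
        case True
        then obtain q where "p = Suc q" "K \<in> index_lists I q" by blast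
        then show ?thesis using B cycF by (auto simp: vec_eq_iff poly_eq_iff)
      next
        case False
        have "?Z (i # K) = 0" for i
          using sup[of "i # K"] False by (auto simp: index_lists_def)
        then show ?thesis by (simp add: contract_def)
      qed
    qed
  qed (use cycF in auto)
  show ?thesis
    unfolding split A B C cochains_def using sup by blast
qed

text \<open>
  Cycles are the solutions of the equations above and boundaries are spanned by the differentials of the products
  of minors with basis sections. All coefficients are polynomial in the parameters.
\<close>

theorem koszul_exact_open:
  assumes good: "distinct_nodes I a0" and ex: "koszul_exact I (basis_sec m I a0) p (sec_ring m I a0 1) (sec_ring m I a0 2)"
  shows "\<exists>f. polynomial_fun (I \<times> UNIV) f \<and> f a0 \<noteq> 0 \<and>
    (\<forall>a. distinct_nodes I a \<and> f a \<noteq> 0 \<longrightarrow> koszul_exact I (basis_sec m I a) p (sec_ring m I a 1) (sec_ring m I a 2))"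
proof -
  note fin = distinct_nodesD(1)[OF good]
  let ?X = "index_lists I (Suc p) \<times> I" and ?Y = "cochain_indices I p"
  define C where "C a = (\<lambda>(J, i). contract I (basis_sec m I a) (\<lambda>K. sconst (minor J K) * basis_sec m I a i))" for a
  define A where "A x y a = (case y of (K, j, e) \<Rightarrow> coeff (C a x K $ j) e)" for x y a
  have W: "sec_ring m I a 2 \<subseteq> secs_le (2 * card I)" for a by (auto simp: sec_ring_def)
  have gen: "(\<lambda>K. sconst (minor J K) * basis_sec m I a i) \<in> cochains I (Suc p) (sec_ring m I a 1)"
    if "distinct_nodes I a" "(J, i) \<in> ?X" for a J i
    using that by (intro koszul_basis.minor_cochains[OF koszul_basis_sec_ring[OF that(1)]] sec_ring_subspace basis_sec_in) auto
  have C: "C a x \<in> cochains I p (sec_ring m I a 2)" "\<And>K. contract I (basis_sec m I a) (C a x) K = 0"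
    if a: "distinct_nodes I a" and x: "x \<in> ?X" for a x
  proof -
    obtain J i where J: "x = (J, i)" by fastforce
    note g = gen[OF a x[unfolded J]]
    show "C a x \<in> cochains I p (sec_ring m I a 2)"
      unfolding C_def J prod.case
      by (rule contract_cochains[OF g])
         (use sec_ring_subspace sec_ring_mult[of _ m I a 1 _ 1] basis_sec_in[OF a] in \<open>auto simp: sec_subspaceD numeral_2_eq_2\<close>)
    show "\<And>K. contract I (basis_sec m I a) (C a x) K = 0"
      unfolding C_def J prod.case by (rule contract_contract[OF cochainsD(1)[OF g]])
  qed
  have C_sum: "contract I (basis_sec m I a) (\<lambda>K. \<Sum>x\<in>?X. sconst (c x) * (case x of (J, i) \<Rightarrow> sconst (minor J K) * basis_sec m I a i)) K
      = (\<Sum>x\<in>?X. sconst (c x) * C a x K)" for a c K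
    unfolding contract_sum contract_mult by (intro sum.cong refl) (auto simp: C_def)
  have coeff_C_sum: "coeff ((\<Sum>x\<in>?X. sconst (c x) * C a x K) $ j) e = (\<Sum>x\<in>?X. c x * A x (K, j, e) a)" for c a K j e
    by (simp add: coeff_sum A_def)
  have finX: "finite ?X" "finite ?Y"
    using fin by (simp_all add: cochain_indices_def finite_index_lists)
  have "\<exists>f. polynomial_fun (I \<times> UNIV) f \<and> f a0 \<noteq> 0 \<and>
    (\<forall>a. f a \<noteq> 0 \<and> (\<forall>x\<in>?X. \<forall>\<Phi>\<in>cycle_forms m I p. \<Phi> a (\<lambda>y. A x y a) = 0) \<longrightarrow>
      (\<forall>z. (\<forall>\<Phi>\<in>cycle_forms m I p. \<Phi> a z = 0) \<longrightarrow> (\<exists>c. \<forall>y\<in>?Y. z y = (\<Sum>x\<in>?X. c x * A x y a))))"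
  proof (rule exactness_open_forms[OF finX(2,1) _ cycle_forms_polynomial[OF fin]])
    show "polynomial_fun (I \<times> UNIV) (A x y)" if x: "x \<in> ?X" and y: "y \<in> ?Y" for x y
    proof -
      obtain J i K j e where xy: "x = (J, i)" "y = (K, j, e)" by (metis prod.exhaust)
      have "poly_coeffs_fun (I \<times> UNIV) (\<lambda>a. \<Sum>k\<in>I. basis_sec m I a k $ j * ([:minor J (k # K):] * basis_sec m I a i $ j))"
        by (intro poly_coeffs_fun_sum poly_coeffs_fun_mult poly_coeffs_fun_const poly_coeffs_fun_basis) (use x xy in auto)
      then show ?thesis
        by (simp add: A_def[abs_def] C_def xy contract_def poly_coeffs_fun_def)
    qed
    fix z assume z: "\<forall>\<Phi>\<in>cycle_forms m I p. \<Phi> a0 z = 0"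
    let ?Z = "cochain_of I p (2 * card I) z"
    from z obtain Y where Y: "Y \<in> cochains I (Suc p) (sec_ring m I a0 1)" and dY: "\<And>K. contract I (basis_sec m I a0) Y K = ?Z K"
      unfolding cycle_forms_vanish_iff[OF good] using koszul_exactD[OF ex] by metis
    define c where "c = (\<lambda>(J, i). basis_coord m I a0 i (Y J) / fact (Suc p))"
    have Y_eq: "Y = (\<lambda>K. \<Sum>x\<in>?X. sconst (c x) * (case x of (J, i) \<Rightarrow> sconst (minor J K) * basis_sec m I a0 i))"
      by (rule ext, rule trans[OF koszul_basis.cochain_expansion[OF koszul_basis_sec_ring[OF good] Y]])
         (simp add: c_def split_def)
    have Z: "?Z K = (\<Sum>x\<in>?X. sconst (c x) * C a0 x K)" for K
      unfolding dY[symmetric] by (subst Y_eq) (rule C_sum)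
    have "z y = (\<Sum>x\<in>?X. c x * A x y a0)" if "y \<in> ?Y" for y
    proof -
      obtain K j e where y: "y = (K, j, e)" by (metis prod.exhaust)
      then have "K \<in> index_lists I p" "e \<le> 2 * card I" using that by (auto simp: cochain_indices_def)
      then have "z y = coeff (?Z K $ j) e" by (simp add: coeff_cochain_of y)
      then show ?thesis unfolding Z coeff_C_sum y .
    qed
    then show "\<exists>c. \<forall>y\<in>?Y. z y = (\<Sum>x\<in>?X. c x * A x y a0)" by blast
  qed
  then obtain f where f: "polynomial_fun (I \<times> UNIV) f" "f a0 \<noteq> 0"
    and fex: "\<forall>a. f a \<noteq> 0 \<and> (\<forall>x\<in>?X. \<forall>\<Phi>\<in>cycle_forms m I p. \<Phi> a (\<lambda>y. A x y a) = 0) \<longrightarrow>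
      (\<forall>z. (\<forall>\<Phi>\<in>cycle_forms m I p. \<Phi> a z = 0) \<longrightarrow> (\<exists>c. \<forall>y\<in>?Y. z y = (\<Sum>x\<in>?X. c x * A x y a)))"
    by (elim exE conjE)
  have "koszul_exact I (basis_sec m I a) p (sec_ring m I a 1) (sec_ring m I a 2)" if a: "distinct_nodes I a" "f a \<noteq> 0" for a
  proof (rule koszul_exactI)
    have forms: "\<forall>\<Phi>\<in>cycle_forms m I p. \<Phi> a (\<lambda>(K, j, e). coeff (Z K $ j) e) = 0"
      if "Z \<in> cochains I p (sec_ring m I a 2)" "\<And>K. contract I (basis_sec m I a) Z K = 0" for Z
      unfolding cycle_forms_vanish_iff[OF a(1)] cochain_of_coeff[OF cochains_mono[OF that(1) order_refl W]]
      using that by simp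
    fix Z assume Z: "Z \<in> cochains I p (sec_ring m I a 2)" and cyc: "\<And>xs. contract I (basis_sec m I a) Z xs = 0"
    have "\<forall>x\<in>?X. \<forall>\<Phi>\<in>cycle_forms m I p. \<Phi> a (\<lambda>y. A x y a) = 0"
      unfolding A_def using forms[OF C[OF a(1)]] by (simp add: split_def)
    with a(2) have "f a \<noteq> 0 \<and> (\<forall>x\<in>?X. \<forall>\<Phi>\<in>cycle_forms m I p. \<Phi> a (\<lambda>y. A x y a) = 0)" by (rule conjI)
    from fex[THEN spec[of _ a], THEN mp, OF this, THEN spec, THEN mp, OF forms[OF Z cyc]] obtain c
      where c: "\<And>K j e. (K, j, e) \<in> ?Y \<Longrightarrow> coeff (Z K $ j) e = (\<Sum>x\<in>?X. c x * A x (K, j, e) a)" by fastforce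
    define Y where "Y = (\<lambda>K. \<Sum>x\<in>?X. sconst (c x) * (case x of (J, i) \<Rightarrow> sconst (minor J K) * basis_sec m I a i))"
    have "Y \<in> cochains I (Suc p) (sec_ring m I a 1)"
      unfolding Y_def
    proof (rule cochains_sum[OF sec_subspaceD(1)[OF sec_ring_subspace]])
      fix x assume x: "x \<in> ?X"
      obtain J i where J: "x = (J, i)" by fastforce
      show "(\<lambda>K. sconst (c x) * (case x of (J, i) \<Rightarrow> sconst (minor J K) * basis_sec m I a i)) \<in> cochains I (Suc p) (sec_ring m I a 1)"
        unfolding J prod.case
        by (rule cochains_map[OF gen[OF a(1) x[unfolded J]], of "\<lambda>s. sconst (c (J, i)) * s"])
           (use sec_subspaceD(2)[OF sec_ring_subspace] in auto)
    qed
    moreover have "contract I (basis_sec m I a) Y K = Z K" for K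
    proof -
      have dY: "contract I (basis_sec m I a) Y K = (\<Sum>x\<in>?X. sconst (c x) * C a x K)" unfolding Y_def by (rule C_sum)
      have sum_in: "(\<Sum>x\<in>?X. sconst (c x) * C a x K) \<in> secs_le (2 * card I)"
        by (intro add_closed_sum sec_subspaceD(1,2)[OF secs_le_subspace] subsetD[OF W[of a]] cochainsD(2)[OF C(1)[OF a(1)]])
      show ?thesis
      proof (cases "K \<in> index_lists I p")
        case True
        have "coeff (contract I (basis_sec m I a) Y K $ j) e = coeff (Z K $ j) e" for j e
        proof (cases "e \<le> 2 * card I")
          case le: True
          then show ?thesis unfolding dY coeff_C_sum using True by (simp add: c cochain_indices_def)
        next
          case False
          have "degree ((\<Sum>x\<in>?X. sconst (c x) * C a x K) $ j) < e" "degree (Z K $ j) < e"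
            using False sum_in subsetD[OF W cochainsD(2)[OF Z, of K]] by (auto simp: secs_le_def not_le intro: le_less_trans simp del: sum_component)
          then show ?thesis unfolding dY by (simp only: coeff_eq_0)
        qed
        then show ?thesis by (simp add: vec_eq_iff poly_eq_iff)
      next
        case False
        then have "Z K = 0" using cochainsD(3,4)[OF Z, of K] by (auto simp: index_lists_def)
        moreover have "C a x K = 0" if "x \<in> ?X" for x
          using False cochainsD(3,4)[OF C(1)[OF a(1) that], of K] by (auto simp: index_lists_def)
        ultimately show ?thesis unfolding dY by simp
      qed
    qed
    ultimately show "\<exists>Y\<in>cochains I (Suc p) (sec_ring m I a 1). \<forall>xs. contract I (basis_sec m I a) Y xs = Z xs" by blast
  qed
  then show ?thesis using f by blast
qed

section \<open>Prym-canonical binary curves\<close>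

lemma form_eval_affine:
  assumes "degree f \<le> d"
  shows "form_eval (int d) f (t, 1) = poly f t"
proof -
  have "poly f t = (\<Sum>i\<le>d. coeff f i * t ^ i)"
    unfolding poly_altdef by (rule sum.mono_neutral_left) (use assms in \<open>auto simp: coeff_eq_0\<close>)
  then show ?thesis by (simp add: form_eval_def)
qed

lemma form_eval_infinity: "form_eval (int d) f (1, 0) = coeff f d"
proof -
  have "form_eval (int d) f (1, 0) = (\<Sum>i\<le>d. if i = d then coeff f d else 0)"
    unfolding form_eval_def by (intro sum.cong) auto
  then show ?thesis by simp
qed

definition pt_of :: "nat \<Rightarrow> nat \<Rightarrow> pt" where
  "pt_of g l = (if l \<le> g - 1 then Fin l else if l = g then Zero else Inf)"

lemma pt_of_image: "g \<ge> 2 \<Longrightarrow> pt_of g ` {1..g + 1} = pts {1..g - 1}"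
proof -
  assume g: "g \<ge> 2"
  have split: "{1..g + 1} = {1..g - 1} \<union> {g, g + 1}" using g by auto
  have "pt_of g ` {1..g - 1} = Fin ` {1..g - 1}" by (intro image_cong) (auto simp: pt_of_def)
  moreover have "pt_of g ` {g, g + 1} = {Zero, Inf}" using g by (auto simp: pt_of_def)
  ultimately show ?thesis unfolding split pts_def image_Un by (simp only:)
qed

lemma form_eval_node:
  assumes "degree f \<le> d"
  shows "form_eval (int d) f (node (prym_curve g a) l j) = pt_eval a d j (pt_of g l) f"
  using form_eval_affine[OF assms] form_eval_infinity[of d f]
  by (simp add: prym_curve_def pt_of_def pt_eval_def)

text \<open>
  Each parameter node contributes one more factor to the residue denominator of every other node, and the nodes at
  \<open>0\<close> and infinity contribute \<open>a\<^sub>l\<^sub>,\<^sub>j\<close> and \<open>-1\<close> to that of the parameter node \<open>l\<close>.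
\<close>

lemma prym_glue:
  assumes g: "g \<ge> 2" and l: "l \<in> {1..g + 1}"
  shows "glue (prym_canonical_bundle g a) l = pt_glue (g div 2) {1..g - 1} a (pt_of g l)"
proof -
  let ?X = "prym_curve g a" and ?I = "{1..g - 1}"
  have nodes: "node ?X g j = (0, 1)" "node ?X (Suc g) j = (1, 0)" for j
    using g by (auto simp: prym_curve_def)
  have param: "node ?X r j = (a (r, j), 1)" if "r \<in> ?I" for r j
    using that by (auto simp: prym_curve_def)
  have cr: "(\<Prod>r\<in>A. cross v (node ?X r j)) = (\<Prod>r\<in>A. cross v (a (r, j), 1))" if "A \<subseteq> ?I" for A v j
    by (intro prod.cong) (use that param in auto)
  have pt: "pt_of g g = Zero" "pt_of g (Suc g) = Inf" using g by (auto simp: pt_of_def)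
  have genus: "genus ?X = g" by (simp add: prym_curve_def)
  have g_out: "g \<notin> ?I" "Suc g \<notin> ?I" "g \<noteq> Suc g" using g by auto
  have denom: "res_denom ?X l j = (if l = g then -1 else 1) * pt_denom ?I a j (pt_of g l)" for j
  proof -
    consider "l \<in> ?I" | "l = g" | "l = Suc g" using l by fastforce
    then show ?thesis
    proof cases
      case 1
      then have "{1..g + 1} - {l} = insert g (insert (Suc g) (?I - {l}))" "l \<noteq> g" using g by auto
      then have denom: "res_denom ?X l j = cross (node ?X l j) (node ?X g j) * (cross (node ?X l j) (node ?X (Suc g) j)
          * (\<Prod>r\<in>?I - {l}. cross (node ?X l j) (node ?X r j)))"
        using g_out by (simp add: res_denom_def genus del: One_nat_def)
      have "pt_of g l = Fin l" using 1 by (simp add: pt_of_def)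
      then show ?thesis
        using \<open>l \<noteq> g\<close> unfolding denom cr[OF Diff_subset] by (simp add: nodes param[OF 1] cross_def pt_denom_def)
    next
      case 2
      then have "{1..g + 1} - {l} = insert (Suc g) ?I" using g by auto
      then have denom: "res_denom ?X l j = cross (node ?X g j) (node ?X (Suc g) j) * (\<Prod>r\<in>?I. cross (node ?X g j) (node ?X r j))"
        using g_out by (simp add: res_denom_def genus 2 del: One_nat_def)
      show ?thesis
        using 2 unfolding denom cr[OF order_refl] by (simp add: nodes pt cross_def pt_denom_def)
    next
      case 3
      then have "{1..g + 1} - {l} = insert g ?I" using g by auto
      then have denom: "res_denom ?X l j = cross (node ?X (Suc g) j) (node ?X g j) * (\<Prod>r\<in>?I. cross (node ?X (Suc g) j) (node ?X r j))"
        using g_out by (simp add: res_denom_def genus 3 del: One_nat_def)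
      show ?thesis
        using 3 unfolding denom cr[OF order_refl] by (simp add: nodes pt cross_def pt_denom_def)
    qed
  qed
  have "(if l \<in> {g div 2 + 1..g} then -1 else 1) = pt_sign (g div 2) (pt_of g l)"
    using l g by (auto simp: pt_of_def pt_sign_def)
  then show ?thesis
    by (simp add: prym_canonical_bundle_def tensor_def dualizing_def prym_torsion_def pt_glue_def denom)
qed

lemma prym_sections:
  assumes g: "g \<ge> 2"
  shows "sections (prym_curve g a) (tensor_power (prym_canonical_bundle g a) (int q))
    = sec_ring (g div 2) {1..g - 1} a q" (is "sections ?X ?L = _")
proof -
  have deg: "deg ?L j = int (q * (g - 1))" for j
    using g by (simp add: tensor_power_def prym_canonical_bundle_def tensor_def dualizing_def prym_torsion_def
        prym_curve_def of_nat_diff)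
  have forms: "f \<in> forms (int d) \<longleftrightarrow> degree f \<le> d" for f d by (auto simp: forms_def)
  have glue: "glue ?L l = pt_glue (g div 2) {1..g - 1} a (pt_of g l) ^ q" if "l \<in> {1..g + 1}" for l
    using prym_glue[OF g that] by (simp add: tensor_power_def)
  have "s \<in> sections ?X ?L \<longleftrightarrow> s \<in> secs_le (q * (g - 1)) \<and> (\<forall>l\<in>{1..g + 1}.
      pt_eval a (q * (g - 1)) 1 (pt_of g l) (s $ 1)
      = pt_glue (g div 2) {1..g - 1} a (pt_of g l) ^ q * pt_eval a (q * (g - 1)) 2 (pt_of g l) (s $ 2))" for s
  proof -
    have "genus ?X = g" by (simp add: prym_curve_def)
    then have "s \<in> sections ?X ?L \<longleftrightarrow> (\<forall>j. degree (s $ j) \<le> q * (g - 1)) \<and>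
        (\<forall>l\<in>{1..g + 1}. form_eval (int (q * (g - 1))) (s $ 1) (node ?X l 1)
           = glue ?L l * form_eval (int (q * (g - 1))) (s $ 2) (node ?X l 2))"
      by (simp only: sections_def deg forms mem_Collect_eq)
    also have "\<dots> \<longleftrightarrow> (\<forall>j. degree (s $ j) \<le> q * (g - 1)) \<and> (\<forall>l\<in>{1..g + 1}.
      pt_eval a (q * (g - 1)) 1 (pt_of g l) (s $ 1)
      = pt_glue (g div 2) {1..g - 1} a (pt_of g l) ^ q * pt_eval a (q * (g - 1)) 2 (pt_of g l) (s $ 2))"
      by (rule conj_cong[OF refl], rule ball_cong[OF refl]) (simp only: form_eval_node glue)
    finally show ?thesis by (simp only: secs_le_def mem_Collect_eq)
  qed
  moreover have "card {1..g - 1} = g - 1" by simp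
  ultimately show ?thesis
    by (simp only: sec_ring_def pt_of_image[OF g, symmetric] ball_simps set_eq_iff mem_Collect_eq) simp
qed

lemma prym_sections_1:
  assumes g: "g \<ge> 2"
  shows "sections (prym_curve g a) (prym_canonical_bundle g a) = sec_ring (g div 2) {1..g - 1} a 1"
proof -
  have "tensor_power (prym_canonical_bundle g a) (int 1) = prym_canonical_bundle g a"
    by (simp add: tensor_power_def)
  then show ?thesis using prym_sections[OF g, of a 1] by simp
qed

lemma koszul_vanishes_iff:
  assumes g: "g \<ge> 2" and good: "distinct_nodes {1..g - 1} a"
  shows "koszul_vanishes (prym_curve g a) (prym_canonical_bundle g a) p 2 \<longleftrightarrow>
    koszul_exact {1..g - 1} (basis_sec (g div 2) {1..g - 1} a) p
      (sec_ring (g div 2) {1..g - 1} a 1) (sec_ring (g div 2) {1..g - 1} a 2)"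
proof -
  let ?R = "sec_ring (g div 2) {1..g - 1} a"
  interpret koszul_basis "{1..g - 1}" "basis_sec (g div 2) {1..g - 1} a" "basis_coord (g div 2) {1..g - 1} a" "?R 1"
    by (rule koszul_basis_sec_ring[OF good])
  have R: "sections (prym_curve g a) (tensor_power (prym_canonical_bundle g a) 1) = ?R 1"
    "sections (prym_curve g a) (tensor_power (prym_canonical_bundle g a) 2) = ?R 2"
    "sections (prym_curve g a) (tensor_power (prym_canonical_bundle g a) 3) = ?R 3"
    using prym_sections[OF g, of a 1] prym_sections[OF g, of a 2] prym_sections[OF g, of a 3] by simp_all
  have "koszul_exact {1..g - 1} (basis_sec (g div 2) {1..g - 1} a) p (?R 1) (?R 2) \<longleftrightarrow>
    {x \<in> wedge_free (?R 1) (?R 2) p. koszul_map x \<in> wedge_rel (?R 1) (?R 3) (p - 1)} \<subseteq>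
    {koszul_map y + z | y z. y \<in> wedge_free (?R 1) (?R 1) (p + 1) \<and> z \<in> wedge_rel (?R 1) (?R 2) p}"
  proof (rule koszul_exact_iff[OF sec_ring_subspace sec_ring_subspace sec_ring_subspace])
    show "v * u \<in> ?R 2" if "v \<in> ?R 1" "u \<in> ?R 1" for v u
      using sec_ring_mult[OF that] by (simp add: numeral_2_eq_2)
    show "v * u \<in> ?R 3" if "v \<in> ?R 1" "u \<in> ?R 2" for v u
      using sec_ring_mult[OF that] by (simp add: numeral_3_eq_3)
  qed
  then show ?thesis
    by (simp add: koszul_vanishes_def koszul_cycles_def koszul_boundaries_def prym_sections_1[OF g] R)
qed

text \<open>
  The data depend on the labels of the parameter nodes only through their position relative to \<open>m\<close>.
\<close>

lemma reindex_curve: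
  assumes bij: "bij_betw \<sigma> J I" and thr: "\<And>l. l \<in> J \<Longrightarrow> \<sigma> l \<le> m \<longleftrightarrow> l \<le> m"
    and b: "\<And>l j. l \<in> J \<Longrightarrow> b (l, j) = a (\<sigma> l, j)"
  shows "l \<in> J \<Longrightarrow> basis_sec m J b l = basis_sec m I a (\<sigma> l)" (is "_ \<Longrightarrow> ?A")
    and "sec_ring m J b q = sec_ring m I a q" (is ?B)
proof -
  have bij': "bij_betw \<sigma> (J - {l}) (I - {\<sigma> l})" if "l \<in> J" for l
    using bij that by (auto simp: bij_betw_def inj_on_def)
  have lin: "lin_prod (J - {l}) b j = lin_prod (I - {\<sigma> l}) a j" if "l \<in> J" for l j
  proof -
    have "lin_prod (J - {l}) b j = (\<Prod>r\<in>J - {l}. [:- a (\<sigma> r, j), 1:])"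
      unfolding lin_prod_def by (intro prod.cong) (auto simp: b)
    also have "\<dots> = lin_prod (I - {\<sigma> l}) a j"
      unfolding lin_prod_def by (rule prod.reindex_bij_betw[OF bij'[OF that]])
    finally show ?thesis .
  qed
  show ?A if "l \<in> J" unfolding basis_sec_def lin[OF that] using thr[OF that] b[OF that] by (simp add: vec_eq_iff)
  define \<tau> where "\<tau> P = (case P of Fin l \<Rightarrow> Fin (\<sigma> l) | Zero \<Rightarrow> Zero | Inf \<Rightarrow> Inf)" for P
  have pts: "pts I = \<tau> ` pts J"
    using bij by (auto simp: pts_def \<tau>_def bij_betw_def image_image image_Un)
  have card: "card I = card J" using bij by (simp add: bij_betw_same_card)
  have eval: "pt_eval b d j P f = pt_eval a d j (\<tau> P) f" if "P \<in> pts J" for P d j f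
    using that by (auto simp: pts_def pt_eval_def \<tau>_def b)
  have denom: "pt_denom J b j P = pt_denom I a j (\<tau> P)" if "P \<in> pts J" for P j
  proof -
    have "(\<Prod>r\<in>J - {l}. b (l, j) - b (r, j)) = (\<Prod>r\<in>I - {\<sigma> l}. a (\<sigma> l, j) - a (r, j))" if "l \<in> J" for l
    proof -
      have "(\<Prod>r\<in>J - {l}. b (l, j) - b (r, j)) = (\<Prod>r\<in>J - {l}. a (\<sigma> l, j) - a (\<sigma> r, j))"
        by (intro prod.cong) (auto simp: b that)
      also have "\<dots> = (\<Prod>r\<in>I - {\<sigma> l}. a (\<sigma> l, j) - a (r, j))" by (rule prod.reindex_bij_betw[OF bij'[OF that]])
      finally show ?thesis .
    qed
    moreover have "(\<Prod>r\<in>J. - b (r, j)) = (\<Prod>r\<in>I. - a (r, j))"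
    proof -
      have "(\<Prod>r\<in>J. - b (r, j)) = (\<Prod>r\<in>J. - a (\<sigma> r, j))" by (intro prod.cong) (auto simp: b)
      also have "\<dots> = (\<Prod>r\<in>I. - a (r, j))" by (rule prod.reindex_bij_betw[OF bij])
      finally show ?thesis .
    qed
    ultimately show ?thesis using that by (auto simp: pts_def pt_denom_def \<tau>_def b)
  qed
  have "pt_glue m J b P = pt_glue m I a (\<tau> P)" if "P \<in> pts J" for P
  proof -
    have "pt_sign m P = pt_sign m (\<tau> P)" using that thr by (auto simp: pts_def pt_sign_def \<tau>_def)
    then show ?thesis by (simp add: pt_glue_def denom[OF that])
  qed
  then show ?B
    unfolding sec_ring_def card pts by (simp add: eval)
qed

lemma koszul_exact_relabel:
  assumes "bij_betw \<sigma> J I" "\<And>l. l \<in> J \<Longrightarrow> \<sigma> l \<le> m \<longleftrightarrow> l \<le> m" "\<And>l j. l \<in> J \<Longrightarrow> b (l, j) = a (\<sigma> l, j)"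
    and ex: "koszul_exact J (basis_sec m J b) p (sec_ring m J b 1) (sec_ring m J b 2)"
  shows "koszul_exact I (basis_sec m I a) p (sec_ring m I a 1) (sec_ring m I a 2)"
proof (rule koszul_exact_reindex[OF assms(1)])
  show "koszul_exact J (\<lambda>i. basis_sec m I a (\<sigma> i)) p (sec_ring m I a 1) (sec_ring m I a 2)"
  proof (rule koszul_exact_cong)
    have "sec_ring m J b q = sec_ring m I a q" for q
      by (rule reindex_curve(2)[OF assms(1)]) (use assms(2,3) in auto)
    then show "koszul_exact J (basis_sec m J b) p (sec_ring m I a 1) (sec_ring m I a 2)" using ex by simp
    show "basis_sec m J b i = basis_sec m I a (\<sigma> i)" if "i \<in> J" for i
      by (rule reindex_curve(1)[OF assms(1) _ _ that]) (use assms(2,3) in auto)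
  qed
qed

section \<open>The embedding for generic parameters\<close>

lemma form_eval_nonzero:
  assumes "degree f \<le> d" "u \<noteq> 0"
  shows "form_eval (int d) f (t, u) = u ^ d * poly f (t / u)"
proof -
  have "poly f (t / u) = (\<Sum>i\<le>d. coeff f i * (t / u) ^ i)"
    unfolding poly_altdef by (rule sum.mono_neutral_left) (use assms in \<open>auto simp: coeff_eq_0\<close>)
  then have "u ^ d * poly f (t / u) = (\<Sum>i\<le>d. coeff f i * t ^ i * (u ^ d / u ^ i))"
    by (simp add: sum_distrib_left power_divide mult_ac)
  also have "\<dots> = (\<Sum>i\<le>d. coeff f i * t ^ i * u ^ (d - i))"
    using assms(2) by (intro sum.cong refl) (auto simp: power_diff)
  finally show ?thesis by (simp add: form_eval_def)
qed

lemma form_eval_zero: "form_eval (int d) f (t, 0) = coeff f d * t ^ d"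
proof -
  have "form_eval (int d) f (t, 0) = (\<Sum>i\<le>d. if i = d then coeff f d * t ^ d else 0)"
    unfolding form_eval_def by (intro sum.cong) auto
  then show ?thesis by simp
qed

lemma form_eval_mult:
  assumes "degree f \<le> d" "degree h \<le> e"
  shows "form_eval (int (d + e)) (f * h) v = form_eval (int d) f v * form_eval (int e) h v"
proof -
  obtain t u where v: "v = (t, u)" by fastforce
  have deg: "degree (f * h) \<le> d + e" using degree_mult_le[of f h] assms by linarith
  show ?thesis
  proof (cases "u = 0")
    case True
    then show ?thesis
      unfolding v True form_eval_zero coeff_mult_top[OF assms] by (simp add: power_add mult_ac)
  next
    case False
    then show ?thesis
      unfolding v form_eval_nonzero[OF deg False] form_eval_nonzero[OF assms(1) False] form_eval_nonzero[OF assms(2) False]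
      by (simp add: power_add mult_ac)
  qed
qed

lemma form_eval_linear: "form_eval (int 1) [:b, c:] v = c * fst v + b * snd v"
  by (simp add: form_eval_def)

lemma form_eval_smult: "form_eval d (smult c f) v = c * form_eval d f v"
  by (simp add: form_eval_def sum_distrib_left mult.assoc)

lemma form_eval_lin_prod:
  assumes "finite A"
  shows "form_eval (int (card A)) (lin_prod A a j) v = (\<Prod>r\<in>A. fst v - a (r, j) * snd v)"
  using assms
proof (induction A rule: finite_induct)
  case empty
  show ?case by (simp add: lin_prod_def form_eval_def)
next
  case (insert k A)
  have "lin_prod (insert k A) a j = [:- a (k, j), 1:] * lin_prod A a j"
    using insert by (simp add: lin_prod_def)
  moreover have "card (insert k A) = 1 + card A" using insert by simp
  moreover have "form_eval (int (1 + card A)) ([:- a (k, j), 1:] * lin_prod A a j) v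
      = form_eval (int 1) [:- a (k, j), 1:] v * form_eval (int (card A)) (lin_prod A a j) v"
    by (rule form_eval_mult) auto
  ultimately show ?case
    using insert by (simp only: form_eval_linear insert.IH) simp
qed

lemma field_differentiable_prod:
  assumes "\<And>k. k \<in> A \<Longrightarrow> f k field_differentiable (at x)"
  shows "(\<lambda>z. \<Prod>k\<in>A. f k z) field_differentiable (at x)"
  using assms by (induction A rule: infinite_finite_induct) (auto intro!: derivative_intros)

lemma deriv_linear_factor:
  assumes "\<And>z. F z = z * k * Q z" "Q field_differentiable at 0"
  shows "deriv F 0 = k * Q (0 :: complex)"
proof -
  obtain q where q: "(Q has_field_derivative q) (at 0)" using assms(2) unfolding field_differentiable_def by blast
  have "((\<lambda>z. z * k * Q z) has_field_derivative k * Q 0) (at 0)"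
    by (rule derivative_eq_intros q refl)+ simp
  moreover have "F = (\<lambda>z. z * k * Q z)" using assms(1) by auto
  ultimately show ?thesis by (simp add: DERIV_imp_deriv)
qed

lemma two_by_two_kernel:
  fixes x y :: complex
  assumes "p * x + q * y = 0" "r * x + s * y = 0" "p * s \<noteq> q * r"
  shows "x = 0" "y = 0"
proof -
  have "(p * s - q * r) * x = s * (p * x + q * y) - q * (r * x + s * y)" by (simp add: algebra_simps)
  then show "x = 0" using assms by simp
  have "(p * s - q * r) * y = p * (r * x + s * y) - r * (p * x + q * y)" by (simp add: algebra_simps)
  then show "y = 0" using assms by simp
qed

text \<open>
  The inequalities are about the points \<open>(a (l, 1), a (l, 2))\<close> of the plane: no two of them are collinear
  with the origin, and no three of them are collinear.
\<close>

definition generic_params :: "nat \<Rightarrow> (nat \<times> 2 \<Rightarrow> complex) \<Rightarrow> bool" where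
  "generic_params g a \<longleftrightarrow> distinct_nodes {1..g - 1} a \<and>
     (\<forall>p\<in>{1..g - 1}. \<forall>q\<in>{1..g - 1}. p \<noteq> q \<longrightarrow> a (p, 1) * a (q, 2) \<noteq> a (p, 2) * a (q, 1)) \<and>
     (\<forall>p\<in>{1..g - 1}. \<forall>q\<in>{1..g - 1}. \<forall>r\<in>{1..g - 1}. p \<noteq> q \<and> p \<noteq> r \<and> q \<noteq> r \<longrightarrow>
        (a (r, 1) - a (p, 1)) * (a (r, 2) - a (q, 2)) \<noteq> (a (r, 2) - a (p, 2)) * (a (r, 1) - a (q, 1)))"

text \<open>
  For \<open>g \<ge> 6\<close> there are at least three coordinates of the first kind and two of the second kind.
\<close>

locale generic_prym =
  fixes g :: nat and a :: "nat \<times> 2 \<Rightarrow> complex" and d :: complex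
  assumes g: "g \<ge> 6" and generic: "generic_params g a" and d: "d \<noteq> 0"
begin

abbreviation "I \<equiv> {1..g - 1}"
abbreviation "m \<equiv> g div 2"

lemma good: "distinct_nodes I a"
  using generic by (simp add: generic_params_def)

lemma off_origin: "p \<in> I \<Longrightarrow> q \<in> I \<Longrightarrow> p \<noteq> q \<Longrightarrow> a (p, 1) * a (q, 2) \<noteq> a (p, 2) * a (q, 1)"
  using generic unfolding generic_params_def by blast

lemma not_collinear:
  "p \<in> I \<Longrightarrow> q \<in> I \<Longrightarrow> r \<in> I \<Longrightarrow> p \<noteq> q \<Longrightarrow> p \<noteq> r \<Longrightarrow> q \<noteq> r \<Longrightarrow>
    (a (r, 1) - a (p, 1)) * (a (r, 2) - a (q, 2)) \<noteq> (a (r, 2) - a (p, 2)) * (a (r, 1) - a (q, 1))"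
  using generic unfolding generic_params_def by blast

lemma small_indices: "1 \<in> I" "2 \<in> I" "3 \<in> I" "1 \<le> m" "2 \<le> m" "3 \<le> m"
  and large_indices: "g - 1 \<in> I" "g - 2 \<in> I" "\<not> g - 1 \<le> m" "\<not> g - 2 \<le> m" "g - 1 \<noteq> g - 2"
  using g by auto

definition coef :: "2 \<Rightarrow> nat \<Rightarrow> complex" where
  "coef j l = (if l \<le> m then 1 else - (prym_d g a d j * a (l, j) / prym_A g a j))"

definition coord :: "2 \<Rightarrow> nat \<Rightarrow> complex \<times> complex \<Rightarrow> complex" where
  "coord j l v = form_eval (int (g - 1)) (prym_map g a d j l) v"

lemma A_nonzero: "prym_A g a j \<noteq> 0"
  using distinct_nodesD(2)[OF good] by (simp add: prym_A_def)

lemma d_nonzero: "prym_d g a d j \<noteq> 0"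
  using d A_nonzero by (simp add: prym_d_def)

lemma coef_nonzero: "l \<in> I \<Longrightarrow> coef j l \<noteq> 0"
  using d_nonzero A_nonzero distinct_nodesD(2)[OF good] by (simp add: coef_def)

lemma coord_eq:
  assumes "l \<in> I"
  shows "coord j l v = coef j l * (if l \<le> m then fst v else snd v) * (\<Prod>r\<in>I - {l}. fst v - a (r, j) * snd v)"
proof -
  have n: "int (g - 1) = int (1 + card (I - {l}))" using card.remove[of I l] assms g by simp
  have lin: "form_eval (int (1 + card (I - {l}))) ([:b, c:] * lin_prod (I - {l}) a j) v
      = (c * fst v + b * snd v) * (\<Prod>r\<in>I - {l}. fst v - a (r, j) * snd v)" for b c
    by (subst form_eval_mult) (auto simp: form_eval_lin_prod form_eval_linear[simplified] simp del: mult_pCons_left)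
  have pm: "prym_map g a d j l = (if l \<le> m then [:0, 1:] * lin_prod (I - {l}) a j
      else smult (coef j l) ([:1, 0:] * lin_prod (I - {l}) a j))"
    by (simp add: prym_map_def lin_prod_def coef_def Let_def del: mult_pCons_left) simp
  show ?thesis
    unfolding coord_def n pm
    by (cases "l \<le> m") (simp_all only: if_True if_False form_eval_smult lin, simp_all add: coef_def)
qed

text \<open>
  Both sides are the product of all \<open>t - a\<^sub>l\<^sub>,\<^sub>j u\<close> with \<open>t\<close> or with \<open>u\<close>. So the ratio of two coordinates of the same
  kind is a fractional linear function on the component, and this is the source of injectivity and immersivity.
\<close>

lemma coord_relation:
  assumes "p \<in> I" "q \<in> I" "p \<le> m \<longleftrightarrow> q \<le> m"
  shows "coord j p v / coef j p * (fst v - a (p, j) * snd v) = coord j q v / coef j q * (fst v - a (q, j) * snd v)"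
proof -
  have "coord j l v / coef j l * (fst v - a (l, j) * snd v)
      = (if l \<le> m then fst v else snd v) * (\<Prod>r\<in>I. fst v - a (r, j) * snd v)" if "l \<in> I" for l
    using that coef_nonzero[OF that] prod.remove[of I l "\<lambda>r. fst v - a (r, j) * snd v"]
    by (simp add: coord_eq mult_ac)
  then show ?thesis using assms by simp
qed

lemma coord_node: 
  assumes "l \<in> I" "fst v = a (l, j) * snd v" "v \<noteq> (0, 0)" "r \<in> I"
  shows "coord j r v \<noteq> 0 \<longleftrightarrow> r = l"
proof
  have u: "snd v \<noteq> 0" using assms(2,3) by (cases v) auto
  have t: "fst v \<noteq> 0" using assms(1,2) u distinct_nodesD(2)[OF good] by auto
  show "coord j r v \<noteq> 0 \<Longrightarrow> r = l"
  proof (rule ccontr)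
    assume "coord j r v \<noteq> 0" "r \<noteq> l"
    then have "(\<Prod>k\<in>I - {r}. fst v - a (k, j) * snd v) = 0" using assms(1,2) by (intro prod_zero) auto
    then show False using \<open>coord j r v \<noteq> 0\<close> assms(4) by (simp add: coord_eq)
  qed
  have "(\<Prod>k\<in>I - {l}. fst v - a (k, j) * snd v) \<noteq> 0"
    using distinct_nodesD(3)[OF good assms(1)] u by (auto simp: assms(2) left_diff_distrib[symmetric])
  then show "r = l \<Longrightarrow> coord j r v \<noteq> 0"
    using assms(1) u t coef_nonzero[OF assms(1)] by (simp add: coord_eq)
qed

lemma coord_off_nodes:
  assumes "\<And>k. k \<in> I \<Longrightarrow> fst v \<noteq> a (k, j) * snd v" "r \<in> I"
  shows "coord j r v \<noteq> 0 \<longleftrightarrow> (if r \<le> m then fst v \<noteq> 0 else snd v \<noteq> 0)"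
proof -
  have "(\<Prod>k\<in>I - {r}. fst v - a (k, j) * snd v) \<noteq> 0" using assms(1) by auto
  then show ?thesis using assms(2) coef_nonzero[OF assms(2)] by (simp add: coord_eq)
qed

lemma base_point_free: "v \<noteq> (0, 0) \<Longrightarrow> \<exists>l\<in>I. coord j l v \<noteq> 0"
proof (cases "\<exists>k\<in>I. fst v = a (k, j) * snd v")
  case False
  assume "v \<noteq> (0, 0)"
  then consider "fst v \<noteq> 0" | "snd v \<noteq> 0" by (cases v) auto
  then show ?thesis
  proof cases
    case 1
    then show ?thesis using coord_off_nodes[of v j 1] False small_indices by (intro bexI[of _ 1]) auto
  next
    case 2
    then show ?thesis using coord_off_nodes[of v j "g - 1"] False large_indices by (intro bexI[of _ "g - 1"]) auto
  qed
qed (use coord_node in blast)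

text \<open>
  The relation between two coordinates of the same kind, for fixed values of the coordinates at \<open>v\<close>, is a linear
  equation for \<open>z\<close>. It is not trivial if one of the values is nonzero, and it is satisfied by \<open>v\<close>.
\<close>

lemma proportional:
  assumes v: "v \<noteq> (0, 0)"
    and z: "\<And>p q. p \<in> I \<Longrightarrow> q \<in> I \<Longrightarrow> p \<le> m \<longleftrightarrow> q \<le> m \<Longrightarrow>
      coord j p v / coef j p * (fst z - a (p, j) * snd z) = coord j q v / coef j q * (fst z - a (q, j) * snd z)"
  shows "cross v z = 0"
proof -
  obtain p where p: "p \<in> I" "coord j p v \<noteq> 0" using base_point_free[OF v] by blast
  obtain q where q: "q \<in> I" "p \<noteq> q" "p \<le> m \<longleftrightarrow> q \<le> m"
  proof (cases "p \<le> m")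
    case True
    then show ?thesis using that[of 1] that[of 2] small_indices by (cases "p = 1") auto
  next
    case False
    then show ?thesis using that[of "g - 1"] that[of "g - 2"] large_indices by (cases "p = g - 1") auto
  qed
  define x y where "x = coord j p v / coef j p" and "y = coord j q v / coef j q"
  have x0: "x \<noteq> 0" using p coef_nonzero by (simp add: x_def)
  define \<alpha> \<beta> where "\<alpha> = x - y" and "\<beta> = x * a (p, j) - y * a (q, j)"
  have "\<alpha> * fst v + (- \<beta>) * snd v = 0"
    using coord_relation[OF p(1) q(1,3), of j v] by (simp add: x_def[symmetric] y_def[symmetric] \<alpha>_def \<beta>_def algebra_simps)
  moreover have "\<alpha> * fst z + (- \<beta>) * snd z = 0"
    using z[OF p(1) q(1,3)] by (simp add: x_def[symmetric] y_def[symmetric] \<alpha>_def \<beta>_def algebra_simps)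
  ultimately have ab: "fst v * \<alpha> + snd v * (- \<beta>) = 0" "fst z * \<alpha> + snd z * (- \<beta>) = 0"
    by (simp_all add: mult.commute)
  show ?thesis
  proof (rule ccontr)
    assume "cross v z \<noteq> 0"
    then have "fst v * snd z \<noteq> snd v * fst z" by (simp add: cross_def)
    from two_by_two_kernel[OF ab this] have "\<alpha> = 0" "\<beta> = 0" by auto
    then have "x * (a (p, j) - a (q, j)) = 0" by (simp add: \<alpha>_def \<beta>_def algebra_simps)
    then show False using x0 distinct_nodesD(3)[OF good p(1) q(1,2), of j] by simp
  qed
qed

lemma injective_on_component:
  assumes v: "v \<noteq> (0, 0)" and w: "w \<noteq> (0, 0)" and eq: "\<And>l. l \<in> I \<Longrightarrow> coord j l w = c * coord j l v"
  shows "cross v w = 0"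
proof (rule proportional[OF v])
  have "c \<noteq> 0" using base_point_free[OF w, of j] eq by auto
  show "coord j p v / coef j p * (fst w - a (p, j) * snd w) = coord j q v / coef j q * (fst w - a (q, j) * snd w)"
    if "p \<in> I" "q \<in> I" "p \<le> m \<longleftrightarrow> q \<le> m" for p q
  proof -
    have "c * (coord j p v / coef j p * (fst w - a (p, j) * snd w)) = c * (coord j q v / coef j q * (fst w - a (q, j) * snd w))"
      using coord_relation[OF that, of j w] unfolding eq[OF that(1)] eq[OF that(2)]
      by (simp only: times_divide_eq_right[symmetric] mult.assoc)
    then show ?thesis using \<open>c \<noteq> 0\<close> by (simp only: mult_cancel_left simp_thms)
  qed
qed

lemma coord_differentiable:
  "(\<lambda>z. coord j l (fst v + z * fst w, snd v + z * snd w)) field_differentiable at 0"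
  unfolding coord_def form_eval_def by (auto intro!: derivative_intros)

text \<open>
  If the derivative in the direction \<open>w\<close> were \<open>c\<close> times the value, differentiating the relation between
  coordinates of the same kind would show that \<open>c v + w\<close> satisfies the same linear equations as \<open>v\<close>.
\<close>

lemma immersion:
  assumes v: "v \<noteq> (0, 0)" and w: "cross v w \<noteq> 0"
  shows "\<exists>l\<in>I. deriv (\<lambda>z. coord j l (fst v + z * fst w, snd v + z * snd w)) 0 \<noteq> c * coord j l v"
proof (rule ccontr)
  assume "\<not> ?thesis"
  then have D: "deriv (\<lambda>z. coord j l (fst v + z * fst w, snd v + z * snd w)) 0 = c * coord j l v" if "l \<in> I" for l
    using that by blast
  define F where "F l z = coord j l (fst v + z * fst w, snd v + z * snd w) / coef j l
      * ((fst v + z * fst w) - a (l, j) * (snd v + z * snd w))" for l z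
  have dF: "deriv (F l) 0 = coord j l v / coef j l * ((c * fst v + fst w) - a (l, j) * (c * snd v + snd w))" if l: "l \<in> I" for l
  proof -
    have "((\<lambda>z. coord j l (fst v + z * fst w, snd v + z * snd w)) has_field_derivative c * coord j l v) (at 0)"
      unfolding D[OF l, symmetric] using coord_differentiable by (simp add: DERIV_deriv_iff_field_differentiable)
    then have "(F l has_field_derivative
        c * coord j l v / coef j l * (fst v - a (l, j) * snd v) + coord j l v / coef j l * (fst w - a (l, j) * snd w)) (at 0)"
      unfolding F_def[abs_def] using coef_nonzero[OF l, of j]
      by (auto intro!: derivative_eq_intros simp: field_simps)
    then have "deriv (F l) 0 = c * coord j l v / coef j l * (fst v - a (l, j) * snd v) + coord j l v / coef j l * (fst w - a (l, j) * snd w)"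
      by (rule DERIV_imp_deriv)
    then show ?thesis by (simp add: algebra_simps add_divide_distrib diff_divide_distrib)
  qed
  have "cross v (c * fst v + fst w, c * snd v + snd w) = 0"
  proof (rule proportional[OF v])
    fix p q assume pq: "p \<in> I" "q \<in> I" "p \<le> m \<longleftrightarrow> q \<le> m"
    have "F p z = F q z" for z
      using coord_relation[OF pq, of j "(fst v + z * fst w, snd v + z * snd w)"] by (simp add: F_def)
    then have "F p = F q" by auto
    then have "deriv (F p) 0 = deriv (F q) 0" by simp
    then show "coord j p v / coef j p * (fst (c * fst v + fst w, c * snd v + snd w) - a (p, j) * snd (c * fst v + fst w, c * snd v + snd w))
        = coord j q v / coef j q * (fst (c * fst v + fst w, c * snd v + snd w) - a (q, j) * snd (c * fst v + fst w, c * snd v + snd w))"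
      unfolding dF[OF pq(1)] dF[OF pq(2)] by simp
  qed
  then have "cross v w = 0" by (simp add: cross_def algebra_simps)
  then show False using w by simp
qed

lemma node_values:
  "l \<in> I \<Longrightarrow> node (prym_curve g a) l j = (a (l, j), 1)"
  "node (prym_curve g a) g j = (0, 1)" "node (prym_curve g a) (g + 1) j = (1, 0)"
  using g by (auto simp: prym_curve_def)

text \<open>
  The set of vanishing coordinates tells the nodes apart from each other and from all other points. If neither point is
  a node, the ratios of the first three coordinates show that \<open>(a\<^sub>l\<^sub>,\<^sub>1, a\<^sub>l\<^sub>,\<^sub>2)\<close>, \<open>l = 1, 2, 3\<close>, lie on a line with the pair of
  affine coordinates of the two points.
\<close>

lemma meet_only_at_nodes:
  assumes v: "v \<noteq> (0, 0)" and w: "w \<noteq> (0, 0)" and eq: "\<And>l. l \<in> I \<Longrightarrow> coord 2 l w = c * coord 1 l v"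
  shows "\<exists>r\<in>{1..g + 1}. cross v (node (prym_curve g a) r 1) = 0 \<and> cross w (node (prym_curve g a) r 2) = 0"
proof -
  have "c \<noteq> 0" using base_point_free[OF w, of 2] eq by auto
  then have supp: "coord 2 l w \<noteq> 0 \<longleftrightarrow> coord 1 l v \<noteq> 0" if "l \<in> I" for l using eq[OF that] by simp
  note S = small_indices large_indices
  show ?thesis
  proof (cases "(\<exists>k\<in>I. fst v = a (k, 1) * snd v) \<or> (\<exists>k\<in>I. fst w = a (k, 2) * snd w)")
    case True
    have "\<exists>k\<in>I. fst v = a (k, 1) * snd v \<and> fst w = a (k, 2) * snd w"
    proof -
      have *: "\<exists>k\<in>I. fst w' = a (k, j') * snd w'"
        if k: "k \<in> I" "fst v' = a (k, j) * snd v'" and "v' \<noteq> (0, 0)"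
          and sp: "\<And>l. l \<in> I \<Longrightarrow> coord j' l w' \<noteq> 0 \<longleftrightarrow> coord j l v' \<noteq> 0" for v' w' :: "complex \<times> complex" and j j' k
      proof (rule ccontr)
        assume no: "\<not> ?thesis"
        have one: "coord j' l w' \<noteq> 0 \<longleftrightarrow> l = k" if "l \<in> I" for l
          using sp[OF that] coord_node[OF k \<open>v' \<noteq> (0, 0)\<close> that] by simp
        have off: "coord j' l w' \<noteq> 0 \<longleftrightarrow> (if l \<le> m then fst w' \<noteq> 0 else snd w' \<noteq> 0)" if "l \<in> I" for l
          using coord_off_nodes[OF _ that, of w' j'] no by blast
        show False
          using one[OF k(1)] off[OF k(1)] one[OF S(1)] off[OF S(1)] one[OF S(2)] off[OF S(2)]
            one[OF S(7)] off[OF S(7)] one[OF S(8)] off[OF S(8)] S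
          by (cases "k \<le> m") (auto split: if_splits)
      qed
      have "(\<exists>k\<in>I. fst v = a (k, 1) * snd v) \<and> (\<exists>k\<in>I. fst w = a (k, 2) * snd w)"
        using True *[of _ v 1 2 w, OF _ _ v supp] *[of _ w 2 1 v, OF _ _ w supp[symmetric]] by blast
      then obtain k k' where k: "k \<in> I" "fst v = a (k, 1) * snd v" and k': "k' \<in> I" "fst w = a (k', 2) * snd w" by blast
      have "k = k'" using supp[OF k(1)] coord_node[OF k v k(1)] coord_node[OF k' w k(1)] by simp
      then show ?thesis using k k' by blast
    qed
    then obtain k where "k \<in> I" "fst v = a (k, 1) * snd v" "fst w = a (k, 2) * snd w" by blast
    then show ?thesis using g by (intro bexI[of _ k]) (auto simp: node_values cross_def)
  next
    case False
    have off: "coord 1 l v \<noteq> 0 \<longleftrightarrow> (if l \<le> m then fst v \<noteq> 0 else snd v \<noteq> 0)"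
      "coord 2 l w \<noteq> 0 \<longleftrightarrow> (if l \<le> m then fst w \<noteq> 0 else snd w \<noteq> 0)" if "l \<in> I" for l
      using coord_off_nodes[OF _ that, of v 1] coord_off_nodes[OF _ that, of w 2] False by blast+
    have fz: "fst w \<noteq> 0 \<longleftrightarrow> fst v \<noteq> 0" using supp[OF S(1)] off[OF S(1)] S by simp
    have sz: "snd w \<noteq> 0 \<longleftrightarrow> snd v \<noteq> 0" using supp[OF S(7)] off[OF S(7)] S by simp
    consider "fst v = 0" | "snd v = 0" | "fst v \<noteq> 0" "snd v \<noteq> 0" by blast
    then show ?thesis
    proof cases
      case 1
      then show ?thesis using fz by (intro bexI[of _ g]) (use g in \<open>auto simp: node_values cross_def\<close>)
    next
      case 2
      then show ?thesis using sz by (intro bexI[of _ "g + 1"]) (use g in \<open>auto simp: node_values(3)[simplified] cross_def\<close>)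
    next
      case 3
      define A B where "A l = fst v - a (l, 1) * snd v" and "B l = fst w - a (l, 2) * snd w" for l
      have par: "A p * B q = A q * B p" if pq: "p \<in> I" "q \<in> I" "p \<le> m" "q \<le> m" for p q
      proof -
        have 1: "coord 1 p v * A p = coord 1 q v * A q"
          using coord_relation[of p q 1 v] pq by (simp add: A_def coef_def)
        have 2: "coord 1 p v * B p = coord 1 q v * B q"
          using coord_relation[of p q 2 w] pq eq \<open>c \<noteq> 0\<close> by (simp add: B_def coef_def)
        have nz: "coord 1 p v \<noteq> 0" "coord 1 q v \<noteq> 0" using off pq 3 by auto
        have "coord 1 p v * coord 1 q v * (A p * B q) = (coord 1 p v * A p) * (coord 1 q v * B q)" by simp
        also have "\<dots> = (coord 1 q v * A q) * (coord 1 p v * B p)" by (simp only: 1 2)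
        finally show ?thesis using nz by simp
      qed
      have "snd v * snd w * ((a (3, 1) - a (1, 1)) * (a (3, 2) - a (2, 2)) - (a (3, 2) - a (1, 2)) * (a (3, 1) - a (2, 1)))
          = (A 1 - A 3) * (B 2 - B 3) - (A 2 - A 3) * (B 1 - B 3)"
        by (simp add: A_def B_def algebra_simps)
      also have "\<dots> = 0"
        using par[of 1 2] par[of 1 3] par[of 2 3] S by (simp add: algebra_simps)
      finally show ?thesis using not_collinear[OF S(1-3)] 3 sz by simp
    qed
  qed
qed

text \<open>
  At a node, consider two coordinates that vanish there. Their derivatives along the two branches form a
  matrix of size two, which is singular only if three of the points \<open>(a\<^sub>l\<^sub>,\<^sub>1, a\<^sub>l\<^sub>,\<^sub>2)\<close> are collinear, for a parameter node,
  or two of them are collinear with the origin, for the nodes at \<open>0\<close> and infinity.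
\<close>

lemma tangents_distinct:
  assumes r: "r \<in> {1..g + 1}" and w: "cross (node (prym_curve g a) r 1) w1 \<noteq> 0" "cross (node (prym_curve g a) r 2) w2 \<noteq> 0"
    and eq: "\<And>l. l \<in> I \<Longrightarrow> c * coord 1 l (node (prym_curve g a) r 1)
      + c1 * deriv (\<lambda>z. coord 1 l (fst (node (prym_curve g a) r 1) + z * fst w1, snd (node (prym_curve g a) r 1) + z * snd w1)) 0
      + c2 * deriv (\<lambda>z. coord 2 l (fst (node (prym_curve g a) r 2) + z * fst w2, snd (node (prym_curve g a) r 2) + z * snd w2)) 0 = 0"
  shows "c = 0 \<and> c1 = 0 \<and> c2 = 0"
proof -
  note S = small_indices large_indices
  let ?N = "node (prym_curve g a) r"
  let ?w = "\<lambda>j :: 2. if j = 1 then w1 else w2"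
  define D where "D j l = deriv (\<lambda>z. coord j l (fst (?N j) + z * fst (?w j), snd (?N j) + z * snd (?w j))) 0" for j l
  have eq': "c * coord 1 l (?N 1) + c1 * D 1 l + c2 * D 2 l = 0" if "l \<in> I" for l
    using eq[OF that] by (simp add: D_def)
  have w': "cross (?N j) (?w j) \<noteq> 0" for j using w exhaust_2[of j] by auto
  have step: ?thesis if e: "c1 = 0 \<and> c2 = 0" and l: "l \<in> I" "coord 1 l (?N 1) \<noteq> 0" for l
    using e eq'[OF l(1)] l(2) by simp
  consider "r \<in> I" | "r = g" | "r = g + 1" using r by fastforce
  then show ?thesis
  proof cases
    case 1
    note N = node_values(1)[OF 1]
    define K where "K j = (fst (?w j) - a (r, j) * snd (?w j)) * a (r, j) * (\<Prod>k\<in>I - {r}. a (r, j) - a (k, j))" for j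
    have K: "K j \<noteq> 0" for j
    proof -
      have "fst (?w j) - a (r, j) * snd (?w j) \<noteq> 0" using w'[of j] by (simp add: N cross_def)
      moreover have "(\<Prod>k\<in>I - {r}. a (r, j) - a (k, j)) \<noteq> 0" using distinct_nodesD(3)[OF good 1] by auto
      ultimately show ?thesis using distinct_nodesD(2)[OF good 1] by (simp add: K_def)
    qed
    have D: "D j l * (a (r, j) - a (l, j)) = K j" if l: "l \<in> I" "l \<le> m" "l \<noteq> r" for l j
    proof -
      define Q where "Q z = (a (r, j) + z * fst (?w j)) * (\<Prod>k\<in>I - {l} - {r}. (a (r, j) + z * fst (?w j)) - a (k, j) * (1 + z * snd (?w j)))" for z
      have "D j l = (fst (?w j) - a (r, j) * snd (?w j)) * Q 0"
        unfolding D_def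
      proof (rule deriv_linear_factor)
        fix z
        have "(\<Prod>k\<in>I - {l}. (a (r, j) + z * fst (?w j)) - a (k, j) * (1 + z * snd (?w j)))
            = ((a (r, j) + z * fst (?w j)) - a (r, j) * (1 + z * snd (?w j)))
              * (\<Prod>k\<in>I - {l} - {r}. (a (r, j) + z * fst (?w j)) - a (k, j) * (1 + z * snd (?w j)))"
          using 1 l by (intro prod.remove) auto
        then show "coord j l (fst (?N j) + z * fst (?w j), snd (?N j) + z * snd (?w j))
            = z * (fst (?w j) - a (r, j) * snd (?w j)) * Q z"
          using l by (simp only: coord_eq N fst_conv snd_conv Q_def) (simp add: coef_def algebra_simps)
      next
        show "Q field_differentiable at 0"
          unfolding Q_def[abs_def] by (auto intro!: derivative_intros field_differentiable_prod)
      qed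
      moreover have "(\<Prod>k\<in>I - {r}. a (r, j) - a (k, j)) = (a (r, j) - a (l, j)) * (\<Prod>k\<in>I - {r} - {l}. a (r, j) - a (k, j))"
        using l by (intro prod.remove) auto
      moreover have "I - {r} - {l} = I - {l} - {r}" by auto
      ultimately show ?thesis by (simp add: K_def Q_def)
    qed
    obtain p q where pq: "p \<in> I" "q \<in> I" "p \<le> m" "q \<le> m" "p \<noteq> r" "q \<noteq> r" "p \<noteq> q"
    proof (cases "r = 1")
      case True
      then show ?thesis using that[of 2 3] S by auto
    next
      case False
      then show ?thesis using that[of 1 2] that[of 1 3] S by (cases "r = 2") auto
    qed
    have lin: "(a (r, 2) - a (l, 2)) * (c1 * K 1) + (a (r, 1) - a (l, 1)) * (c2 * K 2) = 0"
      if l: "l \<in> I" "l \<le> m" "l \<noteq> r" for l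
    proof -
      have "coord 1 l (?N 1) = 0" using coord_node[OF 1, of "?N 1" 1 l] l by (auto simp: N)
      then have "(a (r, 1) - a (l, 1)) * (a (r, 2) - a (l, 2)) * (c1 * D 1 l + c2 * D 2 l) = 0"
        using eq'[OF l(1)] by simp
      then show ?thesis unfolding D[OF l, symmetric] by (simp add: algebra_simps)
    qed
    have "(a (r, 2) - a (p, 2)) * (a (r, 1) - a (q, 1)) \<noteq> (a (r, 1) - a (p, 1)) * (a (r, 2) - a (q, 2))"
      using not_collinear[OF pq(1,2) 1 pq(7,5,6)] by simp
    from two_by_two_kernel[OF lin[OF pq(1,3,5)] lin[OF pq(2,4,6)] this]
    have "c1 = 0 \<and> c2 = 0" using K by simp
    then show ?thesis by (rule step[OF _ 1]) (use coord_node[OF 1, of "?N 1" 1 r] 1 in \<open>simp add: N\<close>)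
  next
    case 2
    note N = node_values(2)
    have D: "D j l = fst (?w j) * (\<Prod>k\<in>I - {l}. - a (k, j))" if l: "l \<in> I" "l \<le> m" for l j
    proof -
      define Q where "Q z = (\<Prod>k\<in>I - {l}. z * fst (?w j) - a (k, j) * (1 + z * snd (?w j)))" for z
      have "D j l = fst (?w j) * Q 0"
        unfolding D_def
      proof (rule deriv_linear_factor)
        show "coord j l (fst (?N j) + z * fst (?w j), snd (?N j) + z * snd (?w j)) = z * fst (?w j) * Q z" for z
          using l by (simp add: coord_eq N 2 Q_def coef_def)
        show "Q field_differentiable at 0"
          unfolding Q_def[abs_def] by (auto intro!: derivative_intros field_differentiable_prod)
      qed
      then show ?thesis by (simp add: Q_def)
    qed
    define K where "K j = fst (?w j) * (\<Prod>k\<in>I. - a (k, j))" for j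
    have K: "K j \<noteq> 0" for j
    proof -
      have "fst (?w j) \<noteq> 0" using w'[of j] by (simp add: 2 N cross_def)
      then show ?thesis using distinct_nodesD(2)[OF good] by (simp add: K_def)
    qed
    have DK: "D j l * (- a (l, j)) = K j" if "l \<in> I" "l \<le> m" for l j
      using prod.remove[of I l "\<lambda>k. - a (k, j)"] that D[OF that, of j] by (simp add: K_def mult_ac)
    have lin: "a (l, 2) * (c1 * K 1) + a (l, 1) * (c2 * K 2) = 0" if l: "l \<in> I" "l \<le> m" for l
    proof -
      have "coord 1 l (?N 1) = 0" using l by (simp add: coord_eq N 2)
      then have "a (l, 1) * a (l, 2) * (c1 * D 1 l + c2 * D 2 l) = 0" using eq'[OF l(1)] by simp
      then show ?thesis unfolding DK[OF l, symmetric] by (simp add: algebra_simps neg_eq_iff_add_eq_0)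
    qed
    have "a (1, 2) * a (2, 1) \<noteq> a (1, 1) * a (2, 2)" using off_origin[OF S(1,2)] by simp
    from two_by_two_kernel[OF lin[OF S(1,4)] lin[OF S(2,5)] this]
    have "c1 = 0 \<and> c2 = 0" using K by simp
    moreover have "coord 1 (g - 1) (?N 1) \<noteq> 0"
      using coord_off_nodes[of "?N 1" 1 "g - 1"] S distinct_nodesD(2)[OF good] by (auto simp: N 2)
    ultimately show ?thesis by (intro step[OF _ S(7)])
  next
    case 3
    note N = node_values(3)
    have D: "D j l = snd (?w j) * coef j l" if l: "l \<in> I" "\<not> l \<le> m" for l j
    proof -
      define Q where "Q z = coef j l * (\<Prod>k\<in>I - {l}. (1 + z * fst (?w j)) - a (k, j) * (z * snd (?w j)))" for z
      have "D j l = snd (?w j) * Q 0"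
        unfolding D_def
      proof (rule deriv_linear_factor)
        show "coord j l (fst (?N j) + z * fst (?w j), snd (?N j) + z * snd (?w j)) = z * snd (?w j) * Q z" for z
          using l by (simp only: coord_eq N 3 Q_def) simp
        show "Q field_differentiable at 0"
          unfolding Q_def[abs_def] by (auto intro!: derivative_intros field_differentiable_prod)
      qed
      then show ?thesis by (simp add: Q_def)
    qed
    define K where "K j = - (snd (?w j) * prym_d g a d j / prym_A g a j)" for j
    have K: "K j \<noteq> 0" for j
    proof -
      have "snd (?w j) \<noteq> 0" using w'[of j] by (simp only: 3 N cross_def) simp
      then show ?thesis using d_nonzero A_nonzero by (simp add: K_def)
    qed
    have lin: "a (l, 1) * (c1 * K 1) + a (l, 2) * (c2 * K 2) = 0" if l: "l \<in> I" "\<not> l \<le> m" for l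
    proof -
      have "coord 1 l (?N 1) = 0" using l by (simp only: coord_eq N 3) simp
      moreover have "D j l = a (l, j) * K j" for j using l by (simp add: D K_def coef_def)
      ultimately show ?thesis using eq'[OF l(1)] by (simp add: mult_ac)
    qed
    have "a (g - 1, 1) * a (g - 2, 2) \<noteq> a (g - 1, 2) * a (g - 2, 1)" using off_origin[OF S(7,8,11)] .
    from two_by_two_kernel[OF lin[OF S(7,9)] lin[OF S(8,10)] this]
    have "c1 = 0 \<and> c2 = 0" using K by simp
    moreover have "coord 1 1 (?N 1) \<noteq> 0"
      using coord_off_nodes[of "?N 1" 1 1] S by (simp only: N 3) simp
    ultimately show ?thesis by (intro step[OF _ S(1)])
  qed
qed

end

context generic_prym
begin

text \<open>
  Up to nonzero constants, the coordinates are the basis sections, after the change of sign on the second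
  component.
\<close>

lemma scaled_basis:
  assumes "l \<in> I"
  shows "(\<chi> j. smult (if j = 1 then 1 else -1) (prym_map g a d j l))
    = sconst (if l \<le> m then 1 else d / prym_A g a 2) * basis_sec m I a l"
proof -
  have "smult (if j = 1 then 1 else -1) (prym_map g a d j l)
      = smult (if l \<le> m then 1 else d / prym_A g a 2) (basis_sec m I a l $ j)" for j
    using exhaust_2[of j] A_nonzero[of 1] A_nonzero[of 2]
    by (auto simp: prym_map_def basis_sec_def lin_prod_def prym_d_def Let_def)
  then show ?thesis by (simp add: vec_eq_iff)
qed

lemma complete_linear_system:
  fixes b :: "nat \<Rightarrow> sec"
  defines "b \<equiv> \<lambda>l. \<chi> j. smult (if j = 1 then 1 else -1) (prym_map g a d j l)"
  assumes s: "s \<in> sec_ring m I a 1"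
  shows "\<exists>!w. w \<in> I \<rightarrow>\<^sub>E UNIV \<and> s = (\<Sum>l\<in>I. sec_scale (w l) (b l))"
proof -
  interpret koszul_basis I "basis_sec m I a" "basis_coord m I a" "sec_ring m I a 1"
    by (rule koszul_basis_sec_ring[OF good])
  define k where "k l = (if l \<le> m then 1 else d / prym_A g a 2)" for l
  have k: "k l \<noteq> 0" for l using d A_nonzero by (simp add: k_def)
  have b: "sec_scale c (b l) = sconst (c * k l) * basis_sec m I a l" if "l \<in> I" for c l
    unfolding b_def scaled_basis[OF that] k_def by (simp add: sec_scale_sconst sconst_mult mult.assoc)
  have sum_b: "(\<Sum>l\<in>I. sec_scale (w l) (b l)) = (\<Sum>l\<in>I. sconst (w l * k l) * basis_sec m I a l)" for w
    by (intro sum.cong refl) (rule b)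
  have coord_sum: "basis_coord m I a i (\<Sum>l\<in>A. f l) = (\<Sum>l\<in>A. basis_coord m I a i (f l))" for i A and f :: "nat \<Rightarrow> sec"
  proof -
    have zero: "basis_coord m I a i 0 = 0" by (simp add: basis_coord_def)
    show ?thesis by (induction A rule: infinite_finite_induct) (simp_all add: kappa_add zero del: One_nat_def)
  qed
  have coord_b: "basis_coord m I a i (\<Sum>l\<in>I. sec_scale (w l) (b l)) = w i * k i" if "i \<in> I" for w i
  proof -
    have "basis_coord m I a i (\<Sum>l\<in>I. sec_scale (w l) (b l)) = (\<Sum>l\<in>I. if l = i then w i * k i else 0)"
      unfolding sum_b coord_sum kappa_scale by (intro sum.cong refl) (simp add: kappa_E del: One_nat_def)
    then show ?thesis using that by simp
  qed
  show ?thesis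
  proof (rule ex1I[of _ "\<lambda>l. if l \<in> I then basis_coord m I a l s / k l else undefined"])
    let ?w = "\<lambda>l. if l \<in> I then basis_coord m I a l s / k l else undefined"
    have "(\<Sum>l\<in>I. sec_scale (?w l) (b l)) = (\<Sum>l\<in>I. sconst (basis_coord m I a l s) * basis_sec m I a l)"
      unfolding sum_b by (intro sum.cong refl) (simp add: k)
    then show "?w \<in> I \<rightarrow>\<^sub>E UNIV \<and> s = (\<Sum>l\<in>I. sec_scale (?w l) (b l))"
      using expand[OF s] by auto
    fix w assume w: "w \<in> I \<rightarrow>\<^sub>E UNIV \<and> s = (\<Sum>l\<in>I. sec_scale (w l) (b l))"
    show "w = ?w"
    proof
      fix l
      show "w l = ?w l"
      proof (cases "l \<in> I")
        case True
        have "basis_coord m I a l s = w l * k l"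
          using coord_b[OF True, of w] w by metis
        then show ?thesis using True k[of l] by simp
      next
        case False
        then show ?thesis using w by (auto simp: PiE_def extensional_def)
      qed
    qed
  qed
qed

theorem prym_canonical: "prym_canonical_binary_curve g a d"
proof -
  let ?X = "prym_curve g a" and ?L = "prym_canonical_bundle g a"
  have genus: "genus ?X = g" by (simp add: prym_curve_def)
  have deg: "deg ?L j = int (g - 1)" for j
    using g by (simp add: prym_canonical_bundle_def tensor_def dualizing_def prym_torsion_def prym_curve_def of_nat_diff)
  have sec: "sections ?X ?L = sec_ring m I a 1"
    using g by (intro prym_sections_1) simp
  have "binary_curve ?X"
  proof -
    have range: "l \<in> I \<or> l = g \<or> l = g + 1" if "l \<in> {1..g + 1}" for l using that by auto
    have nz: "node ?X l j \<noteq> (0, 0)" if "l \<in> {1..g + 1}" for l j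
      using range[OF that] by (auto simp: node_values node_values(3)[simplified])
    have cr: "cross (node ?X l j) (node ?X r j) \<noteq> 0" if "l \<in> {1..g + 1}" "r \<in> {1..g + 1}" "l \<noteq> r" for l r j
      using range[OF that(1)] range[OF that(2)] that(3) distinct_nodesD(2)[OF good] distinct_nodesD(3)[OF good]
      by (auto simp: node_values node_values(3)[simplified] cross_def simp del: One_nat_def)
    show ?thesis unfolding binary_curve_def genus using nz cr g by auto
  qed
  moreover have "embedded_by ?X ?L (g - 1) (prym_map g a d)"
  proof -
    have b_in: "(\<chi> j. smult (if j = 1 then 1 else -1) (prym_map g a d j l)) \<in> sec_ring m I a 1" if "l \<in> I" for l
      unfolding scaled_basis[OF that]
      by (intro sec_subspaceD(2)[OF sec_ring_subspace] basis_sec_in[OF good that])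
    have first: "\<exists>c :: 2 \<Rightarrow> complex. (\<forall>j. c j \<noteq> 0) \<and>
        (let b = (\<lambda>l. \<chi> j. smult (c j) (prym_map g a d j l)) :: nat \<Rightarrow> sec in
           (\<forall>l\<in>{1..g - 1}. b l \<in> sections ?X ?L) \<and>
           (\<forall>s\<in>sections ?X ?L. \<exists>!w. w \<in> {1..g - 1} \<rightarrow>\<^sub>E UNIV \<and> s = (\<Sum>l=1..g - 1. sec_scale (w l) (b l))))"
      unfolding sec Let_def
    proof (intro exI[of _ "\<lambda>j. if j = 1 then 1 else -1"] conjI allI ballI)
      show "(if j = 1 then 1 else -1 :: complex) \<noteq> 0" for j :: 2 by simp
    qed (use b_in complete_linear_system in blast)+
    have e: "form_eval (int (g - 1)) (prym_map g a d j l) v = coord j l v" for j l v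
      by (simp add: coord_def)
    have dd: "form_dderiv (int (g - 1)) (prym_map g a d j l) v w
        = deriv (\<lambda>z. coord j l (fst v + z * fst w, snd v + z * snd w)) 0" for j l v w
      by (simp add: form_dderiv_def coord_def)
    show ?thesis
      unfolding embedded_by_def genus deg e dd
    proof (intro conjI allI impI)
      show "\<exists>l\<in>I. coord j l v \<noteq> 0" if "v \<noteq> (0, 0)" for j v using that by (rule base_point_free)
      show "cross v w = 0" if "v \<noteq> (0, 0)" "w \<noteq> (0, 0)" "\<forall>l\<in>I. coord j l w = c * coord j l v" for j v w c
        using that by (intro injective_on_component[of v w j c]) auto
      show "\<exists>r\<in>{1..g + 1}. cross v (node ?X r 1) = 0 \<and> cross w (node ?X r 2) = 0"
        if "v \<noteq> (0, 0)" "w \<noteq> (0, 0)" "\<forall>l\<in>I. coord 2 l w = c * coord 1 l v" for v w c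
        using that by (intro meet_only_at_nodes[of v w c]) auto
      show "\<exists>l\<in>I. deriv (\<lambda>z. coord j l (fst v + z * fst w, snd v + z * snd w)) 0 \<noteq> c * coord j l v"
        if "v \<noteq> (0, 0)" "cross v w \<noteq> 0" for j v w c
        using that by (rule immersion)
      show "\<forall>r\<in>{1..g + 1}. \<forall>w1 w2 c c1 c2. cross (node ?X r 1) w1 \<noteq> 0 \<longrightarrow> cross (node ?X r 2) w2 \<noteq> 0 \<longrightarrow>
          (\<forall>l\<in>I. c * coord 1 l (node ?X r 1)
            + c1 * deriv (\<lambda>z. coord 1 l (fst (node ?X r 1) + z * fst w1, snd (node ?X r 1) + z * snd w1)) 0
            + c2 * deriv (\<lambda>z. coord 2 l (fst (node ?X r 2) + z * fst w2, snd (node ?X r 2) + z * snd w2)) 0 = 0) \<longrightarrow>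
          c = 0 \<and> c1 = 0 \<and> c2 = 0"
        using tangents_distinct by blast
    qed (rule first)
  qed
  ultimately show ?thesis by (simp add: prym_canonical_binary_curve_def)
qed

end

section \<open>Generic parameters\<close>

text \<open>
  Restriction to lines reduces the irreducibility of affine space to polynomials in one variable.
\<close>

lemma polynomial_fun_on_line:
  assumes "polynomial_fun K f"
  shows "\<exists>P. \<forall>t. f (\<lambda>i. x i + t * (y i - x i)) = poly P t"
  using assms
proof (induction rule: polynomial_fun.induct)
  case (const c)
  show ?case by (intro exI[of _ "[:c:]"]) simp
next
  case (coord i)
  show ?case by (intro exI[of _ "[:x i, y i - x i:]"]) (simp add: mult.commute)
next
  case (add f h)
  then obtain P Q where "\<forall>t. f (\<lambda>i. x i + t * (y i - x i)) = poly P t" "\<forall>t. h (\<lambda>i. x i + t * (y i - x i)) = poly Q t"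
    by blast
  then show ?case by (intro exI[of _ "P + Q"]) simp
next
  case (mult f h)
  then obtain P Q where "\<forall>t. f (\<lambda>i. x i + t * (y i - x i)) = poly P t" "\<forall>t. h (\<lambda>i. x i + t * (y i - x i)) = poly Q t"
    by blast
  then show ?case by (intro exI[of _ "P * Q"]) simp
qed

lemma common_nonzero:
  assumes "polynomial_fun K f" "polynomial_fun K h" "x \<in> K \<rightarrow>\<^sub>E UNIV" "y \<in> K \<rightarrow>\<^sub>E UNIV" "f x \<noteq> 0" "h y \<noteq> 0"
  shows "\<exists>z\<in>K \<rightarrow>\<^sub>E UNIV. f z * h z \<noteq> 0"
proof -
  let ?L = "\<lambda>t i. x i + t * (y i - x i)"
  obtain P Q where P: "\<And>t. f (?L t) = poly P t" and Q: "\<And>t. h (?L t) = poly Q t"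
    using polynomial_fun_on_line[OF assms(1)] polynomial_fun_on_line[OF assms(2)] by metis
  have "P \<noteq> 0" using P[of 0] assms(5) by auto
  moreover have "Q \<noteq> 0" using Q[of 1] assms(6) by auto
  ultimately have "finite {t. poly (P * Q) t = 0}" by (intro poly_roots_finite) simp
  then obtain t where t: "poly (P * Q) t \<noteq> 0"
    using ex_new_if_finite[OF infinite_UNIV_char_0] by blast
  have "?L t i = undefined" if "i \<notin> K" for i
    using assms(3,4) that by (simp add: PiE_def extensional_def)
  then have "?L t \<in> K \<rightarrow>\<^sub>E UNIV" by (simp add: PiE_def extensional_def)
  then show ?thesis using t P Q by (intro bexI[of _ "?L t"]) auto
qed

lemma common_nonzero_family:
  assumes "finite S" "\<And>s. s \<in> S \<Longrightarrow> polynomial_fun K (f s)" "\<And>s. s \<in> S \<Longrightarrow> \<exists>x\<in>K \<rightarrow>\<^sub>E UNIV. f s x \<noteq> 0"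
  shows "\<exists>z\<in>K \<rightarrow>\<^sub>E UNIV. (\<Prod>s\<in>S. f s z) \<noteq> 0"
  using assms
proof (induction S rule: finite_induct)
  case empty
  show ?case by (intro bexI[of _ "\<lambda>_. undefined"]) auto
next
  case (insert s S)
  obtain x where x: "x \<in> K \<rightarrow>\<^sub>E UNIV" "f s x \<noteq> 0" using insert.prems(2)[of s] by blast
  obtain y where y: "y \<in> K \<rightarrow>\<^sub>E UNIV" "(\<Prod>s\<in>S. f s y) \<noteq> 0" using insert.IH insert.prems by blast
  have "polynomial_fun K (\<lambda>z. \<Prod>s\<in>S. f s z)" using insert.prems(1) by (intro polynomial_fun_prod) auto
  moreover have "polynomial_fun K (f s)" by (rule insert.prems(1)) simp
  ultimately have "\<exists>z\<in>K \<rightarrow>\<^sub>E UNIV. f s z * (\<Prod>s\<in>S. f s z) \<noteq> 0"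
    using x y by (intro common_nonzero[where f = "f s" and h = "\<lambda>z. \<Prod>s\<in>S. f s z" and x = x and y = y])
  then show ?case using insert.hyps by simp
qed

lemma polynomial_fun_local:
  assumes "polynomial_fun K f" "\<And>i. i \<in> K \<Longrightarrow> x i = y i"
  shows "f x = f y"
  using assms by (induction rule: polynomial_fun.induct) auto

lemma polynomial_fun_substitute:
  assumes "polynomial_fun K f" "\<And>i. i \<in> K \<Longrightarrow> \<sigma> i \<in> K'"
  shows "polynomial_fun K' (\<lambda>x. f (\<lambda>i. x (\<sigma> i)))"
  using assms by (induction rule: polynomial_fun.induct) (auto intro: polynomial_fun_intros)

text \<open>
  The conditions are the nonvanishing of finitely many polynomials; points with distinct positive abscissas
  on a parabola satisfy them.
\<close>

lemma generic_params_polynomial: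
  "\<exists>f. polynomial_fun (prym_indices g) f \<and> (\<forall>a. f a \<noteq> 0 \<longrightarrow> generic_params g a) \<and>
     (\<exists>a\<in>prym_indices g \<rightarrow>\<^sub>E UNIV. f a \<noteq> 0)"
proof -
  let ?I = "{1..g - 1}"
  define P2 where "P2 = {(p, q). p \<in> ?I \<and> q \<in> ?I \<and> p \<noteq> q}"
  define P3 where "P3 = {(p, q, r). p \<in> ?I \<and> q \<in> ?I \<and> r \<in> ?I \<and> p \<noteq> q \<and> p \<noteq> r \<and> q \<noteq> r}"
  have "P2 \<subseteq> ?I \<times> ?I" "P3 \<subseteq> ?I \<times> ?I \<times> ?I" by (auto simp: P2_def P3_def)
  then have fin: "finite P2" "finite P3" by (auto intro: finite_subset)
  define f1 where "f1 a = (\<Prod>l\<in>?I. \<Prod>j\<in>UNIV. a (l, j))" for a :: "nat \<times> 2 \<Rightarrow> complex"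
  define f2 where "f2 a = (\<Prod>(p, q)\<in>P2. \<Prod>j\<in>UNIV. a (p, j) - a (q, j))" for a :: "nat \<times> 2 \<Rightarrow> complex"
  define f3 where "f3 a = (\<Prod>(p, q)\<in>P2. a (p, 1) * a (q, 2) - a (p, 2) * a (q, 1))" for a :: "nat \<times> 2 \<Rightarrow> complex"
  define f4 where "f4 a = (\<Prod>(p, q, r)\<in>P3. (a (r, 1) - a (p, 1)) * (a (r, 2) - a (q, 2)) - (a (r, 2) - a (p, 2)) * (a (r, 1) - a (q, 1)))"
    for a :: "nat \<times> 2 \<Rightarrow> complex"
  define f where "f a = f1 a * f2 a * (f3 a * f4 a)" for a
  have "polynomial_fun (prym_indices g) f"
    unfolding f_def[abs_def] f1_def f2_def f3_def f4_def split_def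
    by (intro polynomial_fun_intros) (auto simp: prym_indices_def P2_def P3_def)
  moreover have "generic_params g a" if "f a \<noteq> 0" for a
  proof -
    have nz: "f1 a \<noteq> 0" "f2 a \<noteq> 0" "f3 a \<noteq> 0" "f4 a \<noteq> 0" using that by (auto simp: f_def)
    have 1: "a (l, j) \<noteq> 0" if "l \<in> ?I" for l j
      using nz(1) that by (simp add: f1_def)
    have 2: "a (p, j) \<noteq> a (q, j)" if "(p, q) \<in> P2" for p q j
      using nz(2) that fin by (auto simp: f2_def)
    have 3: "a (p, 1) * a (q, 2) \<noteq> a (p, 2) * a (q, 1)" if "(p, q) \<in> P2" for p q
      using nz(3) that fin by (fastforce simp: f3_def)
    have 4: "(a (r, 1) - a (p, 1)) * (a (r, 2) - a (q, 2)) \<noteq> (a (r, 2) - a (p, 2)) * (a (r, 1) - a (q, 1))" if "(p, q, r) \<in> P3" for p q r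
      using nz(4) that fin by (fastforce simp: f4_def)
    show ?thesis
      unfolding generic_params_def distinct_nodes_def using 1 2 3 4 by (auto simp: P2_def P3_def)
  qed
  moreover have "\<exists>a\<in>prym_indices g \<rightarrow>\<^sub>E UNIV. f a \<noteq> 0"
  proof
    define a :: "nat \<times> 2 \<Rightarrow> complex" where
      "a = (\<lambda>i. if i \<in> prym_indices g then (if snd i = 1 then of_nat (fst i) else of_nat (fst i) ^ 2) else undefined)"
    show "a \<in> prym_indices g \<rightarrow>\<^sub>E UNIV" by (auto simp: a_def)
    have a1: "a (l, 1) = of_nat l" and a2: "a (l, 2) = of_nat l ^ 2" if "l \<in> ?I" for l
      using that by (auto simp: a_def prym_indices_def)
    have "f1 a \<noteq> 0"
      unfolding f1_def by (auto simp: a_def prym_indices_def)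
    moreover have "f2 a \<noteq> 0"
    proof -
      have "a (p, j) - a (q, j) \<noteq> 0" if "p \<in> ?I" "q \<in> ?I" "p \<noteq> q" for p q j
      proof -
        have "(of_nat p :: complex) ^ 2 \<noteq> of_nat q ^ 2"
          using that(3) unfolding of_nat_power[symmetric] of_nat_eq_iff by (simp add: power2_eq_iff)
        then show ?thesis using that exhaust_2[of j] by (auto simp: a1 a2)
      qed
      then show ?thesis unfolding f2_def using fin by (auto simp: P2_def)
    qed
    moreover have "f3 a \<noteq> 0"
    proof -
      have "a (p, 1) * a (q, 2) - a (p, 2) * a (q, 1) \<noteq> 0" if "p \<in> ?I" "q \<in> ?I" "p \<noteq> q" for p q
      proof -
        have "a (p, 1) * a (q, 2) - a (p, 2) * a (q, 1) = of_nat p * of_nat q * (of_nat q - of_nat p)"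
          by (simp add: a1[OF that(1)] a1[OF that(2)] a2[OF that(1)] a2[OF that(2)] algebra_simps power2_eq_square)
        then show ?thesis using that by auto
      qed
      then show ?thesis unfolding f3_def using fin by (auto simp: P2_def)
    qed
    moreover have "f4 a \<noteq> 0"
    proof -
      have "(a (r, 1) - a (p, 1)) * (a (r, 2) - a (q, 2)) - (a (r, 2) - a (p, 2)) * (a (r, 1) - a (q, 1)) \<noteq> 0"
        if "p \<in> ?I" "q \<in> ?I" "r \<in> ?I" "p \<noteq> q" "p \<noteq> r" "q \<noteq> r" for p q r
      proof -
        have "(a (r, 1) - a (p, 1)) * (a (r, 2) - a (q, 2)) - (a (r, 2) - a (p, 2)) * (a (r, 1) - a (q, 1))
            = (of_nat r - of_nat p) * (of_nat r - of_nat q) * (of_nat q - of_nat p)"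
          by (simp add: a1[OF that(1)] a1[OF that(2)] a1[OF that(3)] a2[OF that(1)] a2[OF that(2)] a2[OF that(3)]
              algebra_simps power2_eq_square)
        then show ?thesis using that by auto
      qed
      then show ?thesis unfolding f4_def using fin by (auto simp: P3_def)
    qed
    ultimately show "f a \<noteq> 0" by (simp add: f_def)
  qed
  ultimately show ?thesis by blast
qed

lemma binary_curve_distinct_nodes:
  assumes "binary_curve (prym_curve g a)" "g \<ge> 2"
  shows "distinct_nodes {1..g - 1} a"
proof -
  let ?X = "prym_curve g a"
  have genus: "genus ?X = g" by (simp add: prym_curve_def)
  have cr: "cross (node ?X l j) (node ?X r j) \<noteq> 0" if "l \<in> {1..g + 1}" "r \<in> {1..g + 1}" "l \<noteq> r" for l r j
    using assms(1) that unfolding binary_curve_def genus by blast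
  have node: "node ?X l j = (a (l, j), 1)" if "l \<in> {1..g - 1}" for l j
    using that by (simp add: prym_curve_def)
  have "a (l, j) \<noteq> 0" if "l \<in> {1..g - 1}" for l j
  proof -
    have "l \<in> {1..g + 1}" "g \<in> {1..g + 1}" "l \<noteq> g" using that assms(2) by auto
    moreover have "node ?X g j = (0, 1)" using assms(2) by (auto simp: prym_curve_def)
    ultimately show ?thesis using cr[of l g j] node[OF that, of j] by (simp add: cross_def)
  qed
  moreover have "a (l, j) \<noteq> a (r, j)" if "l \<in> {1..g - 1}" "r \<in> {1..g - 1}" "l \<noteq> r" for l r j
  proof -
    have "l \<in> {1..g + 1}" "r \<in> {1..g + 1}" using that by auto
    then show ?thesis using cr[of l r j] that node[OF that(1), of j] node[OF that(2), of j] by (simp add: cross_def)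
  qed
  ultimately show ?thesis unfolding distinct_nodes_def by blast
qed

definition skip :: "nat \<Rightarrow> nat \<Rightarrow> nat" where
  "skip s l = (if l < s then l else l + 1)"

lemma bij_skip: "s \<in> {1..n + 1} \<Longrightarrow> bij_betw (skip s) {1..n} ({1..n + 1} - {s})"
proof (rule bij_betwI[where g = "\<lambda>l. if l < s then l else l - 1"])
qed (auto simp: skip_def split: if_splits)

theorem corollary3p3:
  fixes k :: nat and a' :: "nat \<times> 2 \<Rightarrow> complex" and d' d :: complex
  assumes "k \<ge> 3"
    and "a' \<in> prym_indices (2 * k) \<rightarrow>\<^sub>E UNIV" and "d' \<noteq> 0"
    and "prym_canonical_binary_curve (2 * k) a' d'"
    and "prym_green (prym_curve (2 * k) a') (prym_canonical_bundle (2 * k) a')"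
    and "d \<noteq> 0"
  shows "\<exists>U. zariski_open (prym_indices (2 * k + 1)) U \<and> U \<noteq> {} \<and>
    (\<forall>a\<in>U. prym_canonical_binary_curve (2 * k + 1) a d \<and>
       prym_green (prym_curve (2 * k + 1) a) (prym_canonical_bundle (2 * k + 1) a))"
proof -
  let ?J = "{1..2 * k - 1}" and ?I = "{1..2 * k}" and ?S = "{k + 1..2 * k}"
  let ?K = "prym_indices (2 * k)" and ?K' = "prym_indices (2 * k + 1)"
  let ?exact = "\<lambda>I a p. koszul_exact I (basis_sec k I a) p (sec_ring k I a 1) (sec_ring k I a 2)"
  have K: "?K = ?J \<times> UNIV" and K': "?K' = ?I \<times> UNIV" by (simp_all add: prym_indices_def)
  have good': "distinct_nodes ?J a'"
    using assms(1,4) by (intro binary_curve_distinct_nodes) (simp_all add: prym_canonical_binary_curve_def)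
  have "\<exists>f. polynomial_fun ?K f \<and> f a' \<noteq> 0 \<and> (\<forall>a. distinct_nodes ?J a \<and> f a \<noteq> 0 \<longrightarrow> ?exact ?J a p)" if p: "p + 3 \<le> k" for p
  proof -
    have "koszul_vanishes (prym_curve (2 * k) a') (prym_canonical_bundle (2 * k) a') p 2"
      using assms(5) p unfolding prym_green_def by (simp add: prym_curve_def)
    then have "?exact ?J a' p"
      using koszul_vanishes_iff[of "2 * k" a' p] good' assms(1) by simp
    from koszul_exact_open[OF good' this] show ?thesis unfolding K .
  qed
  then obtain F where F: "\<And>p. p + 3 \<le> k \<Longrightarrow> polynomial_fun ?K (F p)" "\<And>p. p + 3 \<le> k \<Longrightarrow> F p a' \<noteq> 0"
    and F_exact: "\<And>p a. p + 3 \<le> k \<Longrightarrow> distinct_nodes ?J a \<Longrightarrow> F p a \<noteq> 0 \<Longrightarrow> ?exact ?J a p" by metis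
  \<comment> \<open>The nonvanishing of \<open>f\<close> is an open condition on curves of genus \<open>2k\<close> that gives all vanishings.\<close>
  define f where "f a = (\<Prod>p\<in>{..k - 3}. F p a)" for a
  have range: "p \<in> {..k - 3} \<longleftrightarrow> p + 3 \<le> k" for p using assms(1) by auto
  have f: "polynomial_fun ?K f" "f a' \<noteq> 0"
  proof -
    show "polynomial_fun ?K f"
      unfolding f_def[abs_def] by (intro polynomial_fun_prod F(1)) (simp only: range)
    have "F p a' \<noteq> 0" if "p \<in> {..k - 3}" for p using F(2) that unfolding range .
    then show "f a' \<noteq> 0" by (simp add: f_def)
  qed
  have f_exact: "?exact ?J a p" if p: "p + 3 \<le> k" and a: "distinct_nodes ?J a" "f a \<noteq> 0" for a p
  proof -
    have "F p a \<noteq> 0"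
    proof
      assume "F p a = 0"
      then have "f a = 0" unfolding f_def using p by (intro prod_zero) (auto simp: range simp del: atMost_iff)
      then show False using a by simp
    qed
    then show ?thesis using F_exact p a by blast
  qed
  define restrict_params where "restrict_params s a = (\<lambda>(l, j). a (skip s l, j))" for s and a :: "nat \<times> 2 \<Rightarrow> complex"
  have skip: "bij_betw (skip s) ?J (?I - {s})" if "s \<in> ?I" for s
    using bij_skip[of s "2 * k - 1"] that assms(1) by simp
  have skip_in: "skip s l \<in> ?I - {s}" if "s \<in> ?I" "l \<in> ?J" for s l
    using bij_betwE[OF skip[OF that(1)]] that(2) by blast
  have fs: "polynomial_fun ?K' (\<lambda>a. f (restrict_params s a))" if "s \<in> ?I" for s
    unfolding restrict_params_def split_def
  proof (rule polynomial_fun_substitute[OF f(1)])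
    fix i assume "i \<in> ?K"
    then have "fst i \<in> ?J" unfolding K by auto
    then show "(skip s (fst i), snd i) \<in> ?K'" unfolding K' using skip_in[OF that] by blast
  qed
  have fs_nonzero: "\<exists>a\<in>?K' \<rightarrow>\<^sub>E UNIV. f (restrict_params s a) \<noteq> 0" if s: "s \<in> ?I" for s
  proof
    define a where "a = (\<lambda>(l, j). if (l, j) \<in> ?K' then a' (if l < s then l else l - 1, j) else undefined)"
    show "a \<in> ?K' \<rightarrow>\<^sub>E UNIV" by (auto simp: a_def)
    have "restrict_params s a (l, j) = a' (l, j)" if "l \<in> ?J" for l j
    proof -
      have "(skip s l, j) \<in> ?K'" unfolding K' using skip_in[OF s that] by blast
      then show ?thesis by (simp add: restrict_params_def a_def) (simp add: skip_def)
    qed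
    then have "f (restrict_params s a) = f a'"
      by (intro polynomial_fun_local[OF f(1)]) (auto simp: K)
    then show "f (restrict_params s a) \<noteq> 0" using f(2) by simp
  qed
  obtain G where G: "polynomial_fun ?K' G" "\<And>a. G a \<noteq> 0 \<Longrightarrow> generic_params (2 * k + 1) a"
    and G_nonzero: "\<exists>a\<in>?K' \<rightarrow>\<^sub>E UNIV. G a \<noteq> 0"
    using generic_params_polynomial[of "2 * k + 1"] by metis
  \<comment> \<open>The condition \<open>f\<close> is imposed on all \<open>k\<close> projections.\<close>
  define h where "h a = G a * (\<Prod>s\<in>?S. f (restrict_params s a))" for a
  have S: "s \<in> ?I" if "s \<in> ?S" for s using that by auto
  have prod_pol: "polynomial_fun ?K' (\<lambda>a. \<Prod>s\<in>?S. f (restrict_params s a))"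
    by (intro polynomial_fun_prod fs S)
  have h: "polynomial_fun ?K' h"
    unfolding h_def[abs_def] by (intro polynomial_fun.mult G(1) prod_pol)
  obtain y where y: "y \<in> ?K' \<rightarrow>\<^sub>E UNIV" "(\<Prod>s\<in>?S. f (restrict_params s y)) \<noteq> 0"
    using common_nonzero_family[of ?S ?K' "\<lambda>s a. f (restrict_params s a)"] fs fs_nonzero S by auto
  obtain x where x: "x \<in> ?K' \<rightarrow>\<^sub>E UNIV" "G x \<noteq> 0" using G_nonzero by blast
  define U where "U = {a \<in> ?K' \<rightarrow>\<^sub>E UNIV. \<exists>h\<in>{h}. h a \<noteq> 0}"
  have "zariski_open ?K' U"
    unfolding zariski_open_def U_def using h by (intro exI[of _ "{h}"]) simp
  moreover have "U \<noteq> {}"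
    using common_nonzero[where f = G and h = "\<lambda>a. \<Prod>s\<in>?S. f (restrict_params s a)" and x = x and y = y,
        OF G(1) prod_pol x(1) y(1) x(2) y(2)] by (auto simp: U_def h_def)
  moreover have "prym_canonical_binary_curve (2 * k + 1) a d \<and>
       prym_green (prym_curve (2 * k + 1) a) (prym_canonical_bundle (2 * k + 1) a)" if "a \<in> U" for a
  proof
    have nz: "G a \<noteq> 0" "\<And>s. s \<in> ?S \<Longrightarrow> f (restrict_params s a) \<noteq> 0"
      using that by (auto simp: U_def h_def)
    interpret generic_prym "2 * k + 1" a d
      using assms(1,6) G(2)[OF nz(1)] by unfold_locales auto
    show "prym_canonical_binary_curve (2 * k + 1) a d" by (rule prym_canonical)
    have good_I: "distinct_nodes ?I a" using good by simp
    have "?exact ?I a p" if p: "p + 3 \<le> k" for p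
    proof (rule koszul_exact_from_projections[OF good_I, of ?S])
      show "?S \<subseteq> ?I" by auto
      show "\<exists>l\<in>?I. l \<le> k" using assms(1) by (intro bexI[of _ 1]) auto
      show "p + 3 \<le> card ?S" using p by simp
      show "k < s" if "s \<in> ?S" for s using that by simp
      fix s assume s: "s \<in> ?S"
      have "distinct_nodes ?J (restrict_params s a)"
        unfolding distinct_nodes_def
      proof (intro conjI allI ballI impI)
        fix j l assume l: "l \<in> ?J"
        show "restrict_params s a (l, j) \<noteq> 0"
          using distinct_nodesD(2)[OF good_I] skip_in[OF S[OF s] l] by (simp add: restrict_params_def)
        fix r assume r: "r \<in> ?J" "l \<noteq> r"
        have "skip s l \<noteq> skip s r" using r(2) by (simp add: skip_def)
        then show "restrict_params s a (l, j) \<noteq> restrict_params s a (r, j)"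
          using distinct_nodesD(3)[OF good_I, of "skip s l" "skip s r" j] skip_in[OF S[OF s] l] skip_in[OF S[OF s] r(1)]
          by (simp add: restrict_params_def)
      qed simp
      then have "?exact ?J (restrict_params s a) p" using f_exact[OF p] nz(2)[OF s] by blast
      then show "?exact (?I - {s}) a p"
      proof (rule koszul_exact_relabel[OF skip[OF S[OF s]], rotated 2])
        show "skip s l \<le> k \<longleftrightarrow> l \<le> k" for l using s by (auto simp: skip_def)
        show "restrict_params s a (l, j) = a (skip s l, j)" for l j by (simp add: restrict_params_def)
      qed
    qed
    then have "koszul_vanishes (prym_curve (2 * k + 1) a) (prym_canonical_bundle (2 * k + 1) a) p 2" if "p + 3 \<le> k" for p
      using koszul_vanishes_iff[of "2 * k + 1" a p] good assms(1) that by simp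
    then show "prym_green (prym_curve (2 * k + 1) a) (prym_canonical_bundle (2 * k + 1) a)"
      unfolding prym_green_def by (simp add: prym_curve_def)
  qed
  ultimately show ?thesis by blast
qed

end
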